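(* Let $X \subseteq \mathbb{N}$ be finite and fixed. Given an instance $G$ of $X$-AntiFactor together with a tree decomposition of $G$ of width $\mathrm{tw}$, one can compute, for every integer $s$ simultaneously, the number of solutions $S$ of size exactly $|S|=s$, in time $(\max X+2)^{\mathrm{tw}}\cdot n^{O(1)}$, where $n$ is the number of vertices of $G$.
   Context: For a fixed set $X\subseteq\mathbb{N}$, an instance of $X$-AntiFactor is an undirected graph $G=(V,E)$; a solution is a set $S\subseteq E$ such that for every vertex $v\in V$ the number $\deg_S(v)$ of edges of $S$ incident to $v$ satisfies $\deg_S(v)\notin X$. The size of a solution $S$ is $|S|$. *)

theory Defs
  imports "HOL-Library.Log_Nat" "HOL-Computational_Algebra.Polynomial"
begin

section \<open>Graphs and AntiFactor\<close>

definition simple_graph :: "'a set \<Rightarrow> 'a set set \<Rightarrow> bool" where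
  "simple_graph V E \<longleftrightarrow> finite V \<and> (\<forall>e\<in>E. e \<subseteq> V \<and> card e = 2)"

definition degree_in :: "'a set set \<Rightarrow> 'a \<Rightarrow> nat" where
  "degree_in S v = card {e \<in> S. v \<in> e}"

definition antifactor_solution :: "nat set \<Rightarrow> 'a set \<Rightarrow> 'a set set \<Rightarrow> 'a set set \<Rightarrow> bool" where
  "antifactor_solution X V E S \<longleftrightarrow> S \<subseteq> E \<and> (\<forall>v\<in>V. degree_in S v \<notin> X)"


section \<open>Tree decompositions\<close>

definition connected_in :: "'a set set \<Rightarrow> 'a set \<Rightarrow> bool" where
  "connected_in F W \<longleftrightarrow> W \<noteq> {} \<and>
     (\<forall>u\<in>W. \<forall>v\<in>W. (u, v) \<in> {(x, y). x \<in> W \<and> y \<in> W \<and> {x, y} \<in> F}\<^sup>*)"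

definition is_cycle :: "'a set set \<Rightarrow> 'a list \<Rightarrow> bool" where
  "is_cycle F xs \<longleftrightarrow> 3 \<le> length xs \<and> distinct xs \<and>
     (\<forall>i<length xs. {xs ! i, xs ! (Suc i mod length xs)} \<in> F)"

definition is_tree :: "'a set \<Rightarrow> 'a set set \<Rightarrow> bool" where
  "is_tree I F \<longleftrightarrow> simple_graph I F \<and> connected_in F I \<and> (\<nexists>xs. is_cycle F xs)"

text \<open>Since \<open>connected_in\<close> entails nonemptiness, the last conjunct also says that every vertex
  occurs in some bag.\<close>

definition tree_decomposition ::
    "'a set \<Rightarrow> 'a set set \<Rightarrow> 'b set \<Rightarrow> 'b set set \<Rightarrow> ('b \<Rightarrow> 'a set) \<Rightarrow> bool" where
  "tree_decomposition V E I F B \<longleftrightarrow>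
     is_tree I F \<and>
     (\<forall>t\<in>I. B t \<subseteq> V) \<and>
     (\<forall>e\<in>E. \<exists>t\<in>I. e \<subseteq> B t) \<and>
     (\<forall>v\<in>V. connected_in F {t \<in> I. v \<in> B t})"

definition td_width :: "'b set \<Rightarrow> ('b \<Rightarrow> 'a set) \<Rightarrow> nat" where
  "td_width I B = Max ((\<lambda>t. card (B t)) ` I) - 1"


section \<open>The machine model: a random access machine with logarithmic cost\<close>

text \<open>
  The memory of the random access machine is organised as named arrays of integer cells (a program
  mentions only finitely many names, so the arrays can be interleaved in one memory). Programs are
  structured while-programs. As in the logarithmic cost criterion of Aho, Hopcroft and Ullman, every
  operation is charged the binary length of its operands, and every memory access is charged the
  length of the address plus the length of the cell content; so neither big numbers nor big
  addresses come for free.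
\<close>

type_synonym store = "string \<Rightarrow> int \<Rightarrow> int"

datatype aexp =
    Const int
  | Read string aexp
  | Add aexp aexp
  | Sub aexp aexp
  | Mul aexp aexp
  | Div aexp aexp

datatype com =
    Skip
  | Write string aexp aexp
  | Seq com com
  | IfPos aexp com com
  | WhilePos aexp com

definition len :: "int \<Rightarrow> nat" where
  "len i = max 1 (floorlog 2 (nat \<bar>i\<bar>))"

fun aval :: "aexp \<Rightarrow> store \<Rightarrow> int" where
  "aval (Const k) \<sigma> = k"
| "aval (Read a e) \<sigma> = \<sigma> a (aval e \<sigma>)"
| "aval (Add e f) \<sigma> = aval e \<sigma> + aval f \<sigma>"
| "aval (Sub e f) \<sigma> = aval e \<sigma> - aval f \<sigma>"
| "aval (Mul e f) \<sigma> = aval e \<sigma> * aval f \<sigma>"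
| "aval (Div e f) \<sigma> = aval e \<sigma> div aval f \<sigma>"

fun acost :: "aexp \<Rightarrow> store \<Rightarrow> nat" where
  "acost (Const k) \<sigma> = len k"
| "acost (Read a e) \<sigma> = acost e \<sigma> + len (aval e \<sigma>) + len (\<sigma> a (aval e \<sigma>))"
| "acost (Add e f) \<sigma> = acost e \<sigma> + acost f \<sigma> + len (aval e \<sigma>) + len (aval f \<sigma>)"
| "acost (Sub e f) \<sigma> = acost e \<sigma> + acost f \<sigma> + len (aval e \<sigma>) + len (aval f \<sigma>)"
| "acost (Mul e f) \<sigma> = acost e \<sigma> + acost f \<sigma> + len (aval e \<sigma>) + len (aval f \<sigma>)"
| "acost (Div e f) \<sigma> = acost e \<sigma> + acost f \<sigma> + len (aval e \<sigma>) + len (aval f \<sigma>)"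

text \<open>\<open>exec c \<sigma> t \<tau>\<close>: started in store \<open>\<sigma>\<close>, the program \<open>c\<close> halts in store \<open>\<tau>\<close> after time \<open>t\<close>.
  Conditionals and loops test whether the value of the expression is positive.\<close>

inductive exec :: "com \<Rightarrow> store \<Rightarrow> nat \<Rightarrow> store \<Rightarrow> bool" where
  Skip: "exec Skip \<sigma> 1 \<sigma>"
| Write: "exec (Write a e f) \<sigma>
     (acost e \<sigma> + acost f \<sigma> + len (aval e \<sigma>) + len (aval f \<sigma>))
     (\<sigma>(a := (\<sigma> a)(aval e \<sigma> := aval f \<sigma>)))"
| Seq: "exec c \<sigma> t \<sigma>' \<Longrightarrow> exec d \<sigma>' t' \<sigma>'' \<Longrightarrow> exec (Seq c d) \<sigma> (t + t') \<sigma>''"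
| IfTrue: "aval e \<sigma> > 0 \<Longrightarrow> exec c \<sigma> t \<sigma>' \<Longrightarrow>
     exec (IfPos e c d) \<sigma> (acost e \<sigma> + len (aval e \<sigma>) + t) \<sigma>'"
| IfFalse: "\<not> aval e \<sigma> > 0 \<Longrightarrow> exec d \<sigma> t \<sigma>' \<Longrightarrow>
     exec (IfPos e c d) \<sigma> (acost e \<sigma> + len (aval e \<sigma>) + t) \<sigma>'"
| WhileFalse: "\<not> aval e \<sigma> > 0 \<Longrightarrow>
     exec (WhilePos e c) \<sigma> (acost e \<sigma> + len (aval e \<sigma>)) \<sigma>"
| WhileTrue: "aval e \<sigma> > 0 \<Longrightarrow> exec c \<sigma> t \<sigma>' \<Longrightarrow> exec (WhilePos e c) \<sigma>' t' \<sigma>'' \<Longrightarrow>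
     exec (WhilePos e c) \<sigma> (acost e \<sigma> + len (aval e \<sigma>) + t + t') \<sigma>''"

inductive_cases SkipE: "exec Skip \<sigma> t \<tau>"
inductive_cases WriteE: "exec (Write a e f) \<sigma> t \<tau>"
inductive_cases SeqE: "exec (Seq c d) \<sigma> t \<tau>"
inductive_cases IfE: "exec (IfPos e c d) \<sigma> t \<tau>"
inductive_cases WhileE: "exec (WhilePos e c) \<sigma> t \<tau>"

lemma exec_deterministic:
  "exec c \<sigma> t \<tau> \<Longrightarrow> exec c \<sigma> t' \<tau>' \<Longrightarrow> t' = t \<and> \<tau>' = \<tau>"
proof (induction arbitrary: t' \<tau>' rule: exec.induct)
  case (Skip \<sigma>)
  from Skip show ?case by (rule SkipE) simp
next
  case (Write a e f \<sigma>)
  from Write show ?case by (rule WriteE) simp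
next
  case (Seq c \<sigma> t \<sigma>' d t'' \<sigma>'')
  from Seq.prems show ?case by (rule SeqE) (use Seq.IH in metis)
next
  case (IfTrue e \<sigma> c t \<sigma>' d)
  from IfTrue.prems show ?case by (rule IfE) (use IfTrue.IH IfTrue.hyps(1) in metis)+
next
  case (IfFalse e \<sigma> d t \<sigma>' c)
  from IfFalse.prems show ?case by (rule IfE) (use IfFalse.IH IfFalse.hyps(1) in metis)+
next
  case (WhileFalse e \<sigma> c)
  from WhileFalse.prems show ?case by (rule WhileE) (use WhileFalse.hyps in metis)+
next
  case (WhileTrue e \<sigma> c t \<sigma>' t'' \<sigma>'')
  from WhileTrue.prems show ?case by (rule WhileE) (use WhileTrue.IH WhileTrue.hyps(1) in metis)+
qed


section \<open>Encoding of the input\<close>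

text \<open>A relation between \<open>{..<m}\<close> and \<open>{..<k}\<close> is stored row by row as a 0/1-matrix.\<close>

definition matrix_cells :: "nat \<Rightarrow> nat \<Rightarrow> (nat \<Rightarrow> nat \<Rightarrow> bool) \<Rightarrow> int \<Rightarrow> int" where
  "matrix_cells m k P i = of_bool (\<exists>u<m. \<exists>v<k. i = int (u * k + v) \<and> P u v)"

text \<open>The graph has vertices \<open>{..<n}\<close> and edges \<open>E\<close>; the decomposition tree has nodes \<open>{..<N}\<close>,
  edges \<open>F\<close> and bags \<open>B\<close>. All cells that do not belong to the input are 0.\<close>

definition input_store ::
    "nat \<Rightarrow> nat set set \<Rightarrow> nat \<Rightarrow> nat set set \<Rightarrow> (nat \<Rightarrow> nat set) \<Rightarrow> store" where
  "input_store n E N F B = (\<lambda>_ _. 0)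
     (''n'' := (\<lambda>_. 0)(0 := int n),
      ''N'' := (\<lambda>_. 0)(0 := int N),
      ''graph'' := matrix_cells n n (\<lambda>u v. {u, v} \<in> E),
      ''tree'' := matrix_cells N N (\<lambda>t t'. {t, t'} \<in> F),
      ''bag'' := matrix_cells N n (\<lambda>t v. v \<in> B t))"

end

theory Submission
  imports Defs "HOL-Library.FuncSet"
begin

text \<open>
  Let \<open>k = Max X + 2\<close> and \<open>K = k - 1\<close>. Over all edge subsets \<open>S\<close>, the polynomial
  \<open>\<Prod>\<^sub>u\<^sub>v (1 + y x\<^sub>u x\<^sub>v)\<close> collects the monomials \<open>y^|S| \<Prod>\<^sub>v x\<^sub>v^deg\<^sub>S(v)\<close>, so the number of solutions arises
  by applying to every variable the functional \<open>x^m \<mapsto> [m \<notin> X]\<close>. Up to the factor \<open>D \<epsilon>^K\<close> and modulo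
  higher powers of \<open>\<epsilon>\<close>, this functional is an integer combination of evaluations at just \<open>k\<close> points:
  the point 1 counts everything, and the points \<open>i \<epsilon>\<close> with \<open>i < K\<close> extract, by Lagrange interpolation, the
  coefficients of \<open>x^j\<close> for \<open>j \<in> X\<close>. Hence the answer can be read off from
  \<open>\<Sum>\<^sub>\<sigma> \<Prod>\<^sub>v weight(\<sigma> v) \<Prod>\<^sub>u\<^sub>v (1 + y point(\<sigma> u) point(\<sigma> v))\<close>, where \<open>\<sigma>\<close> ranges over the maps from the vertices to \<open>k\<close>
  states, once \<open>y\<close> and \<open>\<epsilon>\<close> are replaced by sufficiently large integers and the sum is reduced modulo
  \<open>\<epsilon>^(K n + 1)\<close>. For such a partition function the tables at a join node are multiplied pointwise, so
  no convolution is needed: leaves of the decomposition tree are eliminated one at a time, each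
  at the cost of enumerating the \<open>k^|bag|\<close> assignments of its bag.
\<close>

section \<open>Total correctness with time bounds\<close>

text \<open>The natural states, the degrees 0 to Max X and one state for anything larger, already
  number k; but at a join node the degrees from both sides add, so combining tables would be a
  convolution over pairs of states. Evaluation at points turns this addition into a product. Only k
  points are affordable, while a vertex may have degree up to n - 1: the K points i \<epsilon>
  determine only K coefficients, and the factor \<epsilon> pushes what they report wrongly about
  degrees from K on into a higher order. This costs little: y and \<epsilon> have polynomially many
  bits, and reduction modulo a power of \<epsilon> keeps the tables that short. The time bound is
  separated from the values: all cells stay within 2^L for an L polynomial in n, so each elementary
  command costs O(L); all loops but one run polynomially often; the remaining one, over the
  assignments of a bag, is never nested in itself, so its number of rounds enters the total
  linearly.\<close>

definition bounded_store :: "nat \<Rightarrow> store \<Rightarrow> bool" where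
  "bounded_store L \<sigma> \<longleftrightarrow> (\<forall>a i. \<bar>\<sigma> a i\<bar> \<le> 2 ^ L)"

section \<open>Bit lengths of values and costs of expressions\<close>

lemma len_le: "\<bar>i\<bar> \<le> 2 ^ m \<Longrightarrow> len i \<le> Suc m"
proof -
  assume "\<bar>i\<bar> \<le> 2 ^ m"
  then have "nat \<bar>i\<bar> \<le> 2 ^ m"
    by (simp add: nat_le_iff)
  then have "nat \<bar>i\<bar> < 2 ^ Suc m"
    by (rule le_less_trans) simp
  then have "floorlog 2 (nat \<bar>i\<bar>) \<le> Suc m"
    by (intro floorlog_leI) auto
  then show ?thesis
    by (simp add: len_def)
qed

lemma abs_le_len: "\<bar>i\<bar> \<le> 2 ^ len i"
proof (cases "i = 0")
  case False
  have "nat \<bar>i\<bar> < 2 ^ floorlog 2 (nat \<bar>i\<bar>)"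
    using floorlog_bounds[of "nat \<bar>i\<bar>" 2] False by simp
  also have "\<dots> \<le> 2 ^ len i"
    by (rule power_increasing) (auto simp: len_def)
  finally have "int (nat \<bar>i\<bar>) < int (2 ^ len i)"
    by (simp only: of_nat_less_iff)
  then show ?thesis
    by simp
qed simp

text \<open>The value of \<open>e\<close> fits into \<open>size_weight e\<close> blocks of L bits
  when every cell fits into one. A read counts one block whatever its address, a product adds the
  blocks of its factors, and only sums and differences need a block for the carry.\<close>

fun size_weight :: "aexp \<Rightarrow> nat" where
  "size_weight (Const k) = len k"
| "size_weight (Read a e) = 1"
| "size_weight (Add e f) = size_weight e + size_weight f + 1"
| "size_weight (Sub e f) = size_weight e + size_weight f + 1"
| "size_weight (Mul e f) = size_weight e + size_weight f"
| "size_weight (Div e f) = size_weight e"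

text \<open>For nonzero b the quotient lies between the integers -|a| and |a|, and so does its
  floor, although rounding is towards minus infinity; division by 0 gives 0. Hence a quotient needs
  no more room than its dividend.\<close>

lemma abs_div_le: "\<bar>a div b\<bar> \<le> \<bar>a\<bar>" for a b :: int
proof -
  consider "b = 0" | "b > 0" | "b < 0"
    by linarith
  then show ?thesis
  proof cases
    case 2
    then have "- \<bar>a\<bar> \<le> a div b"
      using zdiv_mono1[of "- \<bar>a\<bar>" a b] div_by_1[of a]
      by (smt (verit, ccfv_SIG) int_div_less_self nonneg1_imp_zdiv_pos_iff pos_imp_zdiv_nonneg_iff
          zdiv_mono2_neg)
    moreover have "a div b \<le> \<bar>a\<bar>"
      using 2 by (smt (verit) div_by_1 pos_imp_zdiv_neg_iff zdiv_mono2)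
    ultimately show ?thesis
      by linarith
  next
    case 3
    then have "a div b = (- a) div (- b)"
      by simp
    moreover have "- \<bar>- a\<bar> \<le> (- a) div (- b)"
      using 3 by (smt (verit, ccfv_SIG) div_by_1 int_div_less_self pos_imp_zdiv_nonneg_iff
          zdiv_mono2_neg)
    moreover have "(- a) div (- b) \<le> \<bar>- a\<bar>"
      using 3 by (smt (verit) div_by_1 pos_imp_zdiv_neg_iff zdiv_mono2)
    ultimately show ?thesis
      by linarith
  qed simp
qed

lemma aval_bound:
  assumes "bounded_store L \<sigma>" "1 \<le> L"
  shows "\<bar>aval e \<sigma>\<bar> \<le> 2 ^ (size_weight e * L)"
proof (induction e)
  case (Const k)
  have "(2::int) ^ len k \<le> 2 ^ (len k * L)"
    using assms(2) by (intro power_increasing) auto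
  then show ?case
    using order.trans[OF abs_le_len[of k]] by (simp only: aval.simps size_weight.simps)
next
  case (Read a e)
  then show ?case
    using assms(1) by (simp add: bounded_store_def)
next
  case (Add e f)
  let ?x = "size_weight e * L" and ?y = "size_weight f * L"
  have "\<bar>aval e \<sigma> + aval f \<sigma>\<bar> \<le> 2 ^ (?x + ?y) + 2 ^ (?x + ?y)"
    using Add by (smt (verit) le_add1 le_add2 one_le_numeral power_increasing)
  also have "\<dots> = 2 ^ Suc (?x + ?y)"
    by simp
  also have "\<dots> \<le> 2 ^ (size_weight (Add e f) * L)"
    using assms(2) by (intro power_increasing) (auto simp: algebra_simps)
  finally show ?case
    by simp
next
  case (Sub e f)
  let ?x = "size_weight e * L" and ?y = "size_weight f * L"
  have "\<bar>aval e \<sigma> - aval f \<sigma>\<bar> \<le> 2 ^ (?x + ?y) + 2 ^ (?x + ?y)"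
    using Sub by (smt (verit) le_add1 le_add2 one_le_numeral power_increasing)
  also have "\<dots> = 2 ^ Suc (?x + ?y)"
    by simp
  also have "\<dots> \<le> 2 ^ (size_weight (Sub e f) * L)"
    using assms(2) by (intro power_increasing) (auto simp: algebra_simps)
  finally show ?case
    by simp
next
  case (Mul e f)
  then show ?case
    by (simp add: abs_mult power_add algebra_simps mult_mono)
next
  case (Div e f)
  then show ?case
    using abs_div_le[of "aval e \<sigma>" "aval f \<sigma>"] by simp
qed

lemma len_aval_le:
  assumes "bounded_store L \<sigma>" "1 \<le> L"
  shows "len (aval e \<sigma>) \<le> Suc (size_weight e) * L"
  using len_le[OF aval_bound[OF assms, of e]] assms(2) by simp

fun time_weight :: "aexp \<Rightarrow> nat" where
  "time_weight (Const k) = len k"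
| "time_weight (Read a e) = time_weight e + Suc (size_weight e) + 2"
| "time_weight (Add e f) = time_weight e + time_weight f + Suc (size_weight e) + Suc (size_weight f)"
| "time_weight (Sub e f) = time_weight e + time_weight f + Suc (size_weight e) + Suc (size_weight f)"
| "time_weight (Mul e f) = time_weight e + time_weight f + Suc (size_weight e) + Suc (size_weight f)"
| "time_weight (Div e f) = time_weight e + time_weight f + Suc (size_weight e) + Suc (size_weight f)"

lemma acost_le:
  assumes "bounded_store L \<sigma>" "1 \<le> L"
  shows "acost e \<sigma> \<le> time_weight e * L"
proof (induction e)
  case (Const k)
  then show ?case
    using assms(2) by simp
next
  case (Read a e)
  have "len (\<sigma> a (aval e \<sigma>)) \<le> Suc L"
    using assms(1) by (intro len_le) (simp add: bounded_store_def)
  then show ?case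
    using Read len_aval_le[OF assms, of e] assms(2) by (simp add: algebra_simps)
next
  case (Add e f)
  then show ?case
    using len_aval_le[OF assms, of e] len_aval_le[OF assms, of f] by (simp add: algebra_simps)
next
  case (Sub e f)
  then show ?case
    using len_aval_le[OF assms, of e] len_aval_le[OF assms, of f] by (simp add: algebra_simps)
next
  case (Mul e f)
  then show ?case
    using len_aval_le[OF assms, of e] len_aval_le[OF assms, of f] by (simp add: algebra_simps)
next
  case (Div e f)
  then show ?case
    using len_aval_le[OF assms, of e] len_aval_le[OF assms, of f] by (simp add: algebra_simps)
qed

text \<open>Here \<open>\<nu> e\<close> bounds the number of iterations of every loop with guard \<open>e\<close>.\<close>

fun com_weight :: "(aexp \<Rightarrow> nat) \<Rightarrow> com \<Rightarrow> nat" where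
  "com_weight \<nu> Skip = 1"
| "com_weight \<nu> (Write a e f) = time_weight e + time_weight f + Suc (size_weight e) + Suc (size_weight f)"
| "com_weight \<nu> (Seq c d) = com_weight \<nu> c + com_weight \<nu> d"
| "com_weight \<nu> (IfPos e c d) =
     time_weight e + Suc (size_weight e) + com_weight \<nu> c + com_weight \<nu> d"
| "com_weight \<nu> (WhilePos e c) =
     Suc (\<nu> e) * (time_weight e + Suc (size_weight e) + com_weight \<nu> c)"

section \<open>How the weight of a program depends on a single loop bound\<close>

fun has_guard :: "aexp \<Rightarrow> com \<Rightarrow> bool" where
  "has_guard g (Seq c d) \<longleftrightarrow> has_guard g c \<or> has_guard g d"
| "has_guard g (IfPos e c d) \<longleftrightarrow> has_guard g c \<or> has_guard g d"
| "has_guard g (WhilePos e c) \<longleftrightarrow> e = g \<or> has_guard g c"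
| "has_guard g _ \<longleftrightarrow> False"

text \<open>Loops are identified by their guard expressions, so \<open>g\<close> names all loops
  with this guard. Excluded is that one of them runs inside another, which would make the weight at
  least quadratic in \<open>\<nu> g\<close>.\<close>

fun unnested :: "aexp \<Rightarrow> com \<Rightarrow> bool" where
  "unnested g (Seq c d) \<longleftrightarrow> unnested g c \<and> unnested g d"
| "unnested g (IfPos e c d) \<longleftrightarrow> unnested g c \<and> unnested g d"
| "unnested g (WhilePos e c) \<longleftrightarrow> (if e = g then \<not> has_guard g c else unnested g c)"
| "unnested g _ \<longleftrightarrow> True"

lemma com_weight_no_guard:
  "\<not> has_guard g c \<Longrightarrow> com_weight (\<nu>(g := m)) c = com_weight (\<nu>(g := m')) c"
  by (induction c) auto

text \<open>Along any chain of nested loops the factor \<open>Suc m\<close> is picked up at most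
  once, so a huge bound for \<open>g\<close> can be pulled out of the weight.\<close>

lemma com_weight_unnested:
  assumes "unnested g c"
  shows "com_weight (\<nu>(g := m)) c \<le> Suc m * com_weight (\<nu>(g := 0)) c"
  using assms
proof (induction c)
  case (WhilePos e c)
  show ?case
  proof (cases "e = g")
    case True
    with WhilePos.prems have "com_weight (\<nu>(g := m)) c = com_weight (\<nu>(g := 0)) c"
      by (intro com_weight_no_guard) simp
    then have "com_weight (\<nu>(g := m)) c \<le> com_weight (\<nu>(g := 0)) c"
      by simp
    with True show ?thesis
      by (simp only: com_weight.simps fun_upd_same mult_le_mono2 add_left_mono mult_1 One_nat_def[symmetric])
  next
    case False
    let ?a = "time_weight e + Suc (size_weight e)"
    have "com_weight (\<nu>(g := m)) c \<le> Suc m * com_weight (\<nu>(g := 0)) c"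
      using False WhilePos by (simp del: fun_upd_apply)
    then have "?a + com_weight (\<nu>(g := m)) c \<le> Suc m * (?a + com_weight (\<nu>(g := 0)) c)"
      by (simp add: add_mult_distrib2)
    then have "Suc (\<nu> e) * (?a + com_weight (\<nu>(g := m)) c)
        \<le> Suc (\<nu> e) * (Suc m * (?a + com_weight (\<nu>(g := 0)) c))"
      by (rule mult_le_mono2)
    with False show ?thesis
      by (simp only: com_weight.simps fun_upd_other[OF False] mult.left_commute)
  qed
qed (auto simp: algebra_simps)

text \<open>With a common bound m for all loops other than those of \<open>g\<close>, each nesting
  level contributes a factor m + 1. Degree and coefficients depend on the program only, not on its
  input.\<close>

lemma com_weight_poly:
  "\<exists>p. \<forall>m. com_weight ((\<lambda>_. m)(g := 0)) c = poly p m"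
proof (induction c)
  case (WhilePos e c)
  then obtain p where p: "\<And>m. com_weight ((\<lambda>_. m)(g := 0)) c = poly p m"
    by blast
  let ?r = "[:time_weight e + Suc (size_weight e):] + p"
  show ?case
  proof (cases "e = g")
    case True
    then show ?thesis
      by (intro exI[of _ ?r]) (simp add: p fun_upd_same del: fun_upd_apply)
  next
    case False
    then show ?thesis
      by (intro exI[of _ "[:1, 1:] * ?r"]) (simp add: p fun_upd_other del: fun_upd_apply)
  qed
next
  case Skip
  show ?case
    by (intro exI[of _ "[:1:]"]) simp
next
  case (Write a e f)
  show ?case
    by (intro exI[of _ "[:com_weight (\<lambda>_. 0) (Write a e f):]"]) simp
next
  case (Seq c d)
  then obtain p p' where "\<And>m. com_weight ((\<lambda>_. m)(g := 0)) c = poly p m"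
      "\<And>m. com_weight ((\<lambda>_. m)(g := 0)) d = poly p' m"
    by blast
  then show ?case
    by (intro exI[of _ "p + p'"]) (simp del: fun_upd_apply)
next
  case (IfPos e c d)
  then obtain p p' where "\<And>m. com_weight ((\<lambda>_. m)(g := 0)) c = poly p m"
      "\<And>m. com_weight ((\<lambda>_. m)(g := 0)) d = poly p' m"
    by blast
  then show ?case
    by (intro exI[of _ "[:time_weight e + Suc (size_weight e):] + p + p'"]) (simp del: fun_upd_apply)
qed

text \<open>Boundedness is a premise and also part of the guarantee, so the rules below chain it
  silently, and a side condition that needs it retrieves it by \<open>ok_bounded\<close>.\<close>

definition runs ::
    "nat \<Rightarrow> (aexp \<Rightarrow> nat) \<Rightarrow> com \<Rightarrow> store \<Rightarrow> (store \<Rightarrow> bool) \<Rightarrow> bool" where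
  "runs L \<nu> c \<sigma> Q \<longleftrightarrow> (bounded_store L \<sigma> \<longrightarrow>
     (\<exists>t \<tau>. exec c \<sigma> t \<tau> \<and> t \<le> com_weight \<nu> c * L \<and> bounded_store L \<tau> \<and> Q \<tau>))"

section \<open>Proof rules for terminating runs with bounded cells\<close>

locale cost_bounds =
  fixes L :: nat and \<nu> :: "aexp \<Rightarrow> nat"
  assumes L_pos: "1 \<le> L"
begin

abbreviation "ok \<equiv> runs L \<nu>"

lemma ok_mono: "ok c \<sigma> Q \<Longrightarrow> (\<And>\<tau>. bounded_store L \<tau> \<Longrightarrow> Q \<tau> \<Longrightarrow> Q' \<tau>) \<Longrightarrow> ok c \<sigma> Q'"
  unfolding runs_def by blast

lemma ok_bounded: "(bounded_store L \<sigma> \<Longrightarrow> ok c \<sigma> Q) \<Longrightarrow> ok c \<sigma> Q"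
  unfolding runs_def by blast

lemma ok_Skip: "Q \<sigma> \<Longrightarrow> ok Skip \<sigma> Q"
  unfolding runs_def
  using L_pos exec.Skip by (metis com_weight.simps(1) nat_mult_1)

lemma ok_Write:
  assumes "bounded_store L \<sigma> \<Longrightarrow> \<bar>aval f \<sigma>\<bar> \<le> 2 ^ L"
    and "Q (\<sigma>(a := (\<sigma> a)(aval e \<sigma> := aval f \<sigma>)))"
  shows "ok (Write a e f) \<sigma> Q"
  unfolding runs_def
proof (intro impI exI conjI)
  assume bd: "bounded_store L \<sigma>"
  show "exec (Write a e f) \<sigma> (acost e \<sigma> + acost f \<sigma> + len (aval e \<sigma>) + len (aval f \<sigma>))
     (\<sigma>(a := (\<sigma> a)(aval e \<sigma> := aval f \<sigma>)))"
    by (rule exec.Write)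
  show "acost e \<sigma> + acost f \<sigma> + len (aval e \<sigma>) + len (aval f \<sigma>) \<le> com_weight \<nu> (Write a e f) * L"
    using acost_le[OF bd L_pos, of e] acost_le[OF bd L_pos, of f]
      len_aval_le[OF bd L_pos, of e] len_aval_le[OF bd L_pos, of f]
    by (simp add: algebra_simps)
  show "bounded_store L (\<sigma>(a := (\<sigma> a)(aval e \<sigma> := aval f \<sigma>)))"
    using bd assms(1) by (simp add: bounded_store_def)
qed (rule assms(2))

lemma ok_Seq:
  assumes "ok c \<sigma> (\<lambda>\<tau>. ok d \<tau> Q)"
  shows "ok (Seq c d) \<sigma> Q"
  unfolding runs_def
proof
  assume "bounded_store L \<sigma>"
  then obtain t \<tau> where c: "exec c \<sigma> t \<tau>" "t \<le> com_weight \<nu> c * L" "bounded_store L \<tau>" "ok d \<tau> Q"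
    using assms unfolding runs_def by blast
  then obtain t' \<tau>' where d: "exec d \<tau> t' \<tau>'" "t' \<le> com_weight \<nu> d * L" "bounded_store L \<tau>'" "Q \<tau>'"
    unfolding runs_def by blast
  have "exec (Seq c d) \<sigma> (t + t') \<tau>'"
    using c(1) d(1) by (rule exec.Seq)
  moreover have "t + t' \<le> com_weight \<nu> (Seq c d) * L"
    using c(2) d(2) by (simp add: algebra_simps)
  ultimately show "\<exists>t \<tau>. exec (Seq c d) \<sigma> t \<tau> \<and> t \<le> com_weight \<nu> (Seq c d) * L \<and> bounded_store L \<tau> \<and> Q \<tau>"
    using d by blast
qed

lemma ok_IfPos:
  assumes "aval e \<sigma> > 0 \<Longrightarrow> ok c \<sigma> Q" and "\<not> aval e \<sigma> > 0 \<Longrightarrow> ok d \<sigma> Q"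
  shows "ok (IfPos e c d) \<sigma> Q"
  unfolding runs_def
proof
  assume bd: "bounded_store L \<sigma>"
  have guard: "acost e \<sigma> + len (aval e \<sigma>) \<le> (time_weight e + Suc (size_weight e)) * L"
    using acost_le[OF bd L_pos, of e] len_aval_le[OF bd L_pos, of e] by (simp add: algebra_simps)
  show "\<exists>t \<tau>. exec (IfPos e c d) \<sigma> t \<tau> \<and> t \<le> com_weight \<nu> (IfPos e c d) * L \<and> bounded_store L \<tau> \<and> Q \<tau>"
  proof (cases "aval e \<sigma> > 0")
    case True
    then obtain t \<tau> where "exec c \<sigma> t \<tau>" "t \<le> com_weight \<nu> c * L" "bounded_store L \<tau>" "Q \<tau>"
      using assms(1) bd unfolding runs_def by blast
    with guard exec.IfTrue[OF True this(1), of d] show ?thesis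
      by (intro exI conjI) (assumption, auto simp: algebra_simps)
  next
    case False
    then obtain t \<tau> where "exec d \<sigma> t \<tau>" "t \<le> com_weight \<nu> d * L" "bounded_store L \<tau>" "Q \<tau>"
      using assms(2) bd unfolding runs_def by blast
    with guard exec.IfFalse[OF False this(1), of c] show ?thesis
      by (intro exI conjI) (assumption, auto simp: algebra_simps)
  qed
qed

lemma ok_WhilePos:
  assumes "m \<le> \<nu> e" and "I 0 \<sigma>"
    and step: "\<And>i \<tau>. i < m \<Longrightarrow> I i \<tau> \<Longrightarrow> ok c \<tau> (I (Suc i))"
    and pos: "\<And>i \<tau>. i < m \<Longrightarrow> I i \<tau> \<Longrightarrow> aval e \<tau> > 0"
    and stop: "\<And>\<tau>. I m \<tau> \<Longrightarrow> \<not> aval e \<tau> > 0"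
  shows "ok (WhilePos e c) \<sigma> (I m)"
  unfolding runs_def
proof
  assume bd: "bounded_store L \<sigma>"
  let ?g = "time_weight e + Suc (size_weight e)"
  have guard: "acost e \<tau> + len (aval e \<tau>) \<le> ?g * L" if "bounded_store L \<tau>" for \<tau>
    using acost_le[OF that L_pos, of e] len_aval_le[OF that L_pos, of e]
    by (simp add: algebra_simps)
  \<comment> \<open>Induction on the number j of rounds still to come, the invariant being indexed
    by m - j. \<open>Suc j\<close> counts the guard tests, including the last one, which
    fails.\<close>
  have "\<exists>t \<tau>. exec (WhilePos e c) \<sigma> t \<tau> \<and> t \<le> Suc j * (?g + com_weight \<nu> c) * L
      \<and> bounded_store L \<tau> \<and> I m \<tau>" if "I (m - j) \<sigma>" "j \<le> m" "bounded_store L \<sigma>" for j \<sigma>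
    using that
  proof (induction j arbitrary: \<sigma>)
    case 0
    then have "\<not> aval e \<sigma> > 0"
      using stop by simp
    from exec.WhileFalse[OF this, of c] 0 guard[of \<sigma>] show ?case
      by (intro exI conjI) (assumption, auto simp: algebra_simps)
  next
    case (Suc j)
    then have less: "m - Suc j < m"
      by simp
    from step[OF less Suc.prems(1)] Suc.prems(3) obtain t \<tau> where
      c: "exec c \<sigma> t \<tau>" "t \<le> com_weight \<nu> c * L" "bounded_store L \<tau>" "I (Suc (m - Suc j)) \<tau>"
      unfolding runs_def by blast
    have "I (m - j) \<tau>"
      using c(4) Suc.prems(2) by (simp add: Suc_diff_Suc)
    with Suc.IH Suc.prems(2) c(3) obtain t' \<tau>' where
      w: "exec (WhilePos e c) \<tau> t' \<tau>'" "t' \<le> Suc j * (?g + com_weight \<nu> c) * L"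
        "bounded_store L \<tau>'" "I m \<tau>'"
      by (metis Suc_leD)
    have "exec (WhilePos e c) \<sigma> (acost e \<sigma> + len (aval e \<sigma>) + t + t') \<tau>'"
      using exec.WhileTrue[OF pos[OF less Suc.prems(1)] c(1) w(1)] .
    moreover have "acost e \<sigma> + len (aval e \<sigma>) + t + t' \<le> Suc (Suc j) * (?g + com_weight \<nu> c) * L"
      using guard[OF Suc.prems(3)] c(2) w(2) by (simp add: algebra_simps)
    ultimately show ?case
      using w by blast
  qed
  from this[of m \<sigma>] assms(2) bd obtain t \<tau> where
    *: "exec (WhilePos e c) \<sigma> t \<tau>" "t \<le> Suc m * (?g + com_weight \<nu> c) * L" "bounded_store L \<tau>" "I m \<tau>"
    by auto
  have "Suc m * (?g + com_weight \<nu> c) * L \<le> com_weight \<nu> (WhilePos e c) * L"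
    unfolding com_weight.simps using assms(1) by (intro mult_le_mono1) simp
  with * show "\<exists>t \<tau>. exec (WhilePos e c) \<sigma> t \<tau> \<and> t \<le> com_weight \<nu> (WhilePos e c) * L
      \<and> bounded_store L \<tau> \<and> I m \<tau>"
    using le_trans by blast
qed

end

section \<open>Scalar variables and counting loops\<close>

abbreviation Var :: "string \<Rightarrow> aexp" where
  "Var x \<equiv> Read x (Const 0)"

abbreviation Assign :: "string \<Rightarrow> aexp \<Rightarrow> com" where
  "Assign x e \<equiv> Write x (Const 0) e"

text \<open>The bound \<open>e\<close> is evaluated anew before every round, so
  \<open>ok_For\<close> asks that it keep its value. The guard \<open>Sub e (Var x)\<close> is the
  key under which \<open>\<nu>\<close> looks up the number of rounds.\<close>

definition For :: "string \<Rightarrow> aexp \<Rightarrow> com \<Rightarrow> com" where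
  "For x e c =
     Seq (Assign x (Const 0)) (WhilePos (Sub e (Var x)) (Seq c (Assign x (Add (Var x) (Const 1)))))"

definition set_var :: "store \<Rightarrow> string \<Rightarrow> int \<Rightarrow> store" where
  "set_var \<sigma> x i = \<sigma>(x := (\<sigma> x)(0 := i))"

lemma set_var_same [simp]: "set_var \<sigma> x i x = (\<sigma> x)(0 := i)"
  by (simp add: set_var_def)

lemma set_var_other [simp]: "y \<noteq> x \<Longrightarrow> set_var \<sigma> x i y = \<sigma> y"
  by (simp add: set_var_def)

context cost_bounds
begin

lemma ok_Assign:
  assumes "bounded_store L \<sigma> \<Longrightarrow> \<bar>aval f \<sigma>\<bar> \<le> 2 ^ L" and "Q (set_var \<sigma> x (aval f \<sigma>))"
  shows "ok (Assign x f) \<sigma> Q"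
  using assms by (intro ok_Write) (simp_all add: set_var_def)

lemma ok_For:
  assumes count: "m \<le> \<nu> (Sub e (Var x))" and small: "int m \<le> 2 ^ L"
    and start: "I 0 (set_var \<sigma> x 0)"
    and bound: "\<And>i \<tau>. i \<le> m \<Longrightarrow> I i \<tau> \<Longrightarrow> \<tau> x 0 = int i \<Longrightarrow> aval e \<tau> = int m"
    and step: "\<And>i \<tau>. i < m \<Longrightarrow> bounded_store L \<tau> \<Longrightarrow> I i \<tau> \<Longrightarrow> \<tau> x 0 = int i \<Longrightarrow>
      ok c \<tau> (\<lambda>\<tau>'. \<tau>' x 0 = int i \<and> I (Suc i) (set_var \<tau>' x (int (Suc i))))"
    and final: "\<And>\<tau>. I m \<tau> \<Longrightarrow> \<tau> x 0 = int m \<Longrightarrow> Q \<tau>"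
  shows "ok (For x e c) \<sigma> Q"
  unfolding For_def
proof (intro ok_Seq ok_Assign)
  let ?J = "\<lambda>i \<tau>. I i \<tau> \<and> \<tau> x 0 = int i"
  have "ok (WhilePos (Sub e (Var x)) (Seq c (Assign x (Add (Var x) (Const 1)))))
      (set_var \<sigma> x (aval (Const 0) \<sigma>)) (?J m)"
  proof (rule ok_WhilePos[of m])
    fix i \<tau> assume i: "i < m" "?J i \<tau>"
    show "ok (Seq c (Assign x (Add (Var x) (Const 1)))) \<tau> (?J (Suc i))"
    proof (intro ok_Seq, rule ok_bounded, rule ok_mono)
      assume "bounded_store L \<tau>"
      with i step show "ok c \<tau> (\<lambda>\<tau>'. \<tau>' x 0 = int i \<and> I (Suc i) (set_var \<tau>' x (int (Suc i))))"
        by blast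
      fix \<tau>' assume *: "\<tau>' x 0 = int i \<and> I (Suc i) (set_var \<tau>' x (int (Suc i)))"
      have "int i + 1 \<le> 2 ^ L"
        using i small by linarith
      then have "\<bar>1 + int i\<bar> \<le> 2 ^ L"
        by linarith
      with * show "ok (Assign x (Add (Var x) (Const 1))) \<tau>' (?J (Suc i))"
        by (intro ok_Assign) (simp_all add: add.commute)
    qed
  next
    fix i \<tau> assume "i < m" "?J i \<tau>"
    then show "aval (Sub e (Var x)) \<tau> > 0"
      using bound[of i \<tau>] by simp
  next
    fix \<tau> assume "?J m \<tau>"
    then show "\<not> aval (Sub e (Var x)) \<tau> > 0"
      using bound[of m \<tau>] by simp
  qed (use count start in simp_all)
  then show "ok (WhilePos (Sub e (Var x)) (Seq c (Assign x (Add (Var x) (Const 1)))))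
      (set_var \<sigma> x (aval (Const 0) \<sigma>)) Q"
    by (rule ok_mono) (use final in blast)
qed simp

text \<open>Every partial product is written to a cell, hence a size condition for all exponents up
  to m and not just for the result.\<close>

lemma ok_power:
  assumes "x \<noteq> r" "m \<le> \<nu> (Sub e (Var x))" "int m \<le> 2 ^ L"
    and bound: "\<And>i z. aval e (set_var (set_var \<sigma> x i) r z) = int m"
    and factor: "\<And>i z. aval f (set_var (set_var \<sigma> x i) r z) = w"
    and small: "\<And>i. i \<le> m \<Longrightarrow> \<bar>\<sigma> r 0 * w ^ i\<bar> \<le> 2 ^ L"
    and final: "Q (set_var (set_var \<sigma> x (int m)) r (\<sigma> r 0 * w ^ m))"
  shows "ok (For x e (Assign r (Mul (Var r) f))) \<sigma> Q"
proof (rule ok_For[of m _ _ "\<lambda>i \<tau>. \<tau> = set_var (set_var \<sigma> x (int i)) r (\<sigma> r 0 * w ^ i)"])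
  fix i \<tau> assume i: "i < m" "\<tau> = set_var (set_var \<sigma> x (int i)) r (\<sigma> r 0 * w ^ i)"
  have "\<bar>\<sigma> r 0 * w ^ Suc i\<bar> \<le> 2 ^ L"
    using small[of "Suc i"] i(1) by simp
  moreover have "aval (Mul (Var r) f) \<tau> = \<sigma> r 0 * w ^ Suc i"
    using factor[of "int i"] i(2) by simp
  ultimately show "ok (Assign r (Mul (Var r) f)) \<tau> (\<lambda>\<tau>'. \<tau>' x 0 = int i \<and>
      set_var \<tau>' x (int (Suc i)) = set_var (set_var \<sigma> x (int (Suc i))) r (\<sigma> r 0 * w ^ Suc i))"
    using assms(1) i(2)
    by (intro ok_Assign) (auto simp: set_var_def fun_upd_twist simp del: aval.simps power_Suc)
next
  fix i \<tau> assume "\<tau> = set_var (set_var \<sigma> x (int i)) r (\<sigma> r 0 * w ^ i)"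
  then show "aval e \<tau> = int m"
    using bound by simp
next
  show "set_var \<sigma> x 0 = set_var (set_var \<sigma> x (int 0)) r (\<sigma> r 0 * w ^ 0)"
    using assms(1) by (simp add: set_var_def fun_upd_twist fun_upd_idem)
qed (use assms in simp_all)

end

section \<open>Replacing degree constraints by evaluations\<close>

text \<open>Lagrange interpolation at 0, ..., K - 1 expresses the coefficient of x^j of a polynomial
  of degree below K through its values, with rational factors; D is a common denominator. Row j of
  \<open>d\<close> is this coefficient functional.\<close>

lemma integer_interpolation:
  fixes K :: nat
  shows "\<exists>D d. D > (0::int) \<and>
    (\<forall>m<K. \<forall>j<K. (\<Sum>i<K. d j i * int i ^ m) = (if m = j then D else 0))"
proof -
  define l :: "nat \<Rightarrow> int poly" where "l i = (\<Prod>h\<in>{..<K} - {i}. [:- int h, 1:])" for i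
  define e where "e i = poly (l i) (int i)" for i
  define E where "E = (\<Prod>i<K. e i)"
  define g where "g i = (\<Prod>h\<in>{..<K} - {i}. e h)" for i
  have l_other: "poly (l i) (int h) = 0" if "h < K" "h \<noteq> i" for i h
    using that unfolding l_def by (auto simp: poly_prod)
  have "e i \<noteq> 0" for i
    unfolding e_def l_def by (auto simp: poly_prod)
  then have "E \<noteq> 0"
    unfolding E_def by simp
  have g: "g i * e i = E" if "i < K" for i
    unfolding E_def g_def using that by (subst prod.remove[of "{..<K}" i]) auto
  have degree_l: "degree (l i) < K" if "i < K" for i
  proof -
    have "degree (l i) = (\<Sum>h\<in>{..<K} - {i}. degree [:- int h, 1:])"
      unfolding l_def by (intro degree_prod_eq_sum_degree) auto
    then show ?thesis
      using that by simp
  qed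
  \<comment> \<open>Both sides have degree below K and agree at the K nodes: at node h only the term
    i = h survives, and it gives \<open>g h * e h = E\<close> times h^m.\<close>
  have id: "(\<Sum>i<K. smult (g i * int i ^ m) (l i)) = monom E m" if "m < K" for m
  proof (rule poly_eqI_degree[of "int ` {..<K}"])
    fix x assume "x \<in> int ` {..<K}"
    then obtain h where h: "h < K" "x = int h"
      by auto
    have "poly (\<Sum>i<K. smult (g i * int i ^ m) (l i)) x
        = (\<Sum>i<K. g i * int i ^ m * poly (l i) (int h))"
      by (simp add: poly_sum h)
    also have "\<dots> = (\<Sum>i\<in>{h}. g i * int i ^ m * poly (l i) (int h))"
      by (rule sum.mono_neutral_right) (use h l_other in auto)
    also have "\<dots> = poly (monom E m) x"
      using g[of h] h by (simp add: e_def poly_monom mult_ac)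
    finally show "poly (\<Sum>i<K. smult (g i * int i ^ m) (l i)) x = poly (monom E m) x" .
  next
    have card: "card (int ` {..<K}) = K"
      by (simp add: card_image)
    have "degree (smult (g i * int i ^ m) (l i)) \<le> K - 1" if "i < K" for i
      using degree_l[OF that] degree_smult_le[of "g i * int i ^ m" "l i"] by linarith
    then have "degree (\<Sum>i<K. smult (g i * int i ^ m) (l i)) \<le> K - 1"
      by (intro degree_sum_le) auto
    then show "degree (\<Sum>i<K. smult (g i * int i ^ m) (l i)) < card (int ` {..<K})"
      using that card by linarith
    show "degree (monom E m) < card (int ` {..<K})"
      using that card degree_monom_le[of E m] by linarith
  qed
  \<comment> \<open>E may be negative; the second factor E makes the common denominator E * E
    positive.\<close>
  define d where "d j i = E * g i * coeff (l i) j" for j i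
  have "(\<Sum>i<K. d j i * int i ^ m) = (if m = j then E * E else 0)" if "m < K" for m j
  proof -
    have "(\<Sum>i<K. d j i * int i ^ m) = E * coeff (\<Sum>i<K. smult (g i * int i ^ m) (l i)) j"
      by (simp add: coeff_sum sum_distrib_left d_def mult_ac)
    then show ?thesis
      using id[OF that] by simp
  qed
  moreover have "E * E > 0"
    using \<open>E \<noteq> 0\<close> by (auto simp: zero_less_mult_iff)
  ultimately show ?thesis
    by blast
qed

text \<open>Rows with index outside X still have to annihilate the powers below K: the weights sum
  over all j < K and must pick up the degrees in X only.\<close>

locale degree_weights =
  fixes X :: "nat set" and K :: nat and D :: int and d :: "nat \<Rightarrow> nat \<Rightarrow> int"
  assumes X_less: "j \<in> X \<Longrightarrow> j < K"
    and D_pos: "D > 0"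
    and interpolation: "m < K \<Longrightarrow> j < K \<Longrightarrow>
      (\<Sum>i<K. d j i * int i ^ m) = (if m = j \<and> j \<in> X then D else 0)"
begin

definition point :: "int \<Rightarrow> nat \<Rightarrow> int" where
  "point \<epsilon> i = (if i = K then 1 else int i * \<epsilon>)"

text \<open>Evaluation at i \<epsilon> multiplies the coefficient of x^j by \<epsilon>^j; the factor
  \<epsilon>^(K - j) brings all extracted coefficients to the common order \<epsilon>^K, which state
  K must then carry as well. The minus sign removes the forbidden degrees from the count of
  everything.\<close>

definition weight :: "int \<Rightarrow> nat \<Rightarrow> int" where
  "weight \<epsilon> i = (if i = K then D * \<epsilon> ^ K else - (\<Sum>j<K. d j i * \<epsilon> ^ (K - j)))"

text \<open>Degrees m < K are treated exactly, with r = 0. For m \<ge> K interpolation says nothing,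
  but each extracted term then carries \<epsilon>^(K - j + m) with m > j, hence a factor
  \<epsilon>^(K + 1); such an m is not in X, so the D coming from the point 1 is the right leading
  term.\<close>

lemma weighted_power_sum:
  "\<exists>r. (\<Sum>i<Suc K. weight \<epsilon> i * point \<epsilon> i ^ m) = \<epsilon> ^ K * ((if m \<in> X then 0 else D) + \<epsilon> * r)"
proof -
  define s where "s j = (\<Sum>i<K. d j i * int i ^ m)" for j
  have "(\<Sum>i<K. weight \<epsilon> i * point \<epsilon> i ^ m)
      = - (\<Sum>i<K. \<Sum>j<K. \<epsilon> ^ (K - j) * \<epsilon> ^ m * (d j i * int i ^ m))"
    unfolding sum_negf[symmetric]
    by (intro sum.cong)
      (simp_all add: weight_def point_def sum_distrib_left sum_distrib_right power_mult_distrib mult_ac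
        flip: sum_negf)
  also have "\<dots> = - (\<Sum>j<K. \<epsilon> ^ (K - j + m) * s j)"
    unfolding s_def sum_distrib_left power_add by (subst sum.swap) simp
  finally have *: "(\<Sum>i<Suc K. weight \<epsilon> i * point \<epsilon> i ^ m)
      = D * \<epsilon> ^ K - (\<Sum>j<K. \<epsilon> ^ (K - j + m) * s j)"
    by (simp add: weight_def point_def)
  show ?thesis
  proof (cases "m < K")
    case True
    have "(\<Sum>j<K. \<epsilon> ^ (K - j + m) * s j) = (\<Sum>j<K. if j = m then \<epsilon> ^ K * (if m \<in> X then D else 0) else 0)"
      by (rule sum.cong) (use True in \<open>auto simp: s_def interpolation\<close>)
    also have "\<dots> = \<epsilon> ^ K * (if m \<in> X then D else 0)"
      using True by simp
    finally show ?thesis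
      unfolding * by (intro exI[of _ 0]) (simp add: algebra_simps)
  next
    case False
    have "(\<Sum>j<K. \<epsilon> ^ (K - j + m) * s j) = (\<Sum>j<K. \<epsilon> ^ K * (\<epsilon> * (\<epsilon> ^ (m - Suc j) * s j)))"
    proof (rule sum.cong)
      fix j assume "j \<in> {..<K}"
      then have "K - j + m = K + Suc (m - Suc j)"
        using False by simp
      then show "\<epsilon> ^ (K - j + m) * s j = \<epsilon> ^ K * (\<epsilon> * (\<epsilon> ^ (m - Suc j) * s j))"
        by (simp add: power_add mult_ac)
    qed simp
    also have "\<dots> = \<epsilon> ^ K * (\<epsilon> * (\<Sum>j<K. \<epsilon> ^ (m - Suc j) * s j))"
      by (simp only: sum_distrib_left)
    finally show ?thesis
      unfolding * using False X_less
      by (intro exI[of _ "- (\<Sum>j<K. \<epsilon> ^ (m - Suc j) * s j)"]) (auto simp: algebra_simps)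
  qed
qed

section \<open>The partition function and its leading coefficient in \<epsilon>\<close>

definition edge_weight :: "int \<Rightarrow> int \<Rightarrow> nat set \<Rightarrow> (nat \<Rightarrow> nat) \<Rightarrow> int" where
  "edge_weight y \<epsilon> e \<sigma> = 1 + y * (\<Prod>v\<in>e. point \<epsilon> (\<sigma> v))"

definition partition_function :: "int \<Rightarrow> int \<Rightarrow> nat \<Rightarrow> nat set set \<Rightarrow> int" where
  "partition_function y \<epsilon> n E = (\<Sum>\<sigma>\<in>{..<n} \<rightarrow>\<^sub>E {..<Suc K}.
     (\<Prod>v<n. weight \<epsilon> (\<sigma> v)) * (\<Prod>e\<in>E. edge_weight y \<epsilon> e \<sigma>))"

text \<open>Choosing 1 or the other summand in each factor of the edge product means choosing an
  edge set S. For fixed S the points are collected at the vertices, each as often as its degree, and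
  the sum over all maps \<sigma> factors into independent sums per vertex.\<close>

lemma partition_function_expand:
  assumes "finite E" "\<And>e. e \<in> E \<Longrightarrow> e \<subseteq> {..<n}"
  shows "partition_function y \<epsilon> n E =
    (\<Sum>S\<in>Pow E. y ^ card S * (\<Prod>v<n. \<Sum>i<Suc K. weight \<epsilon> i * point \<epsilon> i ^ degree_in S v))"
proof -
  have edges: "(\<Prod>e\<in>E. edge_weight y \<epsilon> e \<sigma>)
      = (\<Sum>S\<in>Pow E. y ^ card S * (\<Prod>v<n. point \<epsilon> (\<sigma> v) ^ degree_in S v))" for \<sigma>
  proof -
    have "(\<Prod>e\<in>E. edge_weight y \<epsilon> e \<sigma>) = (\<Prod>e\<in>E. y * (\<Prod>v\<in>e. point \<epsilon> (\<sigma> v)) + 1)"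
      by (simp add: edge_weight_def add.commute)
    also have "\<dots> = (\<Sum>S\<in>Pow E. \<Prod>e\<in>S. y * (\<Prod>v\<in>e. point \<epsilon> (\<sigma> v)))"
      by (subst prod_add[OF assms(1)]) simp
    also have "\<dots> = (\<Sum>S\<in>Pow E. y ^ card S * (\<Prod>v<n. point \<epsilon> (\<sigma> v) ^ degree_in S v))"
    proof (rule sum.cong)
      fix S assume "S \<in> Pow E"
      then have S: "finite S" "\<And>e. e \<in> S \<Longrightarrow> e \<subseteq> {..<n}"
        using assms finite_subset by auto
      have "(\<Prod>e\<in>S. \<Prod>v\<in>e. point \<epsilon> (\<sigma> v)) = (\<Prod>e\<in>S. \<Prod>v<n. if v \<in> e then point \<epsilon> (\<sigma> v) else 1)"
      proof (rule prod.cong)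
        fix e assume "e \<in> S"
        then have "{..<n} \<inter> e = e"
          using S(2) by blast
        then show "(\<Prod>v\<in>e. point \<epsilon> (\<sigma> v)) = (\<Prod>v<n. if v \<in> e then point \<epsilon> (\<sigma> v) else 1)"
          by (simp add: prod.inter_restrict[symmetric])
      qed simp
      also have "\<dots> = (\<Prod>v<n. \<Prod>e\<in>S. if v \<in> e then point \<epsilon> (\<sigma> v) else 1)"
        by (rule prod.swap)
      also have "\<dots> = (\<Prod>v<n. point \<epsilon> (\<sigma> v) ^ degree_in S v)"
        using S(1) by (simp add: prod.If_cases degree_in_def Int_def)
      finally show "(\<Prod>e\<in>S. y * (\<Prod>v\<in>e. point \<epsilon> (\<sigma> v)))
          = y ^ card S * (\<Prod>v<n. point \<epsilon> (\<sigma> v) ^ degree_in S v)"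
        by (simp add: prod.distrib)
    qed simp
    finally show ?thesis .
  qed
  have "partition_function y \<epsilon> n E = (\<Sum>\<sigma>\<in>{..<n} \<rightarrow>\<^sub>E {..<Suc K}. \<Sum>S\<in>Pow E.
      y ^ card S * (\<Prod>v<n. weight \<epsilon> (\<sigma> v) * point \<epsilon> (\<sigma> v) ^ degree_in S v))"
    by (simp add: partition_function_def edges sum_distrib_left prod.distrib mult_ac)
  also have "\<dots> = (\<Sum>S\<in>Pow E. y ^ card S * (\<Sum>\<sigma>\<in>{..<n} \<rightarrow>\<^sub>E {..<Suc K}.
      \<Prod>v<n. weight \<epsilon> (\<sigma> v) * point \<epsilon> (\<sigma> v) ^ degree_in S v))"
    by (subst sum.swap) (simp only: sum_distrib_left)
  also have "\<dots> = (\<Sum>S\<in>Pow E. y ^ card S * (\<Prod>v<n. \<Sum>i<Suc K. weight \<epsilon> i * point \<epsilon> i ^ degree_in S v))"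
    by (subst prod_sum_PiE) auto
  finally show ?thesis .
qed

lemma prod_first_order:
  fixes a r :: "'b \<Rightarrow> int"
  shows "\<exists>s. (\<Prod>v\<in>A. a v + \<epsilon> * r v) = (\<Prod>v\<in>A. a v) + \<epsilon> * s"
proof (induction A rule: infinite_finite_induct)
  case (insert x A)
  then obtain s where s: "(\<Prod>v\<in>A. a v + \<epsilon> * r v) = (\<Prod>v\<in>A. a v) + \<epsilon> * s"
    by blast
  show ?case
    using insert.hyps
    by (intro exI[of _ "a x * s + r x * (\<Prod>v\<in>A. a v) + \<epsilon> * r x * s"]) (simp add: s algebra_simps)
qed (auto intro: exI[of _ 0])

definition solution_sum :: "int \<Rightarrow> nat \<Rightarrow> nat set set \<Rightarrow> int" where
  "solution_sum y n E = (\<Sum>S | antifactor_solution X {..<n} E S. y ^ card S)"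

text \<open>Each vertex contributes \<epsilon>^K times D or 0, up to higher order; the product of
  these leading terms is nonzero, and then \<open>D ^ n\<close>, exactly when all degrees are
  allowed.\<close>

lemma partition_function_eq:
  assumes "finite E" "\<And>e. e \<in> E \<Longrightarrow> e \<subseteq> {..<n}"
  shows "\<exists>r. partition_function y \<epsilon> n E = \<epsilon> ^ (K * n) * (D ^ n * solution_sum y n E + \<epsilon> * r)"
proof -
  let ?a = "\<lambda>S v. if degree_in S v \<in> X then 0 else D"
  obtain r where r: "\<And>m. (\<Sum>i<Suc K. weight \<epsilon> i * point \<epsilon> i ^ m)
      = \<epsilon> ^ K * ((if m \<in> X then 0 else D) + \<epsilon> * r m)"
    using weighted_power_sum by metis
  have "\<exists>s. (\<Prod>v<n. ?a S v + \<epsilon> * r (degree_in S v)) = (\<Prod>v<n. ?a S v) + \<epsilon> * s" for S :: "nat set set"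
    by (rule prod_first_order)
  then obtain s where s: "\<And>S. (\<Prod>v<n. ?a S v + \<epsilon> * r (degree_in S v)) = (\<Prod>v<n. ?a S v) + \<epsilon> * s S"
    by metis
  have prod_a: "(\<Prod>v<n. ?a S v) = (if \<forall>v<n. degree_in S v \<notin> X then D ^ n else 0)"
    for S :: "nat set set"
    by (cases "\<forall>v<n. degree_in S v \<notin> X") auto
  have "partition_function y \<epsilon> n E = (\<Sum>S\<in>Pow E. y ^ card S *
      (\<epsilon> ^ (K * n) * ((if \<forall>v<n. degree_in S v \<notin> X then D ^ n else 0) + \<epsilon> * s S)))"
    by (simp only: partition_function_expand[OF assms] r prod.distrib s prod_a prod_constant
        card_lessThan power_mult)
  also have "\<dots> = \<epsilon> ^ (K * n) * ((\<Sum>S\<in>Pow E. if \<forall>v<n. degree_in S v \<notin> X then D ^ n * y ^ card S else 0)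
      + \<epsilon> * (\<Sum>S\<in>Pow E. y ^ card S * s S))"
    unfolding sum_distrib_left distrib_left sum.distrib[symmetric]
    by (intro sum.cong) (auto simp: algebra_simps)
  also have "(\<Sum>S\<in>Pow E. if \<forall>v<n. degree_in S v \<notin> X then D ^ n * y ^ card S else 0)
      = D ^ n * solution_sum y n E"
    unfolding solution_sum_def sum_distrib_left
    using assms(1) by (subst sum.inter_filter[symmetric]) (auto simp: antifactor_solution_def intro!: sum.cong)
  finally show ?thesis
    by blast
qed

end

section \<open>Positional notation with integer digits\<close>

lemma sum_digits_less:
  fixes a :: "nat \<Rightarrow> int" and y :: int
  assumes "\<And>s. a s < y" "0 < y"
  shows "(\<Sum>s<m. a s * y ^ s) < y ^ m"
proof (induction m)
  case (Suc m)
  have "a m * y ^ m \<le> (y - 1) * y ^ m"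
    using assms(1)[of m] assms(2) by (intro mult_right_mono) auto
  then show ?case
    using Suc by (simp add: algebra_simps)
qed simp

text \<open>Division by y^i removes the lower digits, whose sum is below y^i, and the higher ones
  form a multiple of y.\<close>

lemma digit_of_sum:
  fixes a :: "nat \<Rightarrow> int" and y :: int
  assumes "\<And>s. 0 \<le> a s" "\<And>s. a s < y" "i < m"
  shows "(\<Sum>s<m. a s * y ^ s) div y ^ i mod y = a i"
proof -
  have y: "0 < y"
    using assms(1)[of 0] assms(2)[of 0] by linarith
  have "{..<m} = {..<i} \<union> {i..<m}"
    using assms(3) by auto
  then have "(\<Sum>s<m. a s * y ^ s) = (\<Sum>s<i. a s * y ^ s) + (\<Sum>s=i..<m. a s * y ^ s)"
    by (simp add: sum.union_disjoint ivl_disj_int)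
  also have "(\<Sum>s=i..<m. a s * y ^ s) = a i * y ^ i + (\<Sum>s=Suc i..<m. a s * y ^ s)"
    using assms(3) by (simp add: sum.atLeast_Suc_lessThan)
  also have "(\<Sum>s=Suc i..<m. a s * y ^ s) = (\<Sum>s=Suc i..<m. y ^ i * (y * (a s * y ^ (s - Suc i))))"
  proof (rule sum.cong)
    fix s assume "s \<in> {Suc i..<m}"
    then have "s = i + Suc (s - Suc i)"
      by auto
    then have "y ^ s = y ^ i * (y * y ^ (s - Suc i))"
      by (metis power_Suc power_add)
    then show "a s * y ^ s = y ^ i * (y * (a s * y ^ (s - Suc i)))"
      by simp
  qed simp
  also have "\<dots> = y ^ i * (y * (\<Sum>s=Suc i..<m. a s * y ^ (s - Suc i)))"
    by (simp only: sum_distrib_left)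
  finally have "(\<Sum>s<m. a s * y ^ s)
      = (\<Sum>s<i. a s * y ^ s) + (a i + y * (\<Sum>s=Suc i..<m. a s * y ^ (s - Suc i))) * y ^ i"
    by (simp add: algebra_simps)
  moreover have "(\<Sum>s<i. a s * y ^ s) div y ^ i = 0"
    using sum_digits_less[of a y i] assms y
    by (intro div_pos_pos_trivial sum_nonneg) auto
  ultimately show ?thesis
    using y assms(1)[of i] assms(2)[of i] by simp
qed

section \<open>Leaves of a tree\<close>

definition neighbours :: "'a set set \<Rightarrow> 'a set \<Rightarrow> 'a \<Rightarrow> 'a set" where
  "neighbours F R t = {s \<in> R. {t, s} \<in> F}"

text \<open>Unlike \<open>connected_in\<close> this admits the empty set: in the course of the
  elimination all occurrences of a vertex may disappear.\<close>

definition linked :: "'a set set \<Rightarrow> 'a set \<Rightarrow> bool" where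
  "linked F W \<longleftrightarrow> (\<forall>u\<in>W. \<forall>v\<in>W. (u, v) \<in> {(x, y). x \<in> W \<and> y \<in> W \<and> {x, y} \<in> F}\<^sup>*)"

lemma linked_remove_leaf:
  assumes "linked F W" "neighbours F W t \<subseteq> {p}" "{t} \<notin> F"
  shows "linked F (W - {t})"
  unfolding linked_def
proof (intro ballI)
  let ?r = "{(x, y). x \<in> W \<and> y \<in> W \<and> {x, y} \<in> F}"
  let ?r' = "{(x, y). x \<in> W - {t} \<and> y \<in> W - {t} \<and> {x, y} \<in> F}"
  fix u v assume u: "u \<in> W - {t}" and v: "v \<in> W - {t}"
  \<comment> \<open>A walk is rerouted by replacing every visit to t by p: a step into or out of t
    can only come from or lead to p.\<close>
  have "(u, if z = t then p else z) \<in> ?r'\<^sup>*" if "(u, z) \<in> ?r\<^sup>*" for z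
    using that
  proof (induction rule: rtrancl_induct)
    case base
    then show ?case
      using u by simp
  next
    case (step w z)
    then have wz: "w \<in> W" "z \<in> W" "{w, z} \<in> F"
      by auto
    consider "z = t" | "z \<noteq> t" "w = t" | "z \<noteq> t" "w \<noteq> t"
      by blast
    then show ?case
    proof cases
      case 1
      then have "w \<noteq> t" "w \<in> neighbours F W t"
        using wz assms(3) by (auto simp: neighbours_def insert_commute)
      then show ?thesis
        using 1 step.IH assms(2) by auto
    next
      case 2
      then have "z \<in> neighbours F W t"
        using wz by (auto simp: neighbours_def)
      then show ?thesis
        using 2 step.IH assms(2) by auto
    next
      case 3
      then have "(u, w) \<in> ?r'\<^sup>*"
        using step.IH by (simp only: if_False)
      moreover have "(w, z) \<in> ?r'"
        using 3 wz by auto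
      ultimately have "(u, z) \<in> ?r'\<^sup>*"
        by (rule rtrancl.rtrancl_into_rtrancl)
      then show ?thesis
        using 3 by (simp only: if_False)
    qed
  qed
  from this[of v] show "(u, v) \<in> ?r'\<^sup>*"
    using assms(1) u v by (auto simp: linked_def)
qed

text \<open>A node without remaining neighbours counts as well, with z as a substitute parent; this
  is how the last node of the tree is eliminated.\<close>

definition is_leaf :: "'a set set \<Rightarrow> 'a set \<Rightarrow> 'a \<Rightarrow> 'a \<Rightarrow> 'a \<Rightarrow> bool" where
  "is_leaf F R z t p \<longleftrightarrow> t \<in> R \<and> (neighbours F R t = {} \<and> p = z \<or> neighbours F R t = {p})"

text \<open>The occurrences of v are connected, so a walk among them from t to s has to leave t
  through its only neighbour p, whose bag then contains v.\<close>

lemma leaf_bag_subset: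
  assumes linked: "\<And>v. linked F {r \<in> R. v \<in> bag r}"
    and leaf: "is_leaf F R z t p" and s: "s \<in> R" "s \<noteq> t"
  shows "bag t \<inter> bag s \<subseteq> bag p"
proof
  fix v assume v: "v \<in> bag t \<inter> bag s"
  let ?W = "{r \<in> R. v \<in> bag r}"
  have "(t, s) \<in> {(x, y). x \<in> ?W \<and> y \<in> ?W \<and> {x, y} \<in> F}\<^sup>*"
    using linked[of v] leaf s v by (auto simp: linked_def is_leaf_def)
  then obtain r where "r \<in> ?W" "{t, r} \<in> F"
    using s(2) by (auto elim: converse_rtranclE)
  then show "v \<in> bag p"
    using leaf by (auto simp: is_leaf_def neighbours_def)
qed

text \<open>The first node of a longest path is a leaf: a second neighbour would either extend the
  path or close a cycle.\<close>

lemma exists_leaf: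
  assumes "finite R" "R \<noteq> {}" "\<nexists>xs. is_cycle F xs" "\<And>x. {x} \<notin> F"
  shows "\<exists>t\<in>R. card (neighbours F R t) \<le> 1"
proof (rule ccontr)
  assume contra: "\<not> ?thesis"
  define path where "path xs \<longleftrightarrow> xs \<noteq> [] \<and> distinct xs \<and> set xs \<subseteq> R \<and>
    (\<forall>i. Suc i < length xs \<longrightarrow> {xs ! i, xs ! Suc i} \<in> F)" for xs
  obtain x where "x \<in> R"
    using assms(2) by blast
  then have "path [x]"
    by (simp add: path_def)
  moreover have "\<forall>xs. path xs \<longrightarrow> length xs < Suc (card R)"
    unfolding path_def using assms(1) by (metis card_mono distinct_card le_imp_less_Suc)
  ultimately obtain xs where xs: "path xs" and longest: "\<And>ys. path ys \<Longrightarrow> length ys \<le> length xs"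
    using ex_has_greatest_nat[of path "[x]" length "Suc (card R)"] by blast
  let ?t = "xs ! 0"
  have "?t \<in> R"
    using xs by (auto simp: path_def)
  \<comment> \<open>If the path is a single node, \<open>xs ! 1\<close> is unspecified; any
    one-element set does here.\<close>
  then have "\<not> card (neighbours F R ?t) \<le> card {xs ! 1}"
    using contra by auto
  then have "\<not> neighbours F R ?t \<subseteq> {xs ! 1}"
    using card_mono[of "{xs ! 1}" "neighbours F R ?t"] by auto
  then obtain y where y: "y \<in> R" "{?t, y} \<in> F" "y \<noteq> xs ! 1"
    by (auto simp: neighbours_def)
  have "y \<in> set xs"
  proof (rule ccontr)
    assume "y \<notin> set xs"
    then have "path (y # xs)"
      using xs y by (auto simp: path_def nth_Cons insert_commute split: nat.splits)
    then show False
      using longest by fastforce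
  qed
  then obtain j where j: "j < length xs" "y = xs ! j"
    by (auto simp: in_set_conv_nth)
  have "j \<noteq> 0"
    using j y(2) assms(4)[of ?t] by (metis insert_absorb2)
  moreover have "j \<noteq> 1"
    using j y(3) by auto
  \<comment> \<open>The segment of the path up to y is closed to a cycle by the edge between y and
    the first node; as j is neither 0 nor 1, it has at least three nodes.\<close>
  moreover have "{take (Suc j) xs ! i, take (Suc j) xs ! (Suc i mod Suc j)} \<in> F" if "i < Suc j" for i
  proof (cases "i = j")
    case True
    then show ?thesis
      using j y(2) by (simp add: insert_commute)
  next
    case False
    then have "Suc i < Suc j"
      using that by simp
    then show ?thesis
      using j xs by (simp add: path_def)
  qed
  ultimately have "is_cycle F (take (Suc j) xs)"
    using j xs unfolding is_cycle_def path_def by (simp add: Suc_le_eq)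
  then show False
    using assms(3) by blast
qed

section \<open>Numbering assignments\<close>

fun code :: "nat \<Rightarrow> nat set \<Rightarrow> (nat \<Rightarrow> nat) \<Rightarrow> nat \<Rightarrow> nat" where
  "code k S \<sigma> 0 = 0"
| "code k S \<sigma> (Suc m) = code k S \<sigma> m * k + (if m \<in> S then \<sigma> m else 0)"

lemma code_cong: "(\<And>v. v \<in> S \<Longrightarrow> \<sigma> v = \<tau> v) \<Longrightarrow> code k S \<sigma> m = code k S \<tau> m"
  by (induction m) auto

lemma code_less:
  assumes "0 < k" "\<And>v. v \<in> S \<Longrightarrow> \<sigma> v < k"
  shows "code k S \<sigma> m < k ^ m"
proof (induction m)
  case (Suc m)
  have "(if m \<in> S then \<sigma> m else 0) < k"
    using assms by simp
  then have "code k S \<sigma> (Suc m) < Suc (code k S \<sigma> m) * k"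
    by simp
  also have "\<dots> \<le> k ^ m * k"
    using Suc by (intro mult_le_mono1) simp
  finally show ?case
    by (simp add: mult.commute)
qed simp

lemma code_inject:
  assumes "code k S \<sigma> m = code k S \<tau> m" "\<And>v. v \<in> S \<Longrightarrow> \<sigma> v < k" "\<And>v. v \<in> S \<Longrightarrow> \<tau> v < k"
    and "v \<in> S" "v < m"
  shows "\<sigma> v = \<tau> v"
  using assms(1,5)
proof (induction m)
  case (Suc m)
  have k: "0 < k"
    using assms(2,4) by force
  let ?x = "if m \<in> S then \<sigma> m else 0" and ?y = "if m \<in> S then \<tau> m else 0"
  have digits: "?x < k" "?y < k"
    using assms(2,3) k by simp_all
  have eq: "code k S \<sigma> m * k + ?x = code k S \<tau> m * k + ?y"
    using Suc.prems(1) by simp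
  from arg_cong[OF eq, of "\<lambda>i. i div k"] have "code k S \<sigma> m = code k S \<tau> m"
    using digits by (simp only: div_mult_self3 div_less add_0_right k neq0_conv)
  moreover from arg_cong[OF eq, of "\<lambda>i. i mod k"] have "?x = ?y"
    using digits by (simp only: mod_mult_self3 mod_less)
  ultimately show ?case
    using Suc assms(4) by (cases "v = m") auto
qed simp

text \<open>Here positions are ranks within S, so the numbers below k^|S| correspond to the
  assignments of S without gaps. This numbering drives the enumeration of a bag, whereas
  \<open>code\<close> addresses the tables.\<close>

definition digit :: "nat \<Rightarrow> nat set \<Rightarrow> nat \<Rightarrow> nat \<Rightarrow> nat" where
  "digit k S i v = i div k ^ card (S \<inter> {..<v}) mod k"

lemma digit_less: "0 < k \<Longrightarrow> digit k S i v < k"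
  by (simp add: digit_def)

text \<open>A new vertex m of S adds a most significant digit b: the range splits into k blocks of
  equal length, and within block b the lower digits run through the same values as before.\<close>

lemma sum_digits:
  assumes "0 < k"
  shows "(\<Sum>i<k ^ card (S \<inter> {..<m}). f (restrict (digit k S i) (S \<inter> {..<m})))
    = (\<Sum>\<sigma>\<in>S \<inter> {..<m} \<rightarrow>\<^sub>E {..<k}. f \<sigma>)"
proof (induction m arbitrary: f)
  case (Suc m)
  let ?T = "S \<inter> {..<m}"
  let ?A = "k ^ card ?T"
  show ?case
  proof (cases "m \<in> S")
    case False
    then have "S \<inter> {..<Suc m} = ?T"
      by (auto simp: less_Suc_eq)
    then show ?thesis
      using Suc by simp
  next
    case True
    then have T: "S \<inter> {..<Suc m} = insert m ?T" and m: "m \<notin> ?T" "finite ?T"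
      by (auto simp: less_Suc_eq)
    \<comment> \<open>For a vertex v below m, \<open>b * ?A\<close> is a multiple of a power of k
      beyond the position of v, so it does not affect that digit.\<close>
    have old: "digit k S (b * ?A + i) v = digit k S i v" if "v \<in> ?T" for b i v
    proof -
      let ?a = "card (S \<inter> {..<v})"
      have "card (insert v (S \<inter> {..<v})) \<le> card ?T"
        using that by (intro card_mono) auto
      then have "Suc ?a \<le> card ?T"
        by simp
      then obtain e where "card ?T = ?a + Suc e"
        using less_imp_Suc_add by fastforce
      then have "b * ?A + i = k ^ ?a * (k * (k ^ e * b)) + i"
        by (simp add: power_add mult_ac)
      moreover have "k ^ ?a \<noteq> 0"
        using assms by simp
      ultimately have "(b * ?A + i) div k ^ ?a = k * (k ^ e * b) + i div k ^ ?a"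
        by (simp only: div_mult_self4 not_False_eq_True)
      then show ?thesis
        by (simp add: digit_def)
    qed
    have new: "digit k S (b * ?A + i) m = b" if "b < k" "i < ?A" for b i
      using that assms by (simp add: digit_def)
    have restr: "restrict (digit k S (b * ?A + i)) (insert m ?T) = (restrict (digit k S i) ?T)(m := b)"
      if "b < k" "i < ?A" for b i
      using old new[OF that] by (auto simp: restrict_def fun_eq_iff)
    have "(\<Sum>i<k ^ card (S \<inter> {..<Suc m}). f (restrict (digit k S i) (S \<inter> {..<Suc m})))
        = (\<Sum>i<k * ?A. f (restrict (digit k S i) (insert m ?T)))"
      using m by (simp add: T)
    also have "\<dots> = (\<Sum>b<k. \<Sum>i=b * ?A..<b * ?A + ?A. f (restrict (digit k S i) (insert m ?T)))"
      by (rule sum.nat_group[symmetric])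
    also have "\<dots> = (\<Sum>b<k. \<Sum>i<?A. f ((restrict (digit k S i) ?T)(m := b)))"
    proof (rule sum.cong)
      fix b assume b: "b \<in> {..<k}"
      have "(\<Sum>i=b * ?A..<b * ?A + ?A. f (restrict (digit k S i) (insert m ?T)))
          = (\<Sum>i<?A. f (restrict (digit k S (b * ?A + i)) (insert m ?T)))"
        using sum.shift_bounds_nat_ivl[of "\<lambda>i. f (restrict (digit k S i) (insert m ?T))" 0 "b * ?A" ?A]
        by (simp add: lessThan_atLeast0 add.commute)
      then show "(\<Sum>i=b * ?A..<b * ?A + ?A. f (restrict (digit k S i) (insert m ?T)))
          = (\<Sum>i<?A. f ((restrict (digit k S i) ?T)(m := b)))"
        using b restr by simp
    qed simp
    also have "\<dots> = (\<Sum>b<k. \<Sum>\<sigma>\<in>?T \<rightarrow>\<^sub>E {..<k}. f (\<sigma>(m := b)))"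
      by (intro sum.cong refl Suc.IH)
    also have "\<dots> = (\<Sum>(b, \<sigma>)\<in>{..<k} \<times> (?T \<rightarrow>\<^sub>E {..<k}). f (\<sigma>(m := b)))"
      by (simp add: sum.cartesian_product)
    also have "\<dots> = (\<Sum>\<sigma>\<in>insert m ?T \<rightarrow>\<^sub>E {..<k}. f \<sigma>)"
      unfolding PiE_insert_eq
      by (subst sum.reindex[OF inj_combinator[OF m(1)]]) (simp add: case_prod_unfold comp_def)
    finally show ?thesis
      by (simp only: T)
  qed
qed (simp add: restrict_def)

section \<open>Eliminating a leaf bag\<close>

text \<open>The elimination works for arbitrary vertex weights and for edge weights that depend on
  the states of the end points only. The index N is a dummy node whose empty bag lets roots be
  treated like other nodes.\<close>

locale bag_tables =
  fixes n N k :: nat and bag :: "nat \<Rightarrow> nat set" and E :: "nat set set"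
    and vw :: "nat \<Rightarrow> int" and ew :: "nat set \<Rightarrow> (nat \<Rightarrow> nat) \<Rightarrow> int"
  assumes bag_subset: "bag t \<subseteq> {..<n}"
    and bag_N [simp]: "bag N = {}"
    and finite_E: "finite E"
    and empty_notin_E: "{} \<notin> E"
    and ew_cong: "(\<And>v. v \<in> e \<Longrightarrow> \<sigma> v = \<tau> v) \<Longrightarrow> ew e \<sigma> = ew e \<tau>"
begin

abbreviation asg :: "nat set \<Rightarrow> (nat \<Rightarrow> nat) set" where
  "asg S \<equiv> S \<rightarrow>\<^sub>E {..<k}"

definition span :: "nat set \<Rightarrow> nat set" where
  "span R = (\<Union>t\<in>R. bag t)"

text \<open>\<open>R\<close> is the set of nodes that have not been eliminated yet, \<open>par\<close> maps the other nodes to their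
  parents (\<open>N\<close> for a root), and \<open>M c\<close> is the table that \<open>c\<close> has passed on. An edge is paid for by the
  node at which its first endpoint disappears.\<close>

definition remaining ::
    "nat set \<Rightarrow> (nat \<Rightarrow> nat) \<Rightarrow> (nat \<Rightarrow> (nat \<Rightarrow> nat) \<Rightarrow> int) \<Rightarrow> int" where
  "remaining R par M = (\<Sum>\<sigma>\<in>asg (span R).
     (\<Prod>v\<in>span R. vw (\<sigma> v)) * (\<Prod>e | e \<in> E \<and> e \<subseteq> span R. ew e \<sigma>) *
     (\<Prod>c | c \<in> {..<N} - R \<and> par c \<in> insert N R. M c (restrict \<sigma> (bag c \<inter> bag (par c)))))"

definition local_value ::
    "nat set \<Rightarrow> (nat \<Rightarrow> nat) \<Rightarrow> (nat \<Rightarrow> (nat \<Rightarrow> nat) \<Rightarrow> int) \<Rightarrow> nat \<Rightarrow> nat \<Rightarrow> (nat \<Rightarrow> nat) \<Rightarrow> int" where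
  "local_value R par M t p \<sigma> =
     (\<Prod>v\<in>bag t - bag p. vw (\<sigma> v)) * (\<Prod>e | e \<in> E \<and> e \<subseteq> bag t \<and> \<not> e \<subseteq> bag p. ew e \<sigma>) *
     (\<Prod>c | c \<in> {..<N} - R \<and> par c = t. M c (restrict \<sigma> (bag c \<inter> bag t)))"

definition message ::
    "nat set \<Rightarrow> (nat \<Rightarrow> nat) \<Rightarrow> (nat \<Rightarrow> (nat \<Rightarrow> nat) \<Rightarrow> int) \<Rightarrow> nat \<Rightarrow> nat \<Rightarrow> (nat \<Rightarrow> nat) \<Rightarrow> int" where
  "message R par M t p \<rho> =
     (\<Sum>\<tau> | \<tau> \<in> asg (bag t) \<and> restrict \<tau> (bag t \<inter> bag p) = \<rho>. local_value R par M t p \<tau>)"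

lemma finite_asg: "S \<subseteq> {..<n} \<Longrightarrow> finite (asg S)"
  by (intro finite_PiE) (auto intro: finite_subset)

lemma span_subset: "span R \<subseteq> {..<n}"
  using bag_subset by (auto simp: span_def)

lemma local_value_cong:
  assumes "\<And>v. v \<in> bag t \<Longrightarrow> \<sigma> v = \<tau> v"
  shows "local_value R par M t p \<sigma> = local_value R par M t p \<tau>"
proof -
  have "(\<Prod>v\<in>bag t - bag p. vw (\<sigma> v)) = (\<Prod>v\<in>bag t - bag p. vw (\<tau> v))"
    using assms by (intro prod.cong) auto
  moreover have "(\<Prod>e | e \<in> E \<and> e \<subseteq> bag t \<and> \<not> e \<subseteq> bag p. ew e \<sigma>)
      = (\<Prod>e | e \<in> E \<and> e \<subseteq> bag t \<and> \<not> e \<subseteq> bag p. ew e \<tau>)"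
    using assms by (intro prod.cong ew_cong) auto
  moreover have "restrict \<sigma> (bag c \<inter> bag t) = restrict \<tau> (bag c \<inter> bag t)" for c
    using assms by (intro restrict_ext) auto
  ultimately show ?thesis
    by (simp add: local_value_def)
qed

text \<open>An assignment splits into its part on the vertices seen by the other bags and its part
  on the bag of t. As t is a leaf, these overlap in \<open>bag t \<inter> bag p\<close> only, so by
  distributivity everything private to t can be summed separately for each assignment of the
  overlap, which gives the table left to p.\<close>

lemma remaining_eliminate:
  assumes R: "R \<subseteq> {..<N}" "t \<in> R" and p: "p \<in> insert N (R - {t})"
    and leaf: "\<And>s. s \<in> R \<Longrightarrow> s \<noteq> t \<Longrightarrow> bag t \<inter> bag s \<subseteq> bag p"
    and cover: "\<And>e. e \<in> E \<Longrightarrow> e \<subseteq> span R \<Longrightarrow> \<exists>s\<in>R. e \<subseteq> bag s"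
  shows "remaining (R - {t}) (par(t := p)) (M(t := message R par M t p)) = remaining R par M"
proof -
  let ?R = "R - {t}" and ?W = "span R" and ?W' = "span (R - {t})" and ?J = "bag t \<inter> bag p"
  have W: "?W = ?W' \<union> bag t"
    using R by (auto simp: span_def)
  \<comment> \<open>For p = N both sides are empty, and t leaves a single number.\<close>
  have J: "bag t \<inter> ?W' = ?J"
    using p leaf by (auto simp: span_def)
  have parent: "bag c \<inter> bag q \<subseteq> ?W'" if "q \<in> insert N ?R" for c q
    using that by (auto simp: span_def)
  have tN: "t < N" "t \<noteq> N"
    using R by auto
  define outer where "outer \<sigma> = (\<Prod>v\<in>?W'. vw (\<sigma> v)) * (\<Prod>e | e \<in> E \<and> e \<subseteq> ?W'. ew e \<sigma>) *
     (\<Prod>c | c \<in> {..<N} - R \<and> par c \<in> insert N ?R. M c (restrict \<sigma> (bag c \<inter> bag (par c))))" for \<sigma>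
  have outer_cong: "outer \<sigma> = outer \<tau>" if "\<And>v. v \<in> ?W' \<Longrightarrow> \<sigma> v = \<tau> v" for \<sigma> \<tau>
  proof -
    have "(\<Prod>v\<in>?W'. vw (\<sigma> v)) = (\<Prod>v\<in>?W'. vw (\<tau> v))"
      using that by (intro prod.cong) auto
    moreover have "(\<Prod>e | e \<in> E \<and> e \<subseteq> ?W'. ew e \<sigma>) = (\<Prod>e | e \<in> E \<and> e \<subseteq> ?W'. ew e \<tau>)"
      using that by (intro prod.cong ew_cong) auto
    moreover have "(\<Prod>c | c \<in> {..<N} - R \<and> par c \<in> insert N ?R. M c (restrict \<sigma> (bag c \<inter> bag (par c))))
        = (\<Prod>c | c \<in> {..<N} - R \<and> par c \<in> insert N ?R. M c (restrict \<tau> (bag c \<inter> bag (par c))))"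
    proof (rule prod.cong)
      fix c assume "c \<in> {c. c \<in> {..<N} - R \<and> par c \<in> insert N ?R}"
      then have "restrict \<sigma> (bag c \<inter> bag (par c)) = restrict \<tau> (bag c \<inter> bag (par c))"
        using that parent[of "par c" c] by (intro restrict_ext) blast
      then show "M c (restrict \<sigma> (bag c \<inter> bag (par c))) = M c (restrict \<tau> (bag c \<inter> bag (par c)))"
        by simp
    qed simp
    ultimately show ?thesis
      by (simp add: outer_def)
  qed
  have split: "(\<Prod>v\<in>?W. vw (\<sigma> v)) * (\<Prod>e | e \<in> E \<and> e \<subseteq> ?W. ew e \<sigma>) *
      (\<Prod>c | c \<in> {..<N} - R \<and> par c \<in> insert N R. M c (restrict \<sigma> (bag c \<inter> bag (par c))))
      = outer \<sigma> * local_value R par M t p \<sigma>" for \<sigma>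
  proof -
    have fin: "finite ?W'" "finite (bag t)"
      using finite_subset[OF span_subset] finite_subset[OF bag_subset] by simp_all
    have "?W = ?W' \<union> (bag t - bag p)" "?W' \<inter> (bag t - bag p) = {}"
      using W J by auto
    then have vertices: "(\<Prod>v\<in>?W. vw (\<sigma> v)) = (\<Prod>v\<in>?W'. vw (\<sigma> v)) * (\<Prod>v\<in>bag t - bag p. vw (\<sigma> v))"
      using fin by (simp add: prod.union_disjoint)
    \<comment> \<open>Some remaining bag covers the edge; any bag other than that of t would put the
      edge inside \<open>?W'\<close>.\<close>
    have inner: "e \<subseteq> bag t" if e: "e \<in> E" "e \<subseteq> ?W" "\<not> e \<subseteq> ?W'" for e
    proof -
      obtain s where s: "s \<in> R" "e \<subseteq> bag s"
        using cover[OF e(1,2)] by blast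
      then have "s = t"
        using e(3) unfolding span_def by (metis DiffI UN_upper order.trans singletonD)
      with s show ?thesis
        by simp
    qed
    have not_outer: "\<not> e \<subseteq> ?W'" if "e \<subseteq> bag t" "\<not> e \<subseteq> bag p" for e
      using that J by blast
    have in_outer: "e \<subseteq> ?W'" if "e \<subseteq> bag t" "e \<subseteq> bag p" for e
      using that J by blast
    have W_subsets: "?W' \<subseteq> ?W" "bag t \<subseteq> ?W"
      using W by simp_all
    have "e \<subseteq> ?W \<longleftrightarrow> e \<subseteq> ?W' \<or> e \<subseteq> bag t \<and> \<not> e \<subseteq> bag p" if "e \<in> E" for e
    proof
      assume "e \<subseteq> ?W"
      then show "e \<subseteq> ?W' \<or> e \<subseteq> bag t \<and> \<not> e \<subseteq> bag p"
        using inner[OF that] in_outer[of e] by blast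
    next
      assume "e \<subseteq> ?W' \<or> e \<subseteq> bag t \<and> \<not> e \<subseteq> bag p"
      then show "e \<subseteq> ?W"
        using W_subsets by (elim disjE conjE) (rule order.trans, assumption+)+
    qed
    then have edge_sets: "{e. e \<in> E \<and> e \<subseteq> ?W}
        = {e. e \<in> E \<and> e \<subseteq> ?W'} \<union> {e. e \<in> E \<and> e \<subseteq> bag t \<and> \<not> e \<subseteq> bag p}"
      by (auto simp only: Un_iff mem_Collect_eq)
    have edges: "(\<Prod>e | e \<in> E \<and> e \<subseteq> ?W. ew e \<sigma>)
        = (\<Prod>e | e \<in> E \<and> e \<subseteq> ?W'. ew e \<sigma>) * (\<Prod>e | e \<in> E \<and> e \<subseteq> bag t \<and> \<not> e \<subseteq> bag p. ew e \<sigma>)"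
      unfolding edge_sets
      by (rule prod.union_disjoint) (use finite_E not_outer in auto)
    have "{c. c \<in> {..<N} - R \<and> par c \<in> insert N R}
        = {c. c \<in> {..<N} - R \<and> par c \<in> insert N ?R} \<union> {c. c \<in> {..<N} - R \<and> par c = t}"
      and "{c. c \<in> {..<N} - R \<and> par c \<in> insert N ?R} \<inter> {c. c \<in> {..<N} - R \<and> par c = t} = {}"
      using R(2) tN by auto
    then have "(\<Prod>c | c \<in> {..<N} - R \<and> par c \<in> insert N R. M c (restrict \<sigma> (bag c \<inter> bag (par c))))
        = (\<Prod>c | c \<in> {..<N} - R \<and> par c \<in> insert N ?R. M c (restrict \<sigma> (bag c \<inter> bag (par c))))
        * (\<Prod>c | c \<in> {..<N} - R \<and> par c = t. M c (restrict \<sigma> (bag c \<inter> bag (par c))))"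
      by (simp add: prod.union_disjoint)
    also have "(\<Prod>c | c \<in> {..<N} - R \<and> par c = t. M c (restrict \<sigma> (bag c \<inter> bag (par c))))
        = (\<Prod>c | c \<in> {..<N} - R \<and> par c = t. M c (restrict \<sigma> (bag c \<inter> bag t)))"
      by (rule prod.cong) auto
    finally show ?thesis
      unfolding outer_def local_value_def vertices edges by (simp only: mult_ac)
  qed
  \<comment> \<open>Extensions of \<sigma>' to the bag of t correspond to the assignments of this
    bag that agree with \<sigma>' on the overlap: one direction restricts, the other glues.\<close>
  have fibre: "(\<Sum>\<sigma> | \<sigma> \<in> asg ?W \<and> restrict \<sigma> ?W' = \<sigma>'. local_value R par M t p \<sigma>)
      = message R par M t p (restrict \<sigma>' ?J)" if \<sigma>': "\<sigma>' \<in> asg ?W'" for \<sigma>'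
    unfolding message_def
  proof (rule sum.reindex_bij_witness[where
        i = "\<lambda>\<tau>. restrict (\<lambda>v. if v \<in> ?W' then \<sigma>' v else \<tau> v) ?W" and j = "\<lambda>\<sigma>. restrict \<sigma> (bag t)"])
    fix \<sigma> assume \<sigma>: "\<sigma> \<in> {\<sigma> \<in> asg ?W. restrict \<sigma> ?W' = \<sigma>'}"
    then have restr: "\<sigma>' v = \<sigma> v" if "v \<in> ?W'" for v
      using that by auto
    show "restrict (\<lambda>v. if v \<in> ?W' then \<sigma>' v else restrict \<sigma> (bag t) v) ?W = \<sigma>"
      using \<sigma> W by (intro PiE_ext[of _ ?W "\<lambda>_. {..<k}"]) (auto simp: restr)
    have "\<sigma> v = \<sigma>' v" if "v \<in> ?J" for v
    proof -
      have "v \<in> ?W'"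
        using that J by blast
      then show ?thesis
        by (simp add: restr)
    qed
    then have "restrict (restrict \<sigma> (bag t)) ?J = restrict \<sigma>' ?J"
      by (intro restrict_ext) simp
    then show "restrict \<sigma> (bag t) \<in> {\<tau> \<in> asg (bag t). restrict \<tau> ?J = restrict \<sigma>' ?J}"
      using \<sigma> W by auto
    show "local_value R par M t p (restrict \<sigma> (bag t)) = local_value R par M t p \<sigma>"
      by (rule local_value_cong) simp
  next
    fix \<tau> assume \<tau>: "\<tau> \<in> {\<tau> \<in> asg (bag t). restrict \<tau> ?J = restrict \<sigma>' ?J}"
    then have restr: "\<tau> v = \<sigma>' v" if "v \<in> ?J" for v
    proof -
      have "restrict \<tau> ?J v = restrict \<sigma>' ?J v"
        using \<tau> by simp
      with that show ?thesis
        by simp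
    qed
    show "restrict (restrict (\<lambda>v. if v \<in> ?W' then \<sigma>' v else \<tau> v) ?W) (bag t) = \<tau>"
    proof
      fix v
      show "restrict (restrict (\<lambda>v. if v \<in> ?W' then \<sigma>' v else \<tau> v) ?W) (bag t) v = \<tau> v"
      proof (cases "v \<in> bag t")
        case True
        then have "v \<in> ?W" "v \<in> ?W' \<Longrightarrow> v \<in> ?J"
          using W J by blast+
        with True restr[of v] show ?thesis
          by simp
      next
        case False
        with \<tau> show ?thesis
          by (auto dest: PiE_arb)
      qed
    qed
    have "restrict (restrict (\<lambda>v. if v \<in> ?W' then \<sigma>' v else \<tau> v) ?W) ?W' = \<sigma>'"
      using \<sigma>' W by (intro PiE_ext[of _ ?W' "\<lambda>_. {..<k}"]) auto
    moreover have "restrict (\<lambda>v. if v \<in> ?W' then \<sigma>' v else \<tau> v) ?W \<in> asg ?W"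
      using \<tau> \<sigma>' W by (auto simp: restrict_PiE_iff PiE_iff)
    ultimately show "restrict (\<lambda>v. if v \<in> ?W' then \<sigma>' v else \<tau> v) ?W
        \<in> {\<sigma> \<in> asg ?W. restrict \<sigma> ?W' = \<sigma>'}"
      by blast
  qed
  have "remaining R par M = (\<Sum>\<sigma>\<in>asg ?W. outer \<sigma> * local_value R par M t p \<sigma>)"
    by (simp only: remaining_def split)
  also have "\<dots> = (\<Sum>\<sigma>'\<in>asg ?W'. \<Sum>\<sigma> | \<sigma> \<in> asg ?W \<and> restrict \<sigma> ?W' = \<sigma>'.
      outer \<sigma> * local_value R par M t p \<sigma>)"
    by (rule sum.group[symmetric]) (use W span_subset in \<open>auto intro!: finite_asg\<close>)
  also have "\<dots> = (\<Sum>\<sigma>'\<in>asg ?W'. outer \<sigma>' *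
      (\<Sum>\<sigma> | \<sigma> \<in> asg ?W \<and> restrict \<sigma> ?W' = \<sigma>'. local_value R par M t p \<sigma>))"
    unfolding sum_distrib_left by (intro sum.cong refl arg_cong2[where f = "(*)"] outer_cong) auto
  also have "\<dots> = (\<Sum>\<sigma>'\<in>asg ?W'. outer \<sigma>' * message R par M t p (restrict \<sigma>' ?J))"
    by (intro sum.cong refl) (simp add: fibre)
  also have "\<dots> = remaining ?R (par(t := p)) (M(t := message R par M t p))"
  proof -
    \<comment> \<open>The children of t drop out, since their tables are used up in the message, and
      t itself enters as a child of p.\<close>
    have *: "{c. c \<in> {..<N} - ?R \<and> (par(t := p)) c \<in> insert N ?R}
        = insert t {c. c \<in> {..<N} - R \<and> par c \<in> insert N ?R}"
      using R(2) p tN by auto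
    have "(\<Prod>c | c \<in> {..<N} - ?R \<and> (par(t := p)) c \<in> insert N ?R.
          (M(t := message R par M t p)) c (restrict \<sigma> (bag c \<inter> bag ((par(t := p)) c))))
        = message R par M t p (restrict \<sigma> ?J) *
          (\<Prod>c | c \<in> {..<N} - R \<and> par c \<in> insert N ?R. M c (restrict \<sigma> (bag c \<inter> bag (par c))))" for \<sigma>
      unfolding * using R(2) by (subst prod.insert) (auto intro!: prod.cong)
    then show ?thesis
      by (simp add: remaining_def outer_def mult_ac)
  qed
  finally show ?thesis
    by simp
qed

text \<open>Nothing is left to assign, and the numbers left to the dummy node multiply to its
  message. One more run of the node step, on N, therefore yields the total.\<close>

lemma remaining_empty: "remaining {} par M = message {} par M N N (\<lambda>_. undefined)"
proof -
  have "(\<Prod>e | e = {} \<and> e \<in> E. ew e \<sigma>) = 1" for \<sigma>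
    by (rule prod.neutral) (use empty_notin_E in auto)
  moreover have "{\<tau>. \<tau> \<in> asg {} \<and> restrict \<tau> {} = (\<lambda>_. undefined)} = {\<lambda>_. undefined}"
    by auto
  moreover have "(\<Prod>c | c \<in> {..<N} - {} \<and> par c \<in> {N}. M c (restrict (\<lambda>_. undefined) (bag c \<inter> bag (par c))))
      = (\<Prod>c | c \<in> {..<N} - {} \<and> par c = N. M c (restrict (\<lambda>_. undefined) (bag c \<inter> bag N)))"
    by (rule prod.cong) auto
  ultimately show ?thesis
    by (simp add: remaining_def message_def local_value_def span_def)
qed

text \<open>This is the order in which the program adds: one pass over all assignments of the bag,
  each contributing to the single entry selected by its restriction.\<close>

lemma message_eq_sum_digits:
  assumes "0 < k"
  shows "message R par M t p \<rho> = (\<Sum>i<k ^ card (bag t).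
    if restrict (digit k (bag t) i) (bag t \<inter> bag p) = \<rho>
    then local_value R par M t p (digit k (bag t) i) else 0)"
proof -
  let ?f = "\<lambda>\<tau>. if restrict \<tau> (bag t \<inter> bag p) = \<rho> then local_value R par M t p \<tau> else 0"
  have bag: "bag t \<inter> {..<n} = bag t"
    using bag_subset[of t] by blast
  have restr: "?f (restrict \<tau> (bag t)) = ?f \<tau>" for \<tau>
    using local_value_cong[of t "restrict \<tau> (bag t)" \<tau> R par M p] by (simp add: Int_absorb1)
  have "message R par M t p \<rho> = (\<Sum>\<tau>\<in>asg (bag t). ?f \<tau>)"
    unfolding message_def using bag_subset[of t] by (simp add: sum.inter_filter[symmetric] finite_asg)
  also have "\<dots> = (\<Sum>i<k ^ card (bag t). ?f (restrict (digit k (bag t) i) (bag t)))"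
    using sum_digits[OF assms, where S = "bag t" and m = n and f = ?f]
    unfolding bag by simp
  also have "\<dots> = (\<Sum>i<k ^ card (bag t). ?f (digit k (bag t) i))"
    by (intro sum.cong refl restr)
  finally show ?thesis .
qed

end

section \<open>The program\<close>

context degree_weights
begin

definition k :: nat where
  "k = Suc K"

lemma k_pos [simp]: "0 < k"
  by (simp add: k_def)

text \<open>K, D and \<open>d\<close> depend on X alone, so powers and sums ranging over them are
  unrolled into the program text, and one program serves all graphs.\<close>

fun power_exp :: "aexp \<Rightarrow> nat \<Rightarrow> aexp" where
  "power_exp e 0 = Const 1"
| "power_exp e (Suc j) = Mul e (power_exp e j)"

fun sum_exp :: "(nat \<Rightarrow> aexp) \<Rightarrow> nat \<Rightarrow> aexp" where
  "sum_exp f 0 = Const 0"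
| "sum_exp f (Suc j) = Add (sum_exp f j) (f j)"

fun seq_upto :: "(nat \<Rightarrow> com) \<Rightarrow> nat \<Rightarrow> com" where
  "seq_upto f 0 = Skip"
| "seq_upto f (Suc j) = Seq (seq_upto f j) (f j)"

lemma aval_power_exp [simp]: "aval (power_exp e j) \<sigma> = aval e \<sigma> ^ j"
  by (induction j) simp_all

lemma aval_sum_exp [simp]: "aval (sum_exp f j) \<sigma> = (\<Sum>i<j. aval (f i) \<sigma>)"
  by (induction j) simp_all

definition remainder :: "aexp \<Rightarrow> aexp" where
  "remainder e = Sub e (Mul (Var ''Q'') (Div e (Var ''Q'')))"

lemma aval_remainder [simp]: "aval (remainder e) \<sigma> = aval e \<sigma> mod \<sigma> ''Q'' 0"
  by (simp add: remainder_def minus_mult_div_eq_mod)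

definition weight_exp :: "nat \<Rightarrow> aexp" where
  "weight_exp i =
     (if i = K then Mul (Const D) (power_exp (Var ''eps'') K)
      else Sub (Const 0) (sum_exp (\<lambda>j. Mul (Const (d j i)) (power_exp (Var ''eps'') (K - j))) K))"

lemma aval_weight_exp: "aval (weight_exp i) \<sigma> = weight (\<sigma> ''eps'' 0) i"
  by (simp add: weight_exp_def weight_def)

definition point_exp :: "nat \<Rightarrow> aexp" where
  "point_exp i = (if i = K then Const 1 else Mul (Const (int i)) (Var ''eps''))"

lemma aval_point_exp: "aval (point_exp i) \<sigma> = point (\<sigma> ''eps'' 0) i"
  by (simp add: point_exp_def point_def)

section \<open>Computing the constants of an instance\<close>

definition weights_prog :: com where
  "weights_prog = seq_upto (\<lambda>i. Seq (Write ''C'' (Const (int i)) (remainder (weight_exp i)))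
     (Write ''b'' (Const (int i)) (point_exp i))) k"

definition square_n :: aexp where
  "square_n = Mul (Var ''n'') (Var ''n'')"

definition constants_prog :: com where
  "constants_prog =
     Seq (Assign ''y'' (Const 2)) (
     Seq (For ''a'' square_n (Assign ''y'' (Mul (Var ''y'') (Const 2)))) (
     Seq (Assign ''Dn'' (Const 1)) (
     Seq (For ''a'' (Var ''n'') (Assign ''Dn'' (Mul (Var ''Dn'') (Const D)))) (
     Seq (Assign ''eps'' (Var ''Dn'')) (
     Seq (For ''a'' (Add square_n (Const 1)) (Assign ''eps'' (Mul (Var ''eps'') (Var ''y'')))) (
     Seq (Assign ''P'' (Const 1)) (
     Seq (For ''a'' (Var ''n'') (Assign ''P'' (Mul (Var ''P'') (power_exp (Var ''eps'') K)))) (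
     Seq (Assign ''Q'' (Mul (Var ''P'') (Var ''eps'')))
         weights_prog))))))))"

section \<open>Evaluating one assignment of a bag\<close>

definition bag_at :: "string \<Rightarrow> string \<Rightarrow> aexp" where
  "bag_at t v = Read ''bag'' (Add (Mul (Var t) (Var ''n'')) (Var v))"

definition code_prog :: "string \<Rightarrow> string \<Rightarrow> com" where
  "code_prog t p =
     Seq (Assign ''h'' (Const 0))
         (For ''v'' (Var ''n'') (Assign ''h'' (Add (Mul (Var ''h'') (Const (int k)))
           (Mul (Mul (bag_at t ''v'') (bag_at p ''v'')) (Read ''g'' (Var ''v''))))))"

text \<open>The vertices of the bag are met in increasing order, so stripping the least significant
  digit at each of them gives v the digit at its rank. Entries of \<open>g\<close> outside the bag
  are stale, but they are read only where a factor 0 cancels them.\<close>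

definition decode_prog :: com where
  "decode_prog =
     Seq (Assign ''z'' (Var ''i''))
         (For ''v'' (Var ''n'') (IfPos (bag_at ''t'' ''v'')
           (Seq (Write ''g'' (Var ''v'') (Sub (Var ''z'') (Mul (Const (int k)) (Div (Var ''z'') (Const (int k))))))
                (Assign ''z'' (Div (Var ''z'') (Const (int k)))))
           Skip))"

definition vertex_prog :: com where
  "vertex_prog = For ''v'' (Var ''n'')
     (IfPos (Mul (bag_at ''t'' ''v'') (Sub (Const 1) (bag_at ''p'' ''v'')))
       (Assign ''x'' (remainder (Mul (Var ''x'') (Read ''C'' (Read ''g'' (Var ''v''))))))
       Skip)"

definition edge_row_prog :: com where
  "edge_row_prog = For ''u'' (Var ''v'')
     (IfPos (Mul (Mul (Read ''graph'' (Add (Mul (Var ''u'') (Var ''n'')) (Var ''v'')))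
                      (Mul (bag_at ''t'' ''u'') (bag_at ''t'' ''v'')))
                 (Sub (Const 1) (Mul (bag_at ''p'' ''u'') (bag_at ''p'' ''v''))))
       (Assign ''x'' (remainder (Mul (Var ''x'') (Add (Const 1) (Mul (Var ''y'')
         (Mul (Read ''b'' (Read ''g'' (Var ''u''))) (Read ''b'' (Read ''g'' (Var ''v'')))))))))
       Skip)"

definition edge_prog :: com where
  "edge_prog = For ''v'' (Var ''n'') edge_row_prog"

text \<open>The tables of the N + 1 nodes, dummy node included, are interleaved with stride N + 1,
  so that an address does not depend on the sizes of the tables.\<close>

definition message_address :: "string \<Rightarrow> aexp" where
  "message_address t = Add (Var t) (Mul (Add (Var ''N'') (Const 1)) (Var ''h''))"

text \<open>Guards of the form \<open>1 - z * z\<close> test \<open>z = 0\<close>.\<close>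

definition child_prog :: com where
  "child_prog = For ''c'' (Var ''N'')
     (IfPos (Sub (Const 1) (Mul (Sub (Read ''par'' (Var ''c'')) (Add (Var ''t'') (Const 1)))
                                (Sub (Read ''par'' (Var ''c'')) (Add (Var ''t'') (Const 1)))))
       (Seq (code_prog ''c'' ''t'')
            (Assign ''x'' (remainder (Mul (Var ''x'') (Read ''M'' (message_address ''c''))))))
       Skip)"

definition assignment_prog :: com where
  "assignment_prog =
     Seq decode_prog (
     Seq (Assign ''x'' (Const 1)) (
     Seq vertex_prog (
     Seq edge_prog (
     Seq child_prog (
     Seq (code_prog ''t'' ''p'')
         (Write ''M'' (message_address ''t'')
           (remainder (Add (Read ''M'' (message_address ''t'')) (Var ''x'')))))))))"

text \<open>A cell of \<open>par\<close> is 0 as long as the node is present; for an eliminated node it holds the parent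
  plus 1.\<close>

definition node_prog :: com where
  "node_prog =
     Seq (Write ''par'' (Var ''t'') (Add (Var ''p'') (Const 1))) (
     Seq (Assign ''K'' (Const 1)) (
     Seq (For ''v'' (Var ''n'')
           (Assign ''K'' (Mul (Var ''K'') (Add (Const 1) (Mul (bag_at ''t'' ''v'') (Const (int K)))))))
         (For ''i'' (Var ''K'') assignment_prog)))"

text \<open>An entry of \<open>par\<close> is 0 for a present node and at least 1 otherwise, so the
  test is positive exactly for present neighbours. The initial value N of \<open>q\<close> is the
  parent used when there are none.\<close>

definition neighbour_prog :: com where
  "neighbour_prog =
     Seq (Assign ''d'' (Const 0)) (
     Seq (Assign ''q'' (Var ''N''))
         (For ''s'' (Var ''N'')
           (IfPos (Mul (Read ''tree'' (Add (Mul (Var ''u'') (Var ''N'')) (Var ''s'')))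
                       (Sub (Const 1) (Read ''par'' (Var ''s''))))
             (Seq (Assign ''d'' (Add (Var ''d'') (Const 1))) (Assign ''q'' (Var ''s'')))
             Skip)))"

text \<open>The scan does not stop at a leaf: later leaves overwrite earlier ones, which keeps the
  number of rounds fixed at N.\<close>

definition leaf_prog :: com where
  "leaf_prog = For ''u'' (Var ''N'')
     (IfPos (Sub (Const 1) (Read ''par'' (Var ''u'')))
       (Seq neighbour_prog
            (IfPos (Sub (Const 2) (Var ''d''))
              (Seq (Assign ''t'' (Var ''u'')) (Assign ''p'' (Var ''q'')))
              Skip))
       Skip)"

text \<open>Only the cells 0 to n^2 are written. All others still hold 0, which is the number of
  solutions of such sizes, negative ones included.\<close>

definition output_prog :: com where
  "output_prog =
     Seq (Assign ''ans'' (Div (Div (Read ''M'' (Var ''N'')) (Var ''P'')) (Var ''Dn'')))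
         (For ''s'' (Add square_n (Const 1))
           (Seq (Write ''out'' (Var ''s'') (Sub (Var ''ans'') (Mul (Var ''y'') (Div (Var ''ans'') (Var ''y'')))))
                (Assign ''ans'' (Div (Var ''ans'') (Var ''y'')))))"

text \<open>The index \<open>N\<close>, whose row in the bag matrix is zero, acts as a node with empty bag and as the
  parent of the last remaining node. Processing it after the loop leaves the value of the partition
  function in its only cell.\<close>

definition antifactor_prog :: com where
  "antifactor_prog =
     Seq constants_prog (
     Seq (For ''r'' (Var ''N'') (Seq leaf_prog node_prog)) (
     Seq (Assign ''t'' (Var ''N'')) (
     Seq (Assign ''p'' (Var ''N'')) (
     Seq node_prog
         output_prog))))"

text \<open>The guard of the only loop whose number of iterations is not polynomial.\<close>

definition table_guard :: aexp where
  "table_guard = Sub (Var ''K'') (Var ''i'')"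

lemma unnested_seq_upto: "(\<And>i. unnested g (f i)) \<Longrightarrow> unnested g (seq_upto f m)"
  by (induction m) auto

text \<open>The loop over assignments appears twice, in the main loop and in the closing step for
  the dummy node, and contains no copy of itself.\<close>

lemma unnested_antifactor_prog: "unnested table_guard antifactor_prog"
  unfolding antifactor_prog_def constants_prog_def weights_prog_def leaf_prog_def neighbour_prog_def
    node_prog_def assignment_prog_def decode_prog_def vertex_prog_def edge_prog_def edge_row_prog_def
    child_prog_def code_prog_def output_prog_def For_def square_n_def table_guard_def
  by (auto simp: bag_at_def intro!: unnested_seq_upto)

end

section \<open>Correctness of the program\<close>

text \<open>Framing by whole arrays is enough, as every scalar variable of the program occupies an
  array of its own.\<close>

definition agree :: "string set \<Rightarrow> store \<Rightarrow> store \<Rightarrow> bool" where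
  "agree S \<sigma> \<tau> \<longleftrightarrow> (\<forall>a. a \<notin> S \<longrightarrow> \<tau> a = \<sigma> a)"

lemma agreeD: "agree S \<sigma> \<tau> \<Longrightarrow> a \<notin> S \<Longrightarrow> \<tau> a = \<sigma> a"
  by (simp add: agree_def)

lemma agree_refl [simp]: "agree S \<sigma> \<sigma>"
  by (simp add: agree_def)

lemma agree_set_var [simp]: "x \<in> S \<Longrightarrow> agree S \<sigma> (set_var \<tau> x i) \<longleftrightarrow> agree S \<sigma> \<tau>"
  by (auto simp: agree_def set_var_def)

lemma agree_upd [simp]: "x \<in> S \<Longrightarrow> agree S \<sigma> (\<tau>(x := f)) \<longleftrightarrow> agree S \<sigma> \<tau>"
  by (auto simp: agree_def)

lemma agree_trans: "agree S \<sigma> \<tau> \<Longrightarrow> agree T \<tau> \<rho> \<Longrightarrow> S \<subseteq> U \<Longrightarrow> T \<subseteq> U \<Longrightarrow> agree U \<sigma> \<rho>"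
  unfolding agree_def by (metis subsetD)

text \<open>The dummy node N gets an empty bag, in accordance with the input memory, where the cells
  beyond the last row of the bag matrix are 0.\<close>

definition ext_bag :: "nat \<Rightarrow> (nat \<Rightarrow> nat set) \<Rightarrow> nat \<Rightarrow> nat set" where
  "ext_bag N B t = (if t < N then B t else {})"

text \<open>Each edge is met once, through the pair of its larger and its smaller end point.\<close>

lemma prod_edges:
  fixes f :: "nat set \<Rightarrow> int"
  assumes "simple_graph {..<n} E"
  shows "(\<Prod>v<n. \<Prod>u<v. if {u, v} \<in> E \<and> R {u, v} then f {u, v} else 1) = (\<Prod>e | e \<in> E \<and> R e. f e)"
proof -
  let ?I = "SIGMA v:{..<n}. {..<v}"
  have "(\<Prod>v<n. \<Prod>u<v. if {u, v} \<in> E \<and> R {u, v} then f {u, v} else 1)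
      = (\<Prod>(v, u)\<in>?I. if {u, v} \<in> E \<and> R {u, v} then f {u, v} else 1)"
    by (rule prod.Sigma) auto
  also have "\<dots> = (\<Prod>(v, u) | (v, u) \<in> ?I \<and> {u, v} \<in> E \<and> R {u, v}. f {u, v})"
    by (rule prod.mono_neutral_cong_right) (auto split: if_splits)
  also have "\<dots> = (\<Prod>e | e \<in> E \<and> R e. f e)"
  proof (rule prod.reindex_bij_witness[where i = "\<lambda>e. (Max e, Min e)" and j = "\<lambda>(v, u). {u, v}"])
    fix e assume e: "e \<in> {e. e \<in> E \<and> R e}"
    then have "e \<subseteq> {..<n}" "card e = 2"
      using assms by (auto simp: simple_graph_def)
    moreover from this obtain u v where uv: "e = {u, v}" "u \<noteq> v"
      by (auto simp: card_2_iff)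
    ultimately have "{Min e, Max e} = e" "Min e < Max e" "Max e < n"
      by (auto simp: min_def max_def)
    with e show "(\<lambda>(v, u). {u, v}) (Max e, Min e) = e"
      "(Max e, Min e) \<in> {a. case a of (v, u) \<Rightarrow> (v, u) \<in> ?I \<and> {u, v} \<in> E \<and> R {u, v}}"
      by auto
  qed auto
  finally show ?thesis .
qed

text \<open>There are at most 2^(n^2) edge sets, so each count is a digit in base
  \<open>base\<close>, and n^2 + 1 digits suffice; \<open>eps\<close> exceeds D^n times the number
  with these digits. Reduction modulo \<open>shift * eps\<close> hence leaves just the leading term.
  The \<open>count\<close> assumptions bound numbers of rounds, the \<open>cap\<close> assumptions
  the contents of cells.\<close>

locale antifactor_run = degree_weights X K D d + cost_bounds L \<nu>
  for X K D d L \<nu> +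
  fixes n N :: nat and E F :: "nat set set" and B :: "nat \<Rightarrow> nat set"
    and base eps shift modulus :: int
  assumes simple: "simple_graph {..<n} E"
    and decomposition: "tree_decomposition {..<n} E {..<N} F B"
    and base_def: "base = 2 ^ (n * n + 1)"
    and eps_def: "eps = D ^ n * base ^ (n * n + 1)"
    and shift_def: "shift = eps ^ (K * n)"
    and modulus_def: "modulus = shift * eps"
    and count_square: "e \<noteq> table_guard \<Longrightarrow> n * n + 1 \<le> \<nu> e"
    and count_N: "e \<noteq> table_guard \<Longrightarrow> N \<le> \<nu> e"
    and count_table: "t \<le> N \<Longrightarrow> k ^ card (ext_bag N B t) \<le> \<nu> table_guard"
    and cap_square: "int (n * n + 1) \<le> 2 ^ L"
    and cap_N: "int (N + 1) \<le> 2 ^ L"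
    and cap_table: "int (k ^ n) \<le> 2 ^ L"
    and cap_modulus: "int k * modulus \<le> 2 ^ L"
begin

section \<open>Size relations between the constants\<close>

abbreviation "bag \<equiv> ext_bag N B"

lemma count_n: "e \<noteq> table_guard \<Longrightarrow> n \<le> \<nu> e"
  using count_square[of e] le_square[of n] by linarith

lemma cap_n: "int n \<le> 2 ^ L"
proof -
  have "int n \<le> int (n * n + 1)"
    using le_square[of n] by linarith
  then show ?thesis
    using cap_square by linarith
qed

lemma base_ge: "2 \<le> base"
  by (simp add: base_def)

lemma base_le_eps: "base \<le> eps"
proof -
  have "1 * base ^ 1 \<le> D ^ n * base ^ (n * n + 1)"
    using D_pos base_ge by (intro mult_mono power_increasing one_le_power) auto
  then show ?thesis
    by (simp add: eps_def)
qed

lemma eps_ge: "2 \<le> eps"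
  using base_ge base_le_eps by linarith

lemma shift_pos: "1 \<le> shift"
  unfolding shift_def using eps_ge by (intro one_le_power) simp

lemma eps_le_modulus: "eps \<le> modulus"
  using mult_right_mono[OF shift_pos, of eps] eps_ge by (simp add: modulus_def)

lemma modulus_ge: "2 \<le> modulus"
  using eps_ge eps_le_modulus by linarith

lemma shift_le_modulus: "shift \<le> modulus"
  using mult_left_mono[of 1 eps shift] eps_ge shift_pos by (simp add: modulus_def)

lemma modulus_le_cap: "modulus \<le> 2 ^ L"
proof -
  have "1 * modulus \<le> int k * modulus"
    using modulus_ge k_pos by (intro mult_right_mono) linarith+
  then show ?thesis
    using cap_modulus by linarith
qed

lemma abs_mod_le_cap: "\<bar>i mod modulus\<bar> \<le> 2 ^ L"
  using modulus_ge modulus_le_cap pos_mod_bound[of modulus i] pos_mod_sign[of modulus i] by linarith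

sublocale bag_tables n N k bag E "weight eps" "edge_weight base eps"
proof
  show "bag t \<subseteq> {..<n}" for t
    using decomposition by (auto simp: ext_bag_def tree_decomposition_def)
  have E: "E \<subseteq> Pow {..<n}" "{} \<notin> E"
    using simple by (auto simp: simple_graph_def)
  then show "finite E"
    using finite_subset by blast
  show "{} \<notin> E"
    by (rule E)
  fix e and \<sigma> \<tau> :: "nat \<Rightarrow> nat" assume "\<And>v. v \<in> e \<Longrightarrow> \<sigma> v = \<tau> v"
  then have "(\<Prod>v\<in>e. point eps (\<sigma> v)) = (\<Prod>v\<in>e. point eps (\<tau> v))"
    by (intro prod.cong) auto
  then show "edge_weight base eps e \<sigma> = edge_weight base eps e \<tau>"
    by (simp add: edge_weight_def)
qed (simp add: ext_bag_def)

text \<open>The part of the memory that stays fixed once the constants are computed; its bag matrix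
  includes the zero row of the dummy node.\<close>

definition env :: "store \<Rightarrow> bool" where
  "env \<sigma> \<longleftrightarrow> \<sigma> ''n'' 0 = int n \<and> \<sigma> ''N'' 0 = int N \<and>
     (\<forall>u<n. \<forall>v<n. \<sigma> ''graph'' (int u * int n + int v) = of_bool ({u, v} \<in> E)) \<and>
     (\<forall>t<N. \<forall>s<N. \<sigma> ''tree'' (int t * int N + int s) = of_bool ({t, s} \<in> F)) \<and>
     (\<forall>t\<le>N. \<forall>v<n. \<sigma> ''bag'' (int t * int n + int v) = of_bool (v \<in> bag t)) \<and>
     \<sigma> ''y'' 0 = base \<and> \<sigma> ''Dn'' 0 = D ^ n \<and> \<sigma> ''P'' 0 = shift \<and> \<sigma> ''Q'' 0 = modulus \<and>
     (\<forall>i<k. \<sigma> ''C'' (int i) = weight eps i mod modulus) \<and> (\<forall>i<k. \<sigma> ''b'' (int i) = point eps i)"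

definition env_names :: "string set" where
  "env_names = {''n'', ''N'', ''graph'', ''tree'', ''bag'', ''y'', ''Dn'', ''P'', ''Q'', ''C'', ''b''}"

lemma env_agree:
  assumes "env \<sigma>" "agree S \<sigma> \<tau>" "S \<inter> env_names = {}"
  shows "env \<tau>"
proof -
  have "\<tau> a = \<sigma> a" if "a \<in> env_names" for a
    using assms that by (auto simp: agree_def)
  then have "\<tau> ''n'' = \<sigma> ''n''" "\<tau> ''N'' = \<sigma> ''N''" "\<tau> ''graph'' = \<sigma> ''graph''" "\<tau> ''tree'' = \<sigma> ''tree''"
    "\<tau> ''bag'' = \<sigma> ''bag''" "\<tau> ''y'' = \<sigma> ''y''" "\<tau> ''Dn'' = \<sigma> ''Dn''" "\<tau> ''P'' = \<sigma> ''P''"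
    "\<tau> ''Q'' = \<sigma> ''Q''" "\<tau> ''C'' = \<sigma> ''C''" "\<tau> ''b'' = \<sigma> ''b''"
    by (simp_all add: env_names_def)
  then show ?thesis
    using assms(1) unfolding env_def by (simp only:) blast
qed

lemma env_set_var: "env \<sigma> \<Longrightarrow> x \<notin> env_names \<Longrightarrow> env (set_var \<sigma> x i)"
  by (rule env_agree[of \<sigma> "{x}"]) auto

lemma env_simps:
  assumes "env \<sigma>"
  shows "\<sigma> ''n'' 0 = int n" "\<sigma> ''N'' 0 = int N"
    "\<sigma> ''y'' 0 = base" "\<sigma> ''Dn'' 0 = D ^ n" "\<sigma> ''P'' 0 = shift" "\<sigma> ''Q'' 0 = modulus"
    "i < k \<Longrightarrow> \<sigma> ''C'' (int i) = weight eps i mod modulus" "i < k \<Longrightarrow> \<sigma> ''b'' (int i) = point eps i"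
    "u < n \<Longrightarrow> v < n \<Longrightarrow> \<sigma> ''graph'' (int u * int n + int v) = of_bool ({u, v} \<in> E)"
    "t < N \<Longrightarrow> s < N \<Longrightarrow> \<sigma> ''tree'' (int t * int N + int s) = of_bool ({t, s} \<in> F)"
  using assms by (auto simp: env_def)

section \<open>Correctness of the steps for one assignment\<close>

lemma aval_bag_at:
  assumes "env \<sigma>" "\<sigma> x 0 = int t" "\<sigma> z 0 = int v" "t \<le> N" "v < n"
  shows "aval (bag_at x z) \<sigma> = of_bool (v \<in> bag t)"
  using assms by (simp add: env_def bag_at_def)

text \<open>The variable names are parameters because the same code serves the overlap of a child
  with the current node and that of the current node with its parent.\<close>

lemma ok_code_prog:
  assumes env: "env \<sigma>" and xz: "\<sigma> x 0 = int c" "\<sigma> z 0 = int t" "c \<le> N" "t \<le> N"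
      "x \<notin> {''h'', ''v''}" "z \<notin> {''h'', ''v''}"
    and g: "\<And>v. v \<in> bag c \<inter> bag t \<Longrightarrow> \<sigma> ''g'' (int v) = int (s v)"
    and s: "\<And>v. v \<in> bag c \<inter> bag t \<Longrightarrow> s v < k"
    and final: "\<And>\<tau>. agree {''h'', ''v''} \<sigma> \<tau> \<Longrightarrow> \<tau> ''h'' 0 = int (code k (bag c \<inter> bag t) s n) \<Longrightarrow> Q \<tau>"
  shows "ok (code_prog x z) \<sigma> Q"
  unfolding code_prog_def
proof (intro ok_Seq ok_Assign)
  let ?J = "bag c \<inter> bag t"
  let ?I = "\<lambda>m \<tau>. agree {''h'', ''v''} \<sigma> \<tau> \<and> \<tau> ''h'' 0 = int (code k ?J s m)"
  show "ok (For ''v'' (Var ''n'') (Assign ''h'' (Add (Mul (Var ''h'') (Const (int k)))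
           (Mul (Mul (bag_at x ''v'') (bag_at z ''v'')) (Read ''g'' (Var ''v''))))))
      (set_var \<sigma> ''h'' (aval (Const 0) \<sigma>)) Q"
  proof (rule ok_For[of n _ _ ?I])
    fix m \<tau> assume m: "m < n" and I: "?I m \<tau>" and v: "\<tau> ''v'' 0 = int m"
    have env': "env \<tau>"
      using env I by (rule_tac env_agree) (auto simp: env_names_def)
    have xz': "\<tau> x 0 = int c" "\<tau> z 0 = int t" "\<tau> ''g'' = \<sigma> ''g''"
      using xz by (simp_all add: agreeD[OF conjunct1[OF I]])
    have val: "aval (Add (Mul (Var ''h'') (Const (int k)))
        (Mul (Mul (bag_at x ''v'') (bag_at z ''v'')) (Read ''g'' (Var ''v'')))) \<tau> = int (code k ?J s (Suc m))"
      using I v xz' g m xz aval_bag_at[OF env' xz'(1) v] aval_bag_at[OF env' xz'(2) v] by simp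
    \<comment> \<open>Every intermediate value of the Horner scheme has to fit into a cell, not only
      the last.\<close>
    have "code k ?J s (Suc m) < k ^ Suc m"
      by (intro code_less s) auto
    also have "\<dots> \<le> k ^ n"
      using m by (intro power_increasing) (simp_all add: Suc_le_eq)
    finally have "int (code k ?J s (Suc m)) \<le> 2 ^ L"
      using cap_table by linarith
    with I v val show "ok (Assign ''h'' (Add (Mul (Var ''h'') (Const (int k)))
           (Mul (Mul (bag_at x ''v'') (bag_at z ''v'')) (Read ''g'' (Var ''v''))))) \<tau>
        (\<lambda>\<tau>'. \<tau>' ''v'' 0 = int m \<and> ?I (Suc m) (set_var \<tau>' ''v'' (int (Suc m))))"
      by (intro ok_Assign) (simp_all del: aval.simps code.simps)
  next
    fix m \<tau> assume I: "?I m \<tau>"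
    show "aval (Var ''n'') \<tau> = int n"
      by (simp add: agreeD[OF conjunct1[OF I]] env_simps[OF env])
  qed (use final cap_n in \<open>simp_all add: count_n table_guard_def\<close>)
qed simp

lemma ok_decode_prog:
  assumes env: "env \<sigma>" and t: "\<sigma> ''t'' 0 = int t" "t \<le> N"
    and i: "\<sigma> ''i'' 0 = int i" "i < k ^ n"
    and final: "\<And>\<tau>. agree {''z'', ''g'', ''v''} \<sigma> \<tau> \<Longrightarrow>
      (\<And>v. v \<in> bag t \<Longrightarrow> \<tau> ''g'' (int v) = int (digit k (bag t) i v)) \<Longrightarrow> Q \<tau>"
  shows "ok decode_prog \<sigma> Q"
  unfolding decode_prog_def
proof (intro ok_Seq ok_Assign)
  let ?S = "\<lambda>m. bag t \<inter> {..<m}"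
  let ?I = "\<lambda>m \<tau>. agree {''z'', ''g'', ''v''} \<sigma> \<tau> \<and> \<tau> ''z'' 0 = int (i div k ^ card (?S m)) \<and>
    (\<forall>v\<in>?S m. \<tau> ''g'' (int v) = int (digit k (bag t) i v))"
  have i_cap: "int j \<le> 2 ^ L" if "j \<le> i" for j
    using that i cap_table by linarith
  show "\<bar>aval (Var ''i'') \<sigma>\<bar> \<le> 2 ^ L"
    using i i_cap by simp
  show "ok (For ''v'' (Var ''n'') (IfPos (bag_at ''t'' ''v'')
           (Seq (Write ''g'' (Var ''v'') (Sub (Var ''z'') (Mul (Const (int k)) (Div (Var ''z'') (Const (int k))))))
                (Assign ''z'' (Div (Var ''z'') (Const (int k)))))
           Skip)) (set_var \<sigma> ''z'' (aval (Var ''i'') \<sigma>)) Q"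
  proof (rule ok_For[of n _ _ ?I])
    fix m \<tau> assume m: "m < n" and I: "?I m \<tau>" and v: "\<tau> ''v'' 0 = int m"
    have env': "env \<tau>"
      using env I by (rule_tac env_agree) (auto simp: env_names_def)
    have t': "\<tau> ''t'' 0 = int t"
      using t by (simp add: agreeD[OF conjunct1[OF I]])
    let ?z = "i div k ^ card (?S m)"
    have rem: "int ?z - int k * (int ?z div int k) = int (?z mod k)"
      by (simp add: minus_mult_div_eq_mod zmod_int)
    have quot: "int ?z div int k = int (i div k ^ Suc (card (?S m)))"
      by (simp add: power_Suc2 div_mult2_eq del: power_Suc flip: zdiv_int)
    have "?z mod k \<le> i" "?z div k \<le> i"
      by (meson div_le_dividend mod_less_eq_dividend le_trans)+
    note caps = i_cap[OF this(1)] i_cap[OF this(2)]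
    show "ok (IfPos (bag_at ''t'' ''v'')
           (Seq (Write ''g'' (Var ''v'') (Sub (Var ''z'') (Mul (Const (int k)) (Div (Var ''z'') (Const (int k))))))
                (Assign ''z'' (Div (Var ''z'') (Const (int k)))))
           Skip) \<tau> (\<lambda>\<tau>'. \<tau>' ''v'' 0 = int m \<and> ?I (Suc m) (set_var \<tau>' ''v'' (int (Suc m))))"
    proof (intro ok_IfPos ok_Seq ok_Assign ok_Write ok_Skip)
      assume "aval (bag_at ''t'' ''v'') \<tau> > 0"
      then have "m \<in> bag t"
        using aval_bag_at[OF env' t' v t(2) m] by (simp split: if_splits)
      then have S: "?S (Suc m) = insert m (?S m)" "card (?S (Suc m)) = Suc (card (?S m))"
        by (auto simp: lessThan_Suc)
      show "\<bar>aval (Sub (Var ''z'') (Mul (Const (int k)) (Div (Var ''z'') (Const (int k))))) \<tau>\<bar> \<le> 2 ^ L"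
        using I rem caps by simp
      show "\<bar>aval (Div (Var ''z'') (Const (int k)))
          (\<tau>(''g'' := (\<tau> ''g'')(aval (Var ''v'') \<tau> :=
            aval (Sub (Var ''z'') (Mul (Const (int k)) (Div (Var ''z'') (Const (int k))))) \<tau>)))\<bar> \<le> 2 ^ L"
        using I caps by (simp flip: zdiv_int)
      let ?\<tau>1 = "\<tau>(''g'' := (\<tau> ''g'')(aval (Var ''v'') \<tau> :=
            aval (Sub (Var ''z'') (Mul (Const (int k)) (Div (Var ''z'') (Const (int k))))) \<tau>))"
      let ?\<tau>2 = "set_var ?\<tau>1 ''z'' (aval (Div (Var ''z'') (Const (int k))) ?\<tau>1)"
      have "?I (Suc m) (set_var ?\<tau>2 ''v'' (int (Suc m)))"
        using I v rem quot unfolding S by (auto simp: digit_def simp del: power_Suc)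
      moreover have "?\<tau>2 ''v'' 0 = int m"
        using v by simp
      ultimately show "?\<tau>2 ''v'' 0 = int m \<and> ?I (Suc m) (set_var ?\<tau>2 ''v'' (int (Suc m)))"
        by blast
    next
      assume "\<not> aval (bag_at ''t'' ''v'') \<tau> > 0"
      then have "m \<notin> bag t"
        using aval_bag_at[OF env' t' v t(2) m] by (simp split: if_splits)
      then have S: "?S (Suc m) = ?S m"
        by (auto simp: lessThan_Suc)
      show "\<tau> ''v'' 0 = int m \<and> ?I (Suc m) (set_var \<tau> ''v'' (int (Suc m)))"
        using I v unfolding S by simp
    qed
  next
    fix m \<tau> assume I: "?I m \<tau>"
    show "aval (Var ''n'') \<tau> = int n"
      by (simp add: agreeD[OF conjunct1[OF I]] env_simps[OF env])
  next
    fix \<tau> assume "?I n \<tau>"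
    moreover have "?S n = bag t"
      using bag_subset[of t] by blast
    ultimately show "Q \<tau>"
      by (intro final) auto
  qed (use i cap_n in \<open>simp_all add: count_n table_guard_def\<close>)
qed

text \<open>\<open>a\<close> is the exact product collected so far, of which the cell
  \<open>x\<close> holds the residue. Reduction after each factor keeps the cell bounded and
  commutes with multiplication.\<close>

lemma ok_vertex_prog:
  assumes env: "env \<sigma>" and tp: "\<sigma> ''t'' 0 = int t" "\<sigma> ''p'' 0 = int p" "t \<le> N" "p \<le> N"
    and g: "\<And>v. v \<in> bag t \<Longrightarrow> \<sigma> ''g'' (int v) = int (s v)" and s: "\<And>v. v \<in> bag t \<Longrightarrow> s v < k"
    and x: "\<sigma> ''x'' 0 = a mod modulus"
    and final: "\<And>\<tau>. agree {''v'', ''x''} \<sigma> \<tau> \<Longrightarrow>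
      \<tau> ''x'' 0 = (a * (\<Prod>v\<in>bag t - bag p. weight eps (s v))) mod modulus \<Longrightarrow> Q \<tau>"
  shows "ok vertex_prog \<sigma> Q"
  unfolding vertex_prog_def
proof -
  let ?S = "\<lambda>m. {..<m} \<inter> (bag t - bag p)"
  let ?I = "\<lambda>m \<tau>. agree {''v'', ''x''} \<sigma> \<tau> \<and>
    \<tau> ''x'' 0 = (a * (\<Prod>v\<in>?S m. weight eps (s v))) mod modulus"
  let ?cond = "Mul (bag_at ''t'' ''v'') (Sub (Const 1) (bag_at ''p'' ''v''))"
  let ?rhs = "remainder (Mul (Var ''x'') (Read ''C'' (Read ''g'' (Var ''v''))))"
  show "ok (For ''v'' (Var ''n'') (IfPos ?cond (Assign ''x'' ?rhs) Skip)) \<sigma> Q"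
  proof (rule ok_For[of n _ _ ?I])
    fix m \<tau> assume m: "m < n" and I: "?I m \<tau>" and v: "\<tau> ''v'' 0 = int m"
    have env': "env \<tau>"
      using env I by (rule_tac env_agree) (auto simp: env_names_def)
    have tp': "\<tau> ''t'' 0 = int t" "\<tau> ''p'' 0 = int p" "\<tau> ''g'' = \<sigma> ''g''"
      using tp by (simp_all add: agreeD[OF conjunct1[OF I]])
    have cond: "aval ?cond \<tau> = of_bool (m \<in> bag t - bag p)"
      using aval_bag_at[OF env' tp'(1) v tp(3) m] aval_bag_at[OF env' tp'(2) v tp(4) m] by simp
    show "ok (IfPos ?cond (Assign ''x'' ?rhs) Skip) \<tau>
        (\<lambda>\<tau>'. \<tau>' ''v'' 0 = int m \<and> ?I (Suc m) (set_var \<tau>' ''v'' (int (Suc m))))"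
    proof (intro ok_IfPos ok_Assign ok_Skip)
      assume "aval ?cond \<tau> > 0"
      then have mem: "m \<in> bag t - bag p"
        by (simp only: cond) (simp split: if_splits)
      then have S: "?S (Suc m) = insert m (?S m)"
        by (auto simp: lessThan_Suc)
      have "aval ?rhs \<tau> = (a * (\<Prod>v\<in>?S m. weight eps (s v))) mod modulus
          * (weight eps (s m) mod modulus) mod modulus"
        using I v mem g s by (simp add: env_simps[OF env'] tp')
      also have "\<dots> = (a * (\<Prod>v\<in>?S (Suc m). weight eps (s v))) mod modulus"
        unfolding S by (simp add: mod_mult_eq mult_ac)
      finally have rhs: "aval ?rhs \<tau> = (a * (\<Prod>v\<in>?S (Suc m). weight eps (s v))) mod modulus" .
      show "\<bar>aval ?rhs \<tau>\<bar> \<le> 2 ^ L"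
        unfolding rhs by (rule abs_mod_le_cap)
      show "set_var \<tau> ''x'' (aval ?rhs \<tau>) ''v'' 0 = int m \<and>
          ?I (Suc m) (set_var (set_var \<tau> ''x'' (aval ?rhs \<tau>)) ''v'' (int (Suc m)))"
        unfolding rhs using I v by simp
    next
      assume "\<not> aval ?cond \<tau> > 0"
      then have "m \<notin> bag t - bag p"
        by (simp only: cond) (simp split: if_splits)
      then have S: "?S (Suc m) = ?S m"
        by (auto simp: lessThan_Suc)
      show "\<tau> ''v'' 0 = int m \<and> ?I (Suc m) (set_var \<tau> ''v'' (int (Suc m)))"
        using I v unfolding S by simp
    qed
  next
    fix m \<tau> assume I: "?I m \<tau>"
    show "aval (Var ''n'') \<tau> = int n"
      by (simp add: agreeD[OF conjunct1[OF I]] env_simps[OF env])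
  next
    fix \<tau> assume "?I n \<tau>"
    moreover have "?S n = bag t - bag p"
      using bag_subset[of t] by blast
    ultimately show "Q \<tau>"
      by (intro final) auto
  qed (use x cap_n in \<open>simp_all add: count_n table_guard_def\<close>)
qed

text \<open>The inner product of \<open>prod_edges\<close> for the larger end point v, cut off at m
  so that it can serve as loop invariant.\<close>

definition edge_row :: "nat \<Rightarrow> nat \<Rightarrow> (nat \<Rightarrow> nat) \<Rightarrow> nat \<Rightarrow> nat \<Rightarrow> int" where
  "edge_row t p s v m = (\<Prod>u<m. if {u, v} \<in> E \<and> ({u, v} \<subseteq> bag t \<and> \<not> {u, v} \<subseteq> bag p)
     then edge_weight base eps {u, v} s else 1)"

lemma ok_edge_row_prog:
  assumes env: "env \<sigma>" and tp: "\<sigma> ''t'' 0 = int t" "\<sigma> ''p'' 0 = int p" "t \<le> N" "p \<le> N"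
    and g: "\<And>v. v \<in> bag t \<Longrightarrow> \<sigma> ''g'' (int v) = int (s v)" and s: "\<And>v. v \<in> bag t \<Longrightarrow> s v < k"
    and v: "\<sigma> ''v'' 0 = int v" "v < n"
    and x: "\<sigma> ''x'' 0 = a mod modulus"
    and final: "\<And>\<tau>. agree {''u'', ''x''} \<sigma> \<tau> \<Longrightarrow>
      \<tau> ''x'' 0 = (a * edge_row t p s v v) mod modulus \<Longrightarrow> Q \<tau>"
  shows "ok edge_row_prog \<sigma> Q"
  unfolding edge_row_prog_def
proof -
  let ?I = "\<lambda>m \<tau>. agree {''u'', ''x''} \<sigma> \<tau> \<and> \<tau> ''x'' 0 = (a * edge_row t p s v m) mod modulus"
  let ?cond = "Mul (Mul (Read ''graph'' (Add (Mul (Var ''u'') (Var ''n'')) (Var ''v'')))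
                      (Mul (bag_at ''t'' ''u'') (bag_at ''t'' ''v'')))
                 (Sub (Const 1) (Mul (bag_at ''p'' ''u'') (bag_at ''p'' ''v'')))"
  let ?rhs = "remainder (Mul (Var ''x'') (Add (Const 1) (Mul (Var ''y'')
         (Mul (Read ''b'' (Read ''g'' (Var ''u''))) (Read ''b'' (Read ''g'' (Var ''v'')))))))"
  show "ok (For ''u'' (Var ''v'') (IfPos ?cond (Assign ''x'' ?rhs) Skip)) \<sigma> Q"
  proof (rule ok_For[of v _ _ ?I])
    fix m \<tau> assume m: "m < v" and I: "?I m \<tau>" and u: "\<tau> ''u'' 0 = int m"
    have m': "m < n" "m \<noteq> v"
      using m v(2) by auto
    have env': "env \<tau>"
      using env I by (rule_tac env_agree) (auto simp: env_names_def)
    have tp': "\<tau> ''t'' 0 = int t" "\<tau> ''p'' 0 = int p" "\<tau> ''g'' = \<sigma> ''g''" "\<tau> ''v'' 0 = int v"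
      using tp v by (simp_all add: agreeD[OF conjunct1[OF I]])
    let ?R = "{m, v} \<in> E \<and> ({m, v} \<subseteq> bag t \<and> \<not> {m, v} \<subseteq> bag p)"
    have cond: "aval ?cond \<tau> = of_bool ?R"
      using aval_bag_at[OF env' tp'(1) u tp(3) m'(1)] aval_bag_at[OF env' tp'(2) u tp(4) m'(1)]
        aval_bag_at[OF env' tp'(1) tp'(4) tp(3) v(2)] aval_bag_at[OF env' tp'(2) tp'(4) tp(4) v(2)]
      by (simp add: env_simps[OF env'] u tp' m' v)
    show "ok (IfPos ?cond (Assign ''x'' ?rhs) Skip) \<tau>
        (\<lambda>\<tau>'. \<tau>' ''u'' 0 = int m \<and> ?I (Suc m) (set_var \<tau>' ''u'' (int (Suc m))))"
    proof (intro ok_IfPos ok_Assign ok_Skip)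
      assume "aval ?cond \<tau> > 0"
      then have R: ?R
        by (simp only: cond) (simp split: if_splits)
      have "aval ?rhs \<tau> = (a * edge_row t p s v m) mod modulus * edge_weight base eps {m, v} s mod modulus"
        using I R g s m' by (simp add: env_simps[OF env'] tp' u edge_weight_def)
      also have "\<dots> = (a * edge_row t p s v (Suc m)) mod modulus"
      proof -
        have "edge_row t p s v (Suc m) = edge_row t p s v m * edge_weight base eps {m, v} s"
          using R by (simp add: edge_row_def)
        then show ?thesis
          by (simp only: mod_mult_left_eq mult.assoc)
      qed
      finally have rhs: "aval ?rhs \<tau> = (a * edge_row t p s v (Suc m)) mod modulus" .
      show "\<bar>aval ?rhs \<tau>\<bar> \<le> 2 ^ L"
        unfolding rhs by (rule abs_mod_le_cap)
      show "set_var \<tau> ''x'' (aval ?rhs \<tau>) ''u'' 0 = int m \<and>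
          ?I (Suc m) (set_var (set_var \<tau> ''x'' (aval ?rhs \<tau>)) ''u'' (int (Suc m)))"
        unfolding rhs using I u by simp
    next
      assume "\<not> aval ?cond \<tau> > 0"
      then have "\<not> ?R"
        by (simp only: cond) (simp split: if_splits)
      then have "edge_row t p s v (Suc m) = edge_row t p s v m"
        by (simp only: edge_row_def prod.lessThan_Suc if_False mult_1_right)
      then show "\<tau> ''u'' 0 = int m \<and> ?I (Suc m) (set_var \<tau> ''u'' (int (Suc m)))"
        using I u by simp
    qed
  next
    fix m \<tau> assume I: "?I m \<tau>"
    show "aval (Var ''v'') \<tau> = int v"
      by (simp add: agreeD[OF conjunct1[OF I]] v)
  next
    show "v \<le> \<nu> (Sub (Var ''v'') (Var ''u''))"
      using count_n[of "Sub (Var ''v'') (Var ''u'')"] v by (simp add: table_guard_def)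
    show "int v \<le> 2 ^ L"
      using cap_n v by linarith
  qed (use x in \<open>simp_all add: edge_row_def final\<close>)
qed

lemma ok_edge_prog:
  assumes env: "env \<sigma>" and tp: "\<sigma> ''t'' 0 = int t" "\<sigma> ''p'' 0 = int p" "t \<le> N" "p \<le> N"
    and g: "\<And>v. v \<in> bag t \<Longrightarrow> \<sigma> ''g'' (int v) = int (s v)" and s: "\<And>v. v \<in> bag t \<Longrightarrow> s v < k"
    and x: "\<sigma> ''x'' 0 = a mod modulus"
    and final: "\<And>\<tau>. agree {''v'', ''u'', ''x''} \<sigma> \<tau> \<Longrightarrow>
      \<tau> ''x'' 0 = (a * (\<Prod>e | e \<in> E \<and> (e \<subseteq> bag t \<and> \<not> e \<subseteq> bag p). edge_weight base eps e s)) mod modulus \<Longrightarrow> Q \<tau>"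
  shows "ok edge_prog \<sigma> Q"
  unfolding edge_prog_def
proof -
  let ?I = "\<lambda>m \<tau>. agree {''v'', ''u'', ''x''} \<sigma> \<tau> \<and>
    \<tau> ''x'' 0 = (a * (\<Prod>v<m. edge_row t p s v v)) mod modulus"
  show "ok (For ''v'' (Var ''n'') edge_row_prog) \<sigma> Q"
  proof (rule ok_For[of n _ _ ?I])
    fix m \<tau> assume m: "m < n" and I: "?I m \<tau>" and v: "\<tau> ''v'' 0 = int m"
    have env': "env \<tau>"
      using env I by (rule_tac env_agree) (auto simp: env_names_def)
    have tp': "\<tau> ''t'' 0 = int t" "\<tau> ''p'' 0 = int p" "\<tau> ''g'' = \<sigma> ''g''"
      using tp by (simp_all add: agreeD[OF conjunct1[OF I]])
    show "ok edge_row_prog \<tau> (\<lambda>\<tau>'. \<tau>' ''v'' 0 = int m \<and> ?I (Suc m) (set_var \<tau>' ''v'' (int (Suc m))))"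
    proof (rule ok_edge_row_prog[OF env' tp'(1,2) tp(3,4) _ s v m])
      fix \<tau>' assume \<tau>': "agree {''u'', ''x''} \<tau> \<tau>'"
        "\<tau>' ''x'' 0 = a * (\<Prod>v<m. edge_row t p s v v) * edge_row t p s m m mod modulus"
      have "agree {''v'', ''u'', ''x''} \<sigma> \<tau>'"
        using conjunct1[OF I] \<tau>'(1) by (rule agree_trans) auto
      then show "\<tau>' ''v'' 0 = int m \<and> ?I (Suc m) (set_var \<tau>' ''v'' (int (Suc m)))"
        using \<tau>' v by (simp add: agreeD[OF \<tau>'(1)] mult_ac)
    qed (use g tp' I in auto)
  next
    fix m \<tau> assume I: "?I m \<tau>"
    show "aval (Var ''n'') \<tau> = int n"
      by (simp add: agreeD[OF conjunct1[OF I]] env_simps[OF env])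
  next
    fix \<tau> assume I: "?I n \<tau>"
    have "(\<Prod>v<n. edge_row t p s v v)
        = (\<Prod>e | e \<in> E \<and> (e \<subseteq> bag t \<and> \<not> e \<subseteq> bag p). edge_weight base eps e s)"
      unfolding edge_row_def by (rule prod_edges[OF simple])
    with I show "Q \<tau>"
      by (intro final) auto
  qed (use x cap_n in \<open>simp_all add: count_n table_guard_def\<close>)
qed

lemma ok_child_prog:
  assumes env: "env \<sigma>" and t: "\<sigma> ''t'' 0 = int t" "t \<le> N"
    and g: "\<And>v. v \<in> bag t \<Longrightarrow> \<sigma> ''g'' (int v) = int (s v)" and s: "\<And>v. v \<in> bag t \<Longrightarrow> s v < k"
    and children: "\<And>c. c < N \<Longrightarrow> \<sigma> ''par'' (int c) = int t + 1 \<longleftrightarrow> c \<notin> R \<and> par c = t"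
    and cells: "\<And>c \<rho>. c < N \<Longrightarrow> c \<notin> R \<Longrightarrow> par c = t \<Longrightarrow> \<rho> \<in> bag c \<inter> bag t \<rightarrow>\<^sub>E {..<k} \<Longrightarrow>
      \<sigma> ''M'' (int c + (int N + 1) * int (code k (bag c \<inter> bag t) \<rho> n)) = M c \<rho> mod modulus"
    and x: "\<sigma> ''x'' 0 = a mod modulus"
    and final: "\<And>\<tau>. agree {''c'', ''h'', ''v'', ''x''} \<sigma> \<tau> \<Longrightarrow>
      \<tau> ''x'' 0 = (a * (\<Prod>c | c \<in> {..<N} - R \<and> par c = t. M c (restrict s (bag c \<inter> bag t)))) mod modulus \<Longrightarrow> Q \<tau>"
  shows "ok child_prog \<sigma> Q"
  unfolding child_prog_def
proof -
  let ?C = "{c. c \<in> {..<N} - R \<and> par c = t}"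
  let ?f = "\<lambda>c. M c (restrict s (bag c \<inter> bag t))"
  let ?I = "\<lambda>m \<tau>. agree {''c'', ''h'', ''v'', ''x''} \<sigma> \<tau> \<and>
    \<tau> ''x'' 0 = (a * (\<Prod>c\<in>{..<m} \<inter> ?C. ?f c)) mod modulus"
  let ?cond = "Sub (Const 1) (Mul (Sub (Read ''par'' (Var ''c'')) (Add (Var ''t'') (Const 1)))
                                (Sub (Read ''par'' (Var ''c'')) (Add (Var ''t'') (Const 1))))"
  let ?rhs = "remainder (Mul (Var ''x'') (Read ''M'' (message_address ''c'')))"
  show "ok (For ''c'' (Var ''N'') (IfPos ?cond (Seq (code_prog ''c'' ''t'') (Assign ''x'' ?rhs)) Skip)) \<sigma> Q"
  proof (rule ok_For[of N _ _ ?I])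
    fix m \<tau> assume m: "m < N" and I: "?I m \<tau>" and c: "\<tau> ''c'' 0 = int m"
    have env': "env \<tau>"
      using env I by (rule_tac env_agree) (auto simp: env_names_def)
    have t': "\<tau> ''t'' 0 = int t" "\<tau> ''g'' = \<sigma> ''g''" "\<tau> ''par'' = \<sigma> ''par''" "\<tau> ''M'' = \<sigma> ''M''"
      using t by (simp_all add: agreeD[OF conjunct1[OF I]])
    have "1 - i * i > 0 \<longleftrightarrow> i = 0" for i :: int
    proof (cases "i = 0")
      case False
      then have "0 < i * i"
        by (auto simp: zero_less_mult_iff)
      with False show ?thesis
        by simp
    qed simp
    then have cond: "aval ?cond \<tau> > 0 \<longleftrightarrow> m \<in> ?C"
      using children[OF m] m by (simp add: c t')
    show "ok (IfPos ?cond (Seq (code_prog ''c'' ''t'') (Assign ''x'' ?rhs)) Skip) \<tau>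
        (\<lambda>\<tau>'. \<tau>' ''c'' 0 = int m \<and> ?I (Suc m) (set_var \<tau>' ''c'' (int (Suc m))))"
    proof (intro ok_IfPos ok_Seq ok_Skip)
      assume "aval ?cond \<tau> > 0"
      then have mem: "m \<in> ?C"
        by (simp only: cond)
      then have C: "{..<Suc m} \<inter> ?C = insert m ({..<m} \<inter> ?C)"
        by (auto simp: lessThan_Suc)
      show "ok (code_prog ''c'' ''t'') \<tau> (\<lambda>\<tau>'. ok (Assign ''x'' ?rhs) \<tau>'
          (\<lambda>\<tau>'. \<tau>' ''c'' 0 = int m \<and> ?I (Suc m) (set_var \<tau>' ''c'' (int (Suc m)))))"
      proof (rule ok_code_prog[OF env' c t'(1) _ t(2), where s = s])
        fix \<tau>' assume \<tau>': "agree {''h'', ''v''} \<tau> \<tau>'" "\<tau>' ''h'' 0 = int (code k (bag m \<inter> bag t) s n)"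
        have "code k (bag m \<inter> bag t) s n = code k (bag m \<inter> bag t) (restrict s (bag m \<inter> bag t)) n"
          by (rule code_cong) simp
        moreover have "restrict s (bag m \<inter> bag t) \<in> bag m \<inter> bag t \<rightarrow>\<^sub>E {..<k}"
          using s by auto
        ultimately have cell: "\<sigma> ''M'' (int m + (int N + 1) * int (code k (bag m \<inter> bag t) s n)) = ?f m mod modulus"
          using cells mem by simp
        have "aval ?rhs \<tau>' = (a * (\<Prod>c\<in>{..<m} \<inter> ?C. ?f c)) mod modulus * (?f m mod modulus) mod modulus"
          using conjunct2[OF I] \<tau>'(2) c cell
          by (simp add: message_address_def agreeD[OF \<tau>'(1)] env_simps[OF env'] t')
        also have "\<dots> = (a * (\<Prod>c\<in>{..<Suc m} \<inter> ?C. ?f c)) mod modulus"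
          unfolding C by (simp add: mod_mult_eq mult_ac)
        finally have rhs: "aval ?rhs \<tau>' = (a * (\<Prod>c\<in>{..<Suc m} \<inter> ?C. ?f c)) mod modulus" .
        have "agree {''c'', ''h'', ''v'', ''x''} \<sigma> \<tau>'"
          using conjunct1[OF I] \<tau>'(1) by (rule agree_trans) auto
        then show "ok (Assign ''x'' ?rhs) \<tau>'
            (\<lambda>\<tau>'. \<tau>' ''c'' 0 = int m \<and> ?I (Suc m) (set_var \<tau>' ''c'' (int (Suc m))))"
          using c by (intro ok_Assign) (simp_all only: rhs abs_mod_le_cap, simp add: agreeD[OF \<tau>'(1)])
      qed (use g s t' m in auto)
    next
      assume "\<not> aval ?cond \<tau> > 0"
      then have "m \<notin> ?C"
        by (simp only: cond) simp
      then have C: "{..<Suc m} \<inter> ?C = {..<m} \<inter> ?C"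
        by (auto simp: lessThan_Suc)
      show "\<tau> ''c'' 0 = int m \<and> ?I (Suc m) (set_var \<tau> ''c'' (int (Suc m)))"
        using I c unfolding C by simp
    qed
  next
    fix m \<tau> assume I: "?I m \<tau>"
    show "aval (Var ''N'') \<tau> = int N"
      by (simp add: agreeD[OF conjunct1[OF I]] env_simps[OF env])
  next
    fix \<tau> assume "?I N \<tau>"
    moreover have "{..<N} \<inter> ?C = ?C"
      by blast
    ultimately show "Q \<tau>"
      by (intro final) auto
  next
    show "int N \<le> 2 ^ L"
      using cap_N by linarith
  qed (use x in \<open>simp_all add: count_N table_guard_def\<close>)
qed

lemma ok_assignment_prog:
  assumes env: "env \<sigma>" and tp: "\<sigma> ''t'' 0 = int t" "\<sigma> ''p'' 0 = int p" "t \<le> N" "p \<le> N"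
    and i: "\<sigma> ''i'' 0 = int i" "i < k ^ n"
    and children: "\<And>c. c < N \<Longrightarrow> \<sigma> ''par'' (int c) = int t + 1 \<longleftrightarrow> c \<notin> R \<and> par c = t"
    and cells: "\<And>c \<rho>. c < N \<Longrightarrow> c \<notin> R \<Longrightarrow> par c = t \<Longrightarrow> \<rho> \<in> bag c \<inter> bag t \<rightarrow>\<^sub>E {..<k} \<Longrightarrow>
      \<sigma> ''M'' (int c + (int N + 1) * int (code k (bag c \<inter> bag t) \<rho> n)) = M c \<rho> mod modulus"
    and s_def: "s = digit k (bag t) i"
    and a_def: "a = int t + (int N + 1) * int (code k (bag t \<inter> bag p) s n)"
    and final: "\<And>\<tau>. agree {''z'', ''g'', ''v'', ''u'', ''x'', ''c'', ''h'', ''M''} \<sigma> \<tau> \<Longrightarrow>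
      \<tau> ''M'' = (\<sigma> ''M'')(a := (\<sigma> ''M'' a + local_value R par M t p s) mod modulus) \<Longrightarrow> Q \<tau>"
  shows "ok assignment_prog \<sigma> Q"
  unfolding assignment_prog_def
proof -
  let ?A = "{''z'', ''g'', ''v'', ''u'', ''x'', ''c'', ''h''}"
  let ?g = "\<lambda>\<tau>. \<forall>v\<in>bag t. \<tau> ''g'' (int v) = int (s v)"
  let ?write = "Write ''M'' (message_address ''t'')
     (remainder (Add (Read ''M'' (message_address ''t'')) (Var ''x'')))"
  let ?c5 = "Seq (code_prog ''t'' ''p'') ?write"
  let ?c4 = "Seq child_prog ?c5"
  let ?c3 = "Seq edge_prog ?c4"
  let ?c2 = "Seq vertex_prog ?c3"
  define vp where "vp = (\<Prod>v\<in>bag t - bag p. weight eps (s v))"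
  define ep where "ep = (\<Prod>e | e \<in> E \<and> (e \<subseteq> bag t \<and> \<not> e \<subseteq> bag p). edge_weight base eps e s)"
  define cp where "cp = (\<Prod>c | c \<in> {..<N} - R \<and> par c = t. M c (restrict s (bag c \<inter> bag t)))"
  have lv: "local_value R par M t p s = vp * ep * cp"
    by (simp add: local_value_def vp_def ep_def cp_def)
  have s: "s v < k" for v
    by (simp add: s_def digit_less)
  have frame: "env \<tau>" "\<tau> ''t'' 0 = int t" "\<tau> ''p'' 0 = int p" "\<tau> ''par'' = \<sigma> ''par''" "\<tau> ''M'' = \<sigma> ''M''"
    if "agree ?A \<sigma> \<tau>" for \<tau>
  proof -
    show "env \<tau>"
      using env that by (rule env_agree) (auto simp: env_names_def)
  qed (use tp in \<open>simp_all add: agreeD[OF that]\<close>)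
  \<comment> \<open>The stages are verified from the last to the first, each for every store that
    differs from \<sigma> in work arrays only; a stage then just has to establish the start
    condition of the next.\<close>
  have c5: "ok ?c5 \<tau> Q" if A: "agree ?A \<sigma> \<tau>" and g: "?g \<tau>"
    and x: "\<tau> ''x'' 0 = local_value R par M t p s mod modulus" for \<tau>
  proof (intro ok_Seq, rule ok_code_prog[OF frame(1-3)[OF A] tp(3,4), where s = s])
    fix \<tau>' assume \<tau>': "agree {''h'', ''v''} \<tau> \<tau>'" "\<tau>' ''h'' 0 = int (code k (bag t \<inter> bag p) s n)"
    have A': "agree ?A \<sigma> \<tau>'"
      using A \<tau>'(1) by (rule agree_trans) auto
    have addr: "aval (message_address ''t'') \<tau>' = a"
      using \<tau>'(2) by (simp add: message_address_def a_def frame[OF A'] env_simps[OF frame(1)[OF A']])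
    have "aval (remainder (Add (Read ''M'' (message_address ''t'')) (Var ''x''))) \<tau>'
        = (\<sigma> ''M'' a + local_value R par M t p s mod modulus) mod modulus"
      using x addr by (simp add: frame(5)[OF A] env_simps[OF frame(1)[OF A]] agreeD[OF \<tau>'(1)])
    also have "\<dots> = (\<sigma> ''M'' a + local_value R par M t p s) mod modulus"
      by (rule mod_add_right_eq)
    finally have val: "aval (remainder (Add (Read ''M'' (message_address ''t'')) (Var ''x''))) \<tau>'
        = (\<sigma> ''M'' a + local_value R par M t p s) mod modulus" .
    show "ok ?write \<tau>' Q"
    proof (rule ok_Write)
      show "\<bar>aval (remainder (Add (Read ''M'' (message_address ''t'')) (Var ''x''))) \<tau>'\<bar> \<le> 2 ^ L"
        unfolding val by (rule abs_mod_le_cap)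
      show "Q (\<tau>'(''M'' := (\<tau>' ''M'')(aval (message_address ''t'') \<tau>' :=
          aval (remainder (Add (Read ''M'' (message_address ''t'')) (Var ''x''))) \<tau>')))"
        unfolding val addr frame(5)[OF A']
      proof (intro final)
        have "agree {''z'', ''g'', ''v'', ''u'', ''x'', ''c'', ''h'', ''M''} \<sigma> \<tau>'"
          using A' agree_refl[of ?A \<tau>'] by (rule agree_trans) auto
        then show "agree {''z'', ''g'', ''v'', ''u'', ''x'', ''c'', ''h'', ''M''} \<sigma>
            (\<tau>'(''M'' := (\<sigma> ''M'')(a := (\<sigma> ''M'' a + local_value R par M t p s) mod modulus)))"
          by simp
      qed simp
    qed
  qed (use g s in auto)
  have c4: "ok ?c4 \<tau> Q" if A: "agree ?A \<sigma> \<tau>" and g: "?g \<tau>" and x: "\<tau> ''x'' 0 = (vp * ep) mod modulus" for \<tau>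
  proof (intro ok_Seq, rule ok_child_prog[OF frame(1,2)[OF A] tp(3), where s = s and a = "vp * ep"])
    fix \<tau>' assume \<tau>': "agree {''c'', ''h'', ''v'', ''x''} \<tau> \<tau>'"
      "\<tau>' ''x'' 0 = (vp * ep * (\<Prod>c | c \<in> {..<N} - R \<and> par c = t. M c (restrict s (bag c \<inter> bag t)))) mod modulus"
    show "ok ?c5 \<tau>' Q"
    proof (rule c5)
      show "agree ?A \<sigma> \<tau>'"
        using A \<tau>'(1) by (rule agree_trans) auto
    qed (use \<tau>'(2) g in \<open>simp_all add: lv cp_def agreeD[OF \<tau>'(1)]\<close>)
  qed (use g s x children cells frame[OF A] in auto)
  have c3: "ok ?c3 \<tau> Q" if A: "agree ?A \<sigma> \<tau>" and g: "?g \<tau>" and x: "\<tau> ''x'' 0 = vp mod modulus" for \<tau>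
  proof (intro ok_Seq[of edge_prog], rule ok_edge_prog[OF frame(1-3)[OF A] tp(3,4), where s = s and a = vp])
    fix \<tau>' assume \<tau>': "agree {''v'', ''u'', ''x''} \<tau> \<tau>'"
      "\<tau>' ''x'' 0 = (vp * (\<Prod>e | e \<in> E \<and> (e \<subseteq> bag t \<and> \<not> e \<subseteq> bag p). edge_weight base eps e s)) mod modulus"
    show "ok ?c4 \<tau>' Q"
    proof (rule c4)
      show "agree ?A \<sigma> \<tau>'"
        using A \<tau>'(1) by (rule agree_trans) auto
      show "\<tau>' ''x'' 0 = (vp * ep) mod modulus"
        using \<tau>'(2) by (simp only: ep_def)
    qed (use g in \<open>simp add: agreeD[OF \<tau>'(1)]\<close>)
  qed (use g s x in auto)
  have c2: "ok ?c2 \<tau> Q" if A: "agree ?A \<sigma> \<tau>" and g: "?g \<tau>" and x: "\<tau> ''x'' 0 = 1" for \<tau>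
  proof (intro ok_Seq[of vertex_prog], rule ok_vertex_prog[OF frame(1-3)[OF A] tp(3,4), where s = s and a = 1])
    fix \<tau>' assume \<tau>': "agree {''v'', ''x''} \<tau> \<tau>'"
      "\<tau>' ''x'' 0 = (1 * (\<Prod>v\<in>bag t - bag p. weight eps (s v))) mod modulus"
    show "ok ?c3 \<tau>' Q"
    proof (rule c3)
      show "agree ?A \<sigma> \<tau>'"
        using A \<tau>'(1) by (rule agree_trans) auto
    qed (use \<tau>'(2) g in \<open>simp_all add: vp_def agreeD[OF \<tau>'(1)]\<close>)
  qed (use g s x modulus_ge in auto)
  show "ok (Seq decode_prog (Seq (Assign ''x'' (Const 1)) ?c2)) \<sigma> Q"
  proof (intro ok_Seq[of decode_prog], rule ok_decode_prog[OF env tp(1,3) i])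
    fix \<tau> assume \<tau>: "agree {''z'', ''g'', ''v''} \<sigma> \<tau>"
      "\<And>v. v \<in> bag t \<Longrightarrow> \<tau> ''g'' (int v) = int (digit k (bag t) i v)"
    have "agree ?A \<sigma> \<tau>"
      using \<tau>(1) agree_refl[of "{}" \<tau>] by (rule agree_trans) auto
    then have "ok ?c2 (set_var \<tau> ''x'' 1) Q"
      using \<tau>(2) by (intro c2) (simp_all add: s_def)
    then show "ok (Seq (Assign ''x'' (Const 1)) ?c2) \<tau> Q"
      by (intro ok_Seq[of "Assign _ _"] ok_Assign) simp_all
  qed
qed

section \<open>Filling the table of one node\<close>

lemma address_inject:
  fixes t c :: nat
  assumes "t \<le> N" "c \<le> N" "int t + (int N + 1) * int h = int c + (int N + 1) * int h'"
  shows "t = c \<and> h = h'"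
proof -
  have eq: "t + Suc N * h = c + Suc N * h'"
  proof -
    have "int (t + Suc N * h) = int (c + Suc N * h')"
      using assms(3) by (simp add: algebra_simps)
    then show ?thesis
      by (simp only: of_nat_eq_iff)
  qed
  from arg_cong[OF eq, of "\<lambda>i. i mod Suc N"] have "t = c"
    using assms(1,2) by (simp add: mod_less del: mult_Suc)
  with eq have "Suc N * h = Suc N * h'"
    by simp
  with \<open>t = c\<close> show ?thesis
    by (simp only: mult_cancel1 nat.simps simp_thms)
qed

text \<open>The table is accumulated in place, so \<open>zero\<close> demands that its cells start
  at 0. The case t = p = N is the closing step for the dummy node.\<close>

lemma ok_node_prog:
  assumes env: "env \<sigma>" and tp: "\<sigma> ''t'' 0 = int t" "\<sigma> ''p'' 0 = int p" "t \<le> N" "p \<le> N"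
    and R: "t \<in> insert N R" "p = t \<Longrightarrow> t = N"
    and par: "\<And>c. c < N \<Longrightarrow> \<sigma> ''par'' (int c) = (if c \<in> R then 0 else int (par c) + 1)"
    and cells: "\<And>c \<rho>. c < N \<Longrightarrow> c \<notin> R \<Longrightarrow> par c = t \<Longrightarrow> \<rho> \<in> bag c \<inter> bag t \<rightarrow>\<^sub>E {..<k} \<Longrightarrow>
      \<sigma> ''M'' (int c + (int N + 1) * int (code k (bag c \<inter> bag t) \<rho> n)) = M c \<rho> mod modulus"
    and zero: "\<And>h. \<sigma> ''M'' (int t + (int N + 1) * int h) = 0"
    and final: "\<And>\<tau>. agree {''z'', ''g'', ''v'', ''u'', ''x'', ''c'', ''h'', ''M'', ''par'', ''K'', ''i''} \<sigma> \<tau> \<Longrightarrow>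
      \<tau> ''par'' = (\<sigma> ''par'')(int t := int p + 1) \<Longrightarrow>
      (\<And>\<rho>. \<rho> \<in> bag t \<inter> bag p \<rightarrow>\<^sub>E {..<k} \<Longrightarrow>
        \<tau> ''M'' (int t + (int N + 1) * int (code k (bag t \<inter> bag p) \<rho> n)) = message R par M t p \<rho> mod modulus) \<Longrightarrow>
      (\<And>c h. c \<le> N \<Longrightarrow> c \<noteq> t \<Longrightarrow>
        \<tau> ''M'' (int c + (int N + 1) * int h) = \<sigma> ''M'' (int c + (int N + 1) * int h)) \<Longrightarrow> Q \<tau>"
  shows "ok node_prog \<sigma> Q"
  unfolding node_prog_def
proof -
  let ?A = "{''z'', ''g'', ''v'', ''u'', ''x'', ''c'', ''h'', ''M'', ''par'', ''K'', ''i''}"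
  let ?J = "bag t \<inter> bag p"
  let ?par = "(\<sigma> ''par'')(int t := int p + 1)"
  let ?s = "digit k (bag t)"
  let ?lv = "\<lambda>i. local_value R par M t p (?s i)"
  let ?a = "\<lambda>\<rho>. int t + (int N + 1) * int (code k ?J \<rho> n)"
  have frame: "env \<tau>" "\<tau> ''t'' 0 = int t" "\<tau> ''p'' 0 = int p" if "agree ?A \<sigma> \<tau>" for \<tau>
  proof -
    show "env \<tau>"
      using env that by (rule env_agree) (auto simp: env_names_def)
  qed (use tp in \<open>simp_all add: agreeD[OF that]\<close>)
  have k_le: "int (k ^ card (bag t \<inter> S)) \<le> 2 ^ L" for S
  proof -
    have "card (bag t \<inter> S) \<le> card {..<n}"
      using bag_subset[of t] by (intro card_mono) auto
    then have "k ^ card (bag t \<inter> S) \<le> k ^ n"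
      by (intro power_increasing) (simp_all add: Suc_le_eq)
    then show ?thesis
      using cap_table by linarith
  qed
  have k_card: "k ^ card (bag t) \<le> k ^ n"
    using bag_subset[of t] card_mono[of "{..<n}" "bag t"]
    by (intro power_increasing) (simp_all add: Suc_le_eq)
  \<comment> \<open>Recording the parent of t before its table is computed does no harm: t would
    count as its own child only if p = t < N, which is excluded.\<close>
  have children: "?par (int c) = int t + 1 \<longleftrightarrow> c \<notin> R \<and> par c = t" if "c < N" for c
    using that R par[of c] by auto
  let ?c2 = "For ''i'' (Var ''K'') assignment_prog"
  have c2: "ok ?c2 \<tau> Q" if A: "agree ?A \<sigma> \<tau>" and K: "\<tau> ''K'' 0 = int (k ^ card (bag t))"
    and par': "\<tau> ''par'' = ?par" and M': "\<tau> ''M'' = \<sigma> ''M''" for \<tau>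
  proof -
    \<comment> \<open>After m rounds each cell of the table holds the residue of the partial sum
      over i < m in \<open>message_eq_sum_digits\<close>.\<close>
    let ?I = "\<lambda>m \<rho>. agree ?A \<sigma> \<rho> \<and> \<rho> ''K'' 0 = int (k ^ card (bag t)) \<and> \<rho> ''par'' = ?par \<and>
      (\<forall>\<pi>\<in>?J \<rightarrow>\<^sub>E {..<k}. \<rho> ''M'' (?a \<pi>) = (\<Sum>i<m. if restrict (?s i) ?J = \<pi> then ?lv i else 0) mod modulus) \<and>
      (\<forall>c h. c \<le> N \<longrightarrow> c \<noteq> t \<longrightarrow>
        \<rho> ''M'' (int c + (int N + 1) * int h) = \<sigma> ''M'' (int c + (int N + 1) * int h))"
    show ?thesis
    proof (rule ok_For[of "k ^ card (bag t)" _ _ ?I])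
      show "k ^ card (bag t) \<le> \<nu> (Sub (Var ''K'') (Var ''i''))"
        using count_table[OF tp(3)] by (simp add: table_guard_def)
      show "int (k ^ card (bag t)) \<le> 2 ^ L"
        using k_card cap_table by linarith
      show "?I 0 (set_var \<tau> ''i'' 0)"
        using A K par' M' zero by (simp add: fun_upd_def)
    next
      fix m \<rho> assume m: "m < k ^ card (bag t)" and I: "?I m \<rho>" and i: "\<rho> ''i'' 0 = int m"
      have A': "agree ?A \<sigma> \<rho>" and K': "\<rho> ''K'' 0 = int (k ^ card (bag t))" and par'': "\<rho> ''par'' = ?par"
        and sums: "\<And>\<pi>. \<pi> \<in> ?J \<rightarrow>\<^sub>E {..<k} \<Longrightarrow>
          \<rho> ''M'' (?a \<pi>) = (\<Sum>i<m. if restrict (?s i) ?J = \<pi> then ?lv i else 0) mod modulus"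
        and others: "\<And>c h. c \<le> N \<Longrightarrow> c \<noteq> t \<Longrightarrow>
          \<rho> ''M'' (int c + (int N + 1) * int h) = \<sigma> ''M'' (int c + (int N + 1) * int h)"
        using I by blast+
      let ?\<pi> = "restrict (?s m) ?J"
      have "?\<pi> \<in> ?J \<rightarrow>\<^sub>E {..<k}"
        by (auto simp: digit_less)
      moreover have addr: "?a (?s m) = ?a ?\<pi>"
        using code_cong[of ?J "?s m" ?\<pi> k n] by simp
      ultimately have cell: "\<rho> ''M'' (?a (?s m)) = (\<Sum>i<m. if restrict (?s i) ?J = ?\<pi> then ?lv i else 0) mod modulus"
        using sums by simp
      have par_N: "c \<noteq> t" if "c < N" "c \<notin> R" for c
        using that R(1) by auto
      show "ok assignment_prog \<rho> (\<lambda>\<tau>'. \<tau>' ''i'' 0 = int m \<and> ?I (Suc m) (set_var \<tau>' ''i'' (int (Suc m))))"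
      proof (rule ok_assignment_prog[OF frame[OF A'] tp(3,4) i _ _ _ refl refl, where R = R and par = par and M = M])
        fix \<tau>' assume \<tau>': "agree {''z'', ''g'', ''v'', ''u'', ''x'', ''c'', ''h'', ''M''} \<rho> \<tau>'"
          "\<tau>' ''M'' = (\<rho> ''M'')(?a (?s m) := (\<rho> ''M'' (?a (?s m)) + ?lv m) mod modulus)"
        have "agree ?A \<sigma> \<tau>'"
          using A' \<tau>'(1) by (rule agree_trans) auto
        moreover have "\<tau>' ''M'' (?a \<pi>) = (\<Sum>i<Suc m. if restrict (?s i) ?J = \<pi> then ?lv i else 0) mod modulus"
          if \<pi>: "\<pi> \<in> ?J \<rightarrow>\<^sub>E {..<k}" for \<pi>
        proof (cases "?\<pi> = \<pi>")
          case True
          then have "?a \<pi> = ?a (?s m)"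
            using addr by simp
          then have "\<tau>' ''M'' (?a \<pi>) = (\<rho> ''M'' (?a (?s m)) + ?lv m) mod modulus"
            unfolding \<tau>'(2) by simp
          also have "\<dots> = ((\<Sum>i<m. if restrict (?s i) ?J = \<pi> then ?lv i else 0) + ?lv m) mod modulus"
            unfolding cell True by (rule mod_add_left_eq)
          finally show ?thesis
            using True by simp
        next
          case False
          \<comment> \<open>Different assignments of the overlap have different codes, so this round
            does not touch the cell of \<pi>.\<close>
          have "?a \<pi> \<noteq> ?a (?s m)"
          proof
            assume "?a \<pi> = ?a (?s m)"
            then have "code k ?J \<pi> n = code k ?J ?\<pi> n"
              using address_inject[OF tp(3) tp(3)] addr by metis
            from code_inject[OF this] have "\<pi> v = ?\<pi> v" if "v \<in> ?J" for v
              using that \<pi> bag_subset[of t] by (auto simp: digit_less PiE_iff)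
            then have "\<pi> = ?\<pi>"
              using \<pi> by (intro PiE_ext[of _ ?J "\<lambda>_. {..<k}"]) (auto simp: digit_less)
            with False show False
              by simp
          qed
          then show ?thesis
            using sums[OF \<pi>] False unfolding \<tau>'(2) by simp
        qed
        moreover have "\<tau>' ''M'' (int c + (int N + 1) * int h) = \<sigma> ''M'' (int c + (int N + 1) * int h)"
          if "c \<le> N" "c \<noteq> t" for c h
        proof -
          have "int c + (int N + 1) * int h \<noteq> ?a (?s m)"
            using address_inject[OF that(1) tp(3)] that(2) by metis
          then show ?thesis
            using others[OF that] unfolding \<tau>'(2) by simp
        qed
        ultimately show "\<tau>' ''i'' 0 = int m \<and> ?I (Suc m) (set_var \<tau>' ''i'' (int (Suc m)))"
          using i K' par'' by (simp add: agreeD[OF \<tau>'(1)] fun_upd_def del: sum.lessThan_Suc)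
      next
        fix c \<pi> assume c: "c < N" "c \<notin> R" "par c = t" "\<pi> \<in> bag c \<inter> bag t \<rightarrow>\<^sub>E {..<k}"
        then show "\<rho> ''M'' (int c + (int N + 1) * int (code k (bag c \<inter> bag t) \<pi> n)) = M c \<pi> mod modulus"
          using others[of c] par_N[of c] cells by simp
      next
        show "m < k ^ n"
          using m k_card by linarith
      qed (use par'' children in auto)
    next
      fix \<rho> assume I: "?I (k ^ card (bag t)) \<rho>"
      show "Q \<rho>"
      proof (rule final)
        fix \<pi> assume "\<pi> \<in> ?J \<rightarrow>\<^sub>E {..<k}"
        then show "\<rho> ''M'' (?a \<pi>) = message R par M t p \<pi> mod modulus"
          using I message_eq_sum_digits[OF k_pos, of R par M t p \<pi>] by simp
      qed (use I in auto)
    qed auto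
  qed
  let ?e = "Mul (Var ''K'') (Add (Const 1) (Mul (bag_at ''t'' ''v'') (Const (int K))))"
  let ?c1 = "Seq (For ''v'' (Var ''n'') (Assign ''K'' ?e)) ?c2"
  have c1: "ok ?c1 \<tau> Q" if A: "agree ?A \<sigma> \<tau>" and K: "\<tau> ''K'' 0 = 1"
    and par': "\<tau> ''par'' = ?par" and M': "\<tau> ''M'' = \<sigma> ''M''" for \<tau>
  proof (rule ok_Seq)
    let ?I = "\<lambda>m \<rho>. agree {''K'', ''v''} \<tau> \<rho> \<and> \<rho> ''K'' 0 = int (k ^ card (bag t \<inter> {..<m}))"
    show "ok (For ''v'' (Var ''n'') (Assign ''K'' ?e)) \<tau> (\<lambda>\<tau>'. ok ?c2 \<tau>' Q)"
    proof (rule ok_For[of n _ _ ?I])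
      fix m \<rho> assume m: "m < n" and I: "?I m \<rho>" and v: "\<rho> ''v'' 0 = int m"
      have A': "agree ?A \<sigma> \<rho>"
        using A conjunct1[OF I] by (rule agree_trans) auto
      have S: "bag t \<inter> {..<Suc m} = (if m \<in> bag t then insert m (bag t \<inter> {..<m}) else bag t \<inter> {..<m})"
        by (auto simp: lessThan_Suc)
      \<comment> \<open>A factor 1 + K = k enters for every vertex of the bag and a factor 1 for
        every other vertex.\<close>
      have "aval ?e \<rho> = int (k ^ card (bag t \<inter> {..<Suc m}))"
        using I aval_bag_at[OF frame(1,2)[OF A'] v tp(3) m] unfolding S by (simp add: k_def algebra_simps)
      then show "ok (Assign ''K'' ?e) \<rho> (\<lambda>\<tau>'. \<tau>' ''v'' 0 = int m \<and> ?I (Suc m) (set_var \<tau>' ''v'' (int (Suc m))))"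
        using I v k_le[of "{..<Suc m}"] by (intro ok_Assign) (simp_all del: aval.simps of_nat_power)
    next
      fix m \<rho> assume I: "?I m \<rho>"
      have A': "agree ?A \<sigma> \<rho>"
        using A conjunct1[OF I] by (rule agree_trans) auto
      then show "aval (Var ''n'') \<rho> = int n"
        by (simp add: env_simps[OF frame(1)])
    next
      fix \<rho> assume I: "?I n \<rho>"
      have "bag t \<inter> {..<n} = bag t"
        using bag_subset[of t] by blast
      moreover have "agree ?A \<sigma> \<rho>"
        using A conjunct1[OF I] by (rule agree_trans) auto
      ultimately show "ok ?c2 \<rho> Q"
        using I par' M' by (intro c2) (simp_all add: agreeD[OF conjunct1[OF I]])
    qed (use K cap_n in \<open>simp_all add: count_n table_guard_def\<close>)
  qed
  show "ok (Seq (Write ''par'' (Var ''t'') (Add (Var ''p'') (Const 1))) (Seq (Assign ''K'' (Const 1)) ?c1)) \<sigma> Q"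
  proof (rule ok_Seq, rule ok_Write)
    show "\<bar>aval (Add (Var ''p'') (Const 1)) \<sigma>\<bar> \<le> 2 ^ L"
      using tp cap_N by simp
    have "ok ?c1 (set_var (\<sigma>(''par'' := ?par)) ''K'' 1) Q"
      by (intro c1, simp, simp_all add: fun_upd_def)
    then show "ok (Seq (Assign ''K'' (Const 1)) ?c1)
        (\<sigma>(''par'' := (\<sigma> ''par'')(aval (Var ''t'') \<sigma> := aval (Add (Var ''p'') (Const 1)) \<sigma>))) Q"
      using tp by (intro ok_Seq[of "Assign _ _"] ok_Assign) simp_all
  qed
qed

lemma ok_neighbour_prog:
  assumes env: "env \<sigma>" and u: "\<sigma> ''u'' 0 = int u" "u < N" and R: "R \<subseteq> {..<N}"
    and par: "\<And>c. c < N \<Longrightarrow> \<sigma> ''par'' (int c) = (if c \<in> R then 0 else int (par c) + 1)"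
    and final: "\<And>\<tau>. agree {''d'', ''q'', ''s''} \<sigma> \<tau> \<Longrightarrow>
      \<tau> ''d'' 0 = int (card (neighbours F R u)) \<Longrightarrow>
      (neighbours F R u = {} \<Longrightarrow> \<tau> ''q'' 0 = int N) \<Longrightarrow>
      (neighbours F R u \<noteq> {} \<Longrightarrow> \<exists>q\<in>neighbours F R u. \<tau> ''q'' 0 = int q) \<Longrightarrow> Q \<tau>"
  shows "ok neighbour_prog \<sigma> Q"
  unfolding neighbour_prog_def
proof (intro ok_Seq ok_Assign)
  let ?nb = "\<lambda>m. neighbours F R u \<inter> {..<m}"
  let ?I = "\<lambda>m \<tau>. agree {''d'', ''q'', ''s''} \<sigma> \<tau> \<and> \<tau> ''d'' 0 = int (card (?nb m)) \<and>
    (?nb m = {} \<longrightarrow> \<tau> ''q'' 0 = int N) \<and> (?nb m \<noteq> {} \<longrightarrow> (\<exists>q\<in>?nb m. \<tau> ''q'' 0 = int q))"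
  let ?cond = "Mul (Read ''tree'' (Add (Mul (Var ''u'') (Var ''N'')) (Var ''s'')))
                       (Sub (Const 1) (Read ''par'' (Var ''s'')))"
  let ?body = "IfPos ?cond (Seq (Assign ''d'' (Add (Var ''d'') (Const 1))) (Assign ''q'' (Var ''s''))) Skip"
  have capN: "int N \<le> 2 ^ L"
    using cap_N by linarith
  show "\<bar>aval (Var ''N'') (set_var \<sigma> ''d'' (aval (Const 0) \<sigma>))\<bar> \<le> 2 ^ L"
    using capN by (simp add: env_simps[OF env])
  show "ok (For ''s'' (Var ''N'') ?body) (set_var (set_var \<sigma> ''d'' (aval (Const 0) \<sigma>)) ''q''
      (aval (Var ''N'') (set_var \<sigma> ''d'' (aval (Const 0) \<sigma>)))) Q"
  proof (rule ok_For[of N _ _ ?I])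
    fix m \<tau> assume m: "m < N" and I: "?I m \<tau>" and s: "\<tau> ''s'' 0 = int m"
    have env': "env \<tau>"
      using env I by (rule_tac env_agree) (auto simp: env_names_def)
    have "aval ?cond \<tau> = of_bool ({u, m} \<in> F) * (1 - (if m \<in> R then 0 else int (par m) + 1))"
      using m u par by (simp add: env_simps[OF env] s agreeD[OF conjunct1[OF I]])
    then have cond: "aval ?cond \<tau> > 0 \<longleftrightarrow> m \<in> neighbours F R u"
      by (simp add: neighbours_def)
    have "card (?nb (Suc m)) \<le> card {..<N}"
      using R by (intro card_mono) (auto simp: neighbours_def)
    then have card: "int (card (?nb (Suc m))) \<le> 2 ^ L"
      using capN by simp
    show "ok ?body \<tau> (\<lambda>\<tau>'. \<tau>' ''s'' 0 = int m \<and> ?I (Suc m) (set_var \<tau>' ''s'' (int (Suc m))))"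
    proof (intro ok_IfPos ok_Seq ok_Assign ok_Skip)
      assume "aval ?cond \<tau> > 0"
      then have mem: "m \<in> neighbours F R u"
        by (simp only: cond)
      then have S: "?nb (Suc m) = insert m (?nb m)"
        by (auto simp: lessThan_Suc)
      have d: "aval (Add (Var ''d'') (Const 1)) \<tau> = int (card (?nb (Suc m)))"
        using I unfolding S by simp
      show "\<bar>aval (Add (Var ''d'') (Const 1)) \<tau>\<bar> \<le> 2 ^ L"
        unfolding d using card by simp
      show "\<bar>aval (Var ''s'') (set_var \<tau> ''d'' (aval (Add (Var ''d'') (Const 1)) \<tau>))\<bar> \<le> 2 ^ L"
        using m capN s by simp
      let ?\<tau> = "set_var (set_var \<tau> ''d'' (aval (Add (Var ''d'') (Const 1)) \<tau>)) ''q''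
          (aval (Var ''s'') (set_var \<tau> ''d'' (aval (Add (Var ''d'') (Const 1)) \<tau>)))"
      have "\<exists>q\<in>?nb (Suc m). ?\<tau> ''q'' 0 = int q"
        by (rule bexI[of _ m]) (use mem s in simp_all)
      moreover have "?nb (Suc m) \<noteq> {}"
        using mem by auto
      ultimately show "?\<tau> ''s'' 0 = int m \<and> ?I (Suc m) (set_var ?\<tau> ''s'' (int (Suc m)))"
        unfolding d using I s by simp
    next
      assume "\<not> aval ?cond \<tau> > 0"
      then have "m \<notin> neighbours F R u"
        by (simp only: cond) simp
      then have S: "?nb (Suc m) = ?nb m"
        by (auto simp: lessThan_Suc)
      show "\<tau> ''s'' 0 = int m \<and> ?I (Suc m) (set_var \<tau> ''s'' (int (Suc m)))"
        using I s unfolding S by simp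
    qed
  next
    fix m \<tau> assume I: "?I m \<tau>"
    show "aval (Var ''N'') \<tau> = int N"
      by (simp add: agreeD[OF conjunct1[OF I]] env_simps[OF env])
  next
    fix \<tau> assume I: "?I N \<tau>"
    have "?nb N = neighbours F R u"
      using R by (auto simp: neighbours_def)
    with I show "Q \<tau>"
      by (intro final) auto
  qed (use capN in \<open>simp_all add: count_N table_guard_def env_simps[OF env]\<close>)
qed simp

section \<open>The main loop: choosing and eliminating leaves\<close>

lemma no_loop_F: "{x} \<notin> F" and acyclic_F: "\<nexists>xs. is_cycle F xs"
  using decomposition by (auto simp: tree_decomposition_def is_tree_def simple_graph_def)

text \<open>That a leaf is met at all follows from acyclicity; the invariant merely says that once
  one has been passed, \<open>t\<close> and \<open>p\<close> describe some leaf.\<close>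

lemma ok_leaf_prog:
  assumes env: "env \<sigma>" and R: "R \<subseteq> {..<N}" "R \<noteq> {}"
    and par: "\<And>c. c < N \<Longrightarrow> \<sigma> ''par'' (int c) = (if c \<in> R then 0 else int (par c) + 1)"
    and final: "\<And>\<tau> t p. agree {''u'', ''d'', ''q'', ''s'', ''t'', ''p''} \<sigma> \<tau> \<Longrightarrow>
      is_leaf F R N t p \<Longrightarrow> \<tau> ''t'' 0 = int t \<Longrightarrow> \<tau> ''p'' 0 = int p \<Longrightarrow> Q \<tau>"
  shows "ok leaf_prog \<sigma> Q"
  unfolding leaf_prog_def
proof -
  let ?A = "{''u'', ''d'', ''q'', ''s'', ''t'', ''p''}"
  let ?found = "\<lambda>\<tau>. \<exists>t p. is_leaf F R N t p \<and> \<tau> ''t'' 0 = int t \<and> \<tau> ''p'' 0 = int p"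
  let ?I = "\<lambda>m \<tau>. agree ?A \<sigma> \<tau> \<and> ((\<exists>u<m. u \<in> R \<and> card (neighbours F R u) \<le> 1) \<longrightarrow> ?found \<tau>)"
  let ?inner = "IfPos (Sub (Const 2) (Var ''d'')) (Seq (Assign ''t'' (Var ''u'')) (Assign ''p'' (Var ''q''))) Skip"
  let ?body = "IfPos (Sub (Const 1) (Read ''par'' (Var ''u''))) (Seq neighbour_prog ?inner) Skip"
  have capN: "int N \<le> 2 ^ L"
    using cap_N by linarith
  have fin: "finite R"
    using R finite_subset by blast
  show "ok (For ''u'' (Var ''N'') ?body) \<sigma> Q"
  proof (rule ok_For[of N _ _ ?I])
    fix m \<tau> assume m: "m < N" and bd: "bounded_store L \<tau>" and I: "?I m \<tau>" and u: "\<tau> ''u'' 0 = int m"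
    have env': "env \<tau>"
      using env I by (rule_tac env_agree) (auto simp: env_names_def)
    have par': "\<tau> ''par'' (int c) = (if c \<in> R then 0 else int (par c) + 1)" if "c < N" for c
      using par[OF that] by (simp add: agreeD[OF conjunct1[OF I]])
    let ?nb = "neighbours F R m"
    have skip: "\<tau>' ''u'' 0 = int m \<and> ?I (Suc m) (set_var \<tau>' ''u'' (int (Suc m)))"
      if "agree {''d'', ''q'', ''s''} \<tau> \<tau>'" "m \<notin> R \<or> \<not> card ?nb \<le> 1" for \<tau>'
    proof -
      have "agree ?A \<sigma> \<tau>'"
        using conjunct1[OF I] that(1) by (rule agree_trans) auto
      then show ?thesis
        using I u that(2) by (auto simp: less_Suc_eq agreeD[OF that(1)])
    qed
    show "ok ?body \<tau> (\<lambda>\<tau>'. \<tau>' ''u'' 0 = int m \<and> ?I (Suc m) (set_var \<tau>' ''u'' (int (Suc m))))"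
    proof (intro ok_IfPos ok_Seq[of neighbour_prog] ok_Skip)
      assume "aval (Sub (Const 1) (Read ''par'' (Var ''u''))) \<tau> > 0"
      then have mem: "m \<in> R"
        using par'[OF m] u by (simp split: if_splits)
      show "ok neighbour_prog \<tau> (\<lambda>\<tau>'. ok ?inner \<tau>'
          (\<lambda>\<tau>'. \<tau>' ''u'' 0 = int m \<and> ?I (Suc m) (set_var \<tau>' ''u'' (int (Suc m)))))"
      proof (rule ok_neighbour_prog[OF env' u m R(1) par'])
        fix \<tau>' assume \<tau>': "agree {''d'', ''q'', ''s''} \<tau> \<tau>'" "\<tau>' ''d'' 0 = int (card ?nb)"
          "?nb = {} \<Longrightarrow> \<tau>' ''q'' 0 = int N" "?nb \<noteq> {} \<Longrightarrow> \<exists>q\<in>?nb. \<tau>' ''q'' 0 = int q"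
        show "ok ?inner \<tau>' (\<lambda>\<tau>'. \<tau>' ''u'' 0 = int m \<and> ?I (Suc m) (set_var \<tau>' ''u'' (int (Suc m))))"
        proof (intro ok_IfPos ok_Seq ok_Assign ok_Skip)
          assume "aval (Sub (Const 2) (Var ''d'')) \<tau>' > 0"
          then have "card ?nb \<le> 1"
            using \<tau>'(2) by simp
          moreover have "finite ?nb"
            using fin by (simp add: neighbours_def)
          \<comment> \<open>With at most one neighbour, the cell \<open>q\<close> holds either N or
            that only neighbour, which are the two cases of \<open>is_leaf\<close>.\<close>
          ultimately obtain q where q: "is_leaf F R N m q" "\<tau>' ''q'' 0 = int q"
            using \<tau>'(3,4) mem unfolding is_leaf_def
            by (metis card_0_eq card_1_singletonE le_less_Suc_eq less_one linorder_not_le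
                One_nat_def le_neq_implies_less singletonD)
          have "q \<le> N"
            using q(1) R by (auto simp: is_leaf_def neighbours_def)
          then have "int q \<le> 2 ^ L"
            using capN by linarith
          then show "\<bar>aval (Var ''q'') (set_var \<tau>' ''t'' (aval (Var ''u'') \<tau>'))\<bar> \<le> 2 ^ L"
            using q by simp
          have u': "\<tau>' ''u'' 0 = int m"
            using u by (simp add: agreeD[OF \<tau>'(1)])
          then show "\<bar>aval (Var ''u'') \<tau>'\<bar> \<le> 2 ^ L"
            using m capN by simp
          let ?\<tau> = "set_var (set_var \<tau>' ''t'' (aval (Var ''u'') \<tau>')) ''p''
              (aval (Var ''q'') (set_var \<tau>' ''t'' (aval (Var ''u'') \<tau>')))"
          have "agree ?A \<sigma> \<tau>'"
            using conjunct1[OF I] \<tau>'(1) by (rule agree_trans) auto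
          moreover have "?found (set_var ?\<tau> ''u'' (int (Suc m)))"
            using q u' by (intro exI[of _ m] exI[of _ q]) simp
          ultimately show "?\<tau> ''u'' 0 = int m \<and> ?I (Suc m) (set_var ?\<tau> ''u'' (int (Suc m)))"
            using u' by simp
        next
          assume "\<not> aval (Sub (Const 2) (Var ''d'')) \<tau>' > 0"
          then have "\<not> card ?nb \<le> 1"
            using \<tau>'(2) by simp
          then show "\<tau>' ''u'' 0 = int m \<and> ?I (Suc m) (set_var \<tau>' ''u'' (int (Suc m)))"
            using skip[OF \<tau>'(1)] by blast
        qed
      qed
    next
      assume "\<not> aval (Sub (Const 1) (Read ''par'' (Var ''u''))) \<tau> > 0"
      then have "m \<notin> R"
        using par'[OF m] u by (simp split: if_splits)
      then show "\<tau> ''u'' 0 = int m \<and> ?I (Suc m) (set_var \<tau> ''u'' (int (Suc m)))"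
        using skip[of \<tau>] by simp
    qed
  next
    fix m \<tau> assume I: "?I m \<tau>"
    show "aval (Var ''N'') \<tau> = int N"
      by (simp add: agreeD[OF conjunct1[OF I]] env_simps[OF env])
  next
    fix \<tau> assume I: "?I N \<tau>"
    obtain u where "u \<in> R" "card (neighbours F R u) \<le> 1"
      using exists_leaf[OF fin R(2) acyclic_F no_loop_F] by blast
    with I R obtain t p where "is_leaf F R N t p" "\<tau> ''t'' 0 = int t" "\<tau> ''p'' 0 = int p"
      by blast
    with I show "Q \<tau>"
      by (intro final) auto
  qed (use capN in \<open>simp_all add: count_N table_guard_def\<close>)
qed

text \<open>Invariant of the elimination. Its last two conditions are what survives of the tree
  decomposition: linked occurrences, possibly none, and coverage of the edges whose end points are
  still present. The zero tables prepare for the accumulation in the node step.\<close>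

definition dp_state ::
    "nat set \<Rightarrow> (nat \<Rightarrow> nat) \<Rightarrow> (nat \<Rightarrow> (nat \<Rightarrow> nat) \<Rightarrow> int) \<Rightarrow> store \<Rightarrow> bool" where
  "dp_state R par M \<sigma> \<longleftrightarrow> R \<subseteq> {..<N} \<and>
     (\<forall>c<N. \<sigma> ''par'' (int c) = (if c \<in> R then 0 else int (par c) + 1)) \<and>
     (\<forall>c. c < N \<longrightarrow> c \<notin> R \<longrightarrow> (\<forall>\<rho>\<in>bag c \<inter> bag (par c) \<rightarrow>\<^sub>E {..<k}.
       \<sigma> ''M'' (int c + (int N + 1) * int (code k (bag c \<inter> bag (par c)) \<rho> n)) = M c \<rho> mod modulus)) \<and>
     (\<forall>c\<in>insert N R. \<forall>h. \<sigma> ''M'' (int c + (int N + 1) * int h) = 0) \<and>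
     remaining R par M = partition_function base eps n E \<and>
     (\<forall>v. linked F {r \<in> R. v \<in> bag r}) \<and>
     (\<forall>e\<in>E. e \<subseteq> span R \<longrightarrow> (\<exists>s\<in>R. e \<subseteq> bag s))"

lemma dp_state_step:
  assumes state: "dp_state R par M \<sigma>" and leaf: "is_leaf F R N t p"
    and par: "\<tau> ''par'' = (\<sigma> ''par'')(int t := int p + 1)"
    and new: "\<And>\<rho>. \<rho> \<in> bag t \<inter> bag p \<rightarrow>\<^sub>E {..<k} \<Longrightarrow>
        \<tau> ''M'' (int t + (int N + 1) * int (code k (bag t \<inter> bag p) \<rho> n)) = message R par M t p \<rho> mod modulus"
    and old: "\<And>c h. c \<le> N \<Longrightarrow> c \<noteq> t \<Longrightarrow>
        \<tau> ''M'' (int c + (int N + 1) * int h) = \<sigma> ''M'' (int c + (int N + 1) * int h)"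
  shows "dp_state (R - {t}) (par(t := p)) (M(t := message R par M t p)) \<tau>"
proof -
  have R: "R \<subseteq> {..<N}" and t: "t \<in> R" "t < N"
    using state leaf by (auto simp: dp_state_def is_leaf_def)
  have linked: "linked F {r \<in> R. v \<in> bag r}" for v
    using state by (simp add: dp_state_def)
  have cover: "\<exists>s\<in>R. e \<subseteq> bag s" if "e \<in> E" "e \<subseteq> span R" for e
    using state that by (simp add: dp_state_def)
  have below: "bag t \<inter> bag s \<subseteq> bag p" if "s \<in> R" "s \<noteq> t" for s
    using linked leaf that by (rule leaf_bag_subset)
  have p: "p \<in> insert N (R - {t})"
    using leaf no_loop_F[of t] by (auto simp: is_leaf_def neighbours_def)
  have "remaining (R - {t}) (par(t := p)) (M(t := message R par M t p)) = remaining R par M"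
    by (rule remaining_eliminate[OF R t(1) p below cover])
  moreover have "linked F {r \<in> R - {t}. v \<in> bag r}" for v
  proof -
    have "linked F ({r \<in> R. v \<in> bag r} - {t})"
    proof (rule linked_remove_leaf[OF linked _ no_loop_F])
      show "neighbours F {r \<in> R. v \<in> bag r} t \<subseteq> {p}"
        using leaf by (auto simp: is_leaf_def neighbours_def)
    qed
    moreover have "{r \<in> R. v \<in> bag r} - {t} = {r \<in> R - {t}. v \<in> bag r}"
      by auto
    ultimately show ?thesis
      by simp
  qed
  moreover have "\<exists>s\<in>R - {t}. e \<subseteq> bag s" if e: "e \<in> E" "e \<subseteq> span (R - {t})" for e
  proof -
    have "e \<subseteq> span R"
      using e(2) by (auto simp: span_def)
    then obtain s where s: "s \<in> R" "e \<subseteq> bag s"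
      using cover e(1) by blast
    show ?thesis
    proof (cases "s = t")
      case True
      \<comment> \<open>Each vertex of this edge also occurs in another remaining bag, hence in that
        of p. As the edge is not empty, p is not the dummy node and takes over as the covering
        bag.\<close>
      have "e \<subseteq> bag p"
        using e(2) s(2) below True by (fastforce simp: span_def)
      moreover have "e \<noteq> {}"
        using e(1) empty_notin_E by blast
      ultimately have "p \<noteq> N"
        by (metis bag_N subset_empty)
      with p \<open>e \<subseteq> bag p\<close> show ?thesis
        by blast
    qed (use s in auto)
  qed
  moreover have "\<tau> ''M'' (int c + (int N + 1) * int (code k (bag c \<inter> bag ((par(t := p)) c)) \<rho> n))
      = (M(t := message R par M t p)) c \<rho> mod modulus"
    if c: "c < N" "c \<notin> R - {t}" "\<rho> \<in> bag c \<inter> bag ((par(t := p)) c) \<rightarrow>\<^sub>E {..<k}" for c \<rho>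
  proof (cases "c = t")
    case True
    then show ?thesis
      using new c(3) by simp
  next
    case False
    then show ?thesis
      using c old[of c] state by (simp add: dp_state_def)
  qed
  moreover have "\<tau> ''M'' (int c + (int N + 1) * int h) = 0" if "c \<in> insert N (R - {t})" for c h
    using that t R old[of c h] state by (auto simp: dp_state_def)
  moreover have "\<tau> ''par'' (int c) = (if c \<in> R - {t} then 0 else int ((par(t := p)) c) + 1)" if "c < N" for c
    using that state t by (simp add: par dp_state_def)
  ultimately show ?thesis
    using state R unfolding dp_state_def by (simp add: subset_iff)
qed

lemma ok_main_loop:
  assumes env: "env \<sigma>" and state: "dp_state {..<N} par M \<sigma>"
    and final: "\<And>\<tau> par M. agree {''r'', ''u'', ''d'', ''q'', ''s'', ''t'', ''p'', ''z'', ''g'', ''v'', ''x'',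
        ''c'', ''h'', ''M'', ''par'', ''K'', ''i''} \<sigma> \<tau> \<Longrightarrow> dp_state {} par M \<tau> \<Longrightarrow> Q \<tau>"
  shows "ok (For ''r'' (Var ''N'') (Seq leaf_prog node_prog)) \<sigma> Q"
proof -
  let ?A = "{''r'', ''u'', ''d'', ''q'', ''s'', ''t'', ''p'', ''z'', ''g'', ''v'', ''x'',
        ''c'', ''h'', ''M'', ''par'', ''K'', ''i''}"
  \<comment> \<open>Remaining nodes, parents and tables are existential: which leaf goes is decided
    during the run, and only the number of remaining nodes is known in advance.\<close>
  let ?I = "\<lambda>m \<tau>. agree ?A \<sigma> \<tau> \<and> (\<exists>R par M. card R = N - m \<and> dp_state R par M \<tau>)"
  have state_upd: "dp_state R par M (set_var \<tau> ''r'' i) \<longleftrightarrow> dp_state R par M \<tau>" for R par M \<tau> i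
    by (simp add: dp_state_def)
  show ?thesis
  proof (rule ok_For[of N _ _ ?I])
    fix m \<tau> assume m: "m < N" and I: "?I m \<tau>" and r: "\<tau> ''r'' 0 = int m"
    then obtain R par M where card: "card R = N - m" and st: "dp_state R par M \<tau>"
      by blast
    have env': "env \<tau>"
      using env conjunct1[OF I] by (rule env_agree) (auto simp: env_names_def)
    have R: "R \<subseteq> {..<N}" "R \<noteq> {}"
      using st card m by (auto simp: dp_state_def)
    have par: "\<tau> ''par'' (int c) = (if c \<in> R then 0 else int (par c) + 1)" if "c < N" for c
      using st that by (simp add: dp_state_def)
    show "ok (Seq leaf_prog node_prog) \<tau>
        (\<lambda>\<tau>'. \<tau>' ''r'' 0 = int m \<and> ?I (Suc m) (set_var \<tau>' ''r'' (int (Suc m))))"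
    proof (rule ok_Seq, rule ok_leaf_prog[OF env' R par])
      fix \<tau>1 t p assume \<tau>1: "agree {''u'', ''d'', ''q'', ''s'', ''t'', ''p''} \<tau> \<tau>1"
        and leaf: "is_leaf F R N t p" and tp: "\<tau>1 ''t'' 0 = int t" "\<tau>1 ''p'' 0 = int p"
      have env1: "env \<tau>1"
        using env' \<tau>1 by (rule env_agree) (auto simp: env_names_def)
      have st1: "dp_state R par M \<tau>1"
        using st by (simp add: dp_state_def agreeD[OF \<tau>1])
      have t: "t \<in> R" "t < N" and p: "p \<le> N" "p \<noteq> t"
        using leaf R no_loop_F[of t] by (auto simp: is_leaf_def neighbours_def)
      show "ok node_prog \<tau>1 (\<lambda>\<tau>'. \<tau>' ''r'' 0 = int m \<and> ?I (Suc m) (set_var \<tau>' ''r'' (int (Suc m))))"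
      proof (rule ok_node_prog[OF env1 tp _ p(1), where R = R and par = par and M = M])
        fix \<tau>' assume \<tau>': "agree {''z'', ''g'', ''v'', ''u'', ''x'', ''c'', ''h'', ''M'', ''par'', ''K'', ''i''} \<tau>1 \<tau>'"
          "\<tau>' ''par'' = (\<tau>1 ''par'')(int t := int p + 1)"
          "\<And>\<rho>. \<rho> \<in> bag t \<inter> bag p \<rightarrow>\<^sub>E {..<k} \<Longrightarrow>
            \<tau>' ''M'' (int t + (int N + 1) * int (code k (bag t \<inter> bag p) \<rho> n)) = message R par M t p \<rho> mod modulus"
          "\<And>c h. c \<le> N \<Longrightarrow> c \<noteq> t \<Longrightarrow>
            \<tau>' ''M'' (int c + (int N + 1) * int h) = \<tau>1 ''M'' (int c + (int N + 1) * int h)"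
        have "agree ?A \<sigma> \<tau>1"
          using conjunct1[OF I] \<tau>1 by (rule agree_trans) auto
        then have "agree ?A \<sigma> \<tau>'"
          using \<tau>'(1) by (rule agree_trans) auto
        moreover have "dp_state (R - {t}) (par(t := p)) (M(t := message R par M t p)) \<tau>'"
          by (rule dp_state_step[OF st1 leaf \<tau>'(2-4)])
        moreover have "card (R - {t}) = N - Suc m"
          using card t finite_subset[OF R(1)] by simp
        ultimately show "\<tau>' ''r'' 0 = int m \<and> ?I (Suc m) (set_var \<tau>' ''r'' (int (Suc m)))"
          using r by (auto simp: state_upd agreeD[OF \<tau>'(1)] agreeD[OF \<tau>1])
      qed (use st1 t p in \<open>auto simp: dp_state_def\<close>)
    qed
  next
    fix m \<tau> assume I: "?I m \<tau>"
    show "aval (Var ''N'') \<tau> = int N"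
      by (simp add: agreeD[OF conjunct1[OF I]] env_simps[OF env])
  next
    fix \<tau> assume I: "?I N \<tau>"
    then obtain R par M where "card R = 0" "dp_state R par M \<tau>"
      by auto
    moreover from this have "R = {}"
      by (auto simp: dp_state_def dest: finite_subset)
    ultimately show "Q \<tau>"
      using I final by blast
  next
    show "int N \<le> 2 ^ L"
      using cap_N by linarith
    show "?I 0 (set_var \<sigma> ''r'' 0)"
      using state by (auto simp: state_upd intro!: exI[of _ "{..<N}"])
  qed (simp add: count_N table_guard_def)
qed

section \<open>Initialisation\<close>

definition inputs :: "store \<Rightarrow> bool" where
  "inputs \<sigma> \<longleftrightarrow> \<sigma> ''n'' 0 = int n \<and> \<sigma> ''N'' 0 = int N \<and>
     (\<forall>u<n. \<forall>v<n. \<sigma> ''graph'' (int u * int n + int v) = of_bool ({u, v} \<in> E)) \<and>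
     (\<forall>t<N. \<forall>s<N. \<sigma> ''tree'' (int t * int N + int s) = of_bool ({t, s} \<in> F)) \<and>
     (\<forall>t\<le>N. \<forall>v<n. \<sigma> ''bag'' (int t * int n + int v) = of_bool (v \<in> bag t))"

lemma ok_seq_upto:
  assumes "I 0 \<sigma>" and "\<And>i \<tau>. i < m \<Longrightarrow> I i \<tau> \<Longrightarrow> ok (f i) \<tau> (I (Suc i))"
  shows "ok (seq_upto f m) \<sigma> (I m)"
  using assms(2)
proof (induction m)
  case 0
  then show ?case
    using assms(1) by (simp add: ok_Skip)
next
  case (Suc m)
  have "ok (seq_upto f m) \<sigma> (\<lambda>\<tau>. ok (f m) \<tau> (I (Suc m)))"
    by (rule ok_mono[OF Suc.IH]) (use Suc.prems in simp_all)
  then show ?case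
    by (simp add: ok_Seq)
qed

lemma abs_le_cap: "0 \<le> i \<Longrightarrow> i \<le> modulus \<Longrightarrow> \<bar>i\<bar> \<le> 2 ^ L"
  using modulus_le_cap by linarith

lemma ok_weights_prog:
  assumes \<sigma>: "\<sigma> ''Q'' 0 = modulus" "\<sigma> ''eps'' 0 = eps"
    and final: "\<And>\<tau>. agree {''C'', ''b''} \<sigma> \<tau> \<Longrightarrow>
      \<forall>i<k. \<tau> ''C'' (int i) = weight eps i mod modulus \<Longrightarrow> \<forall>i<k. \<tau> ''b'' (int i) = point eps i \<Longrightarrow> Q \<tau>"
  shows "ok weights_prog \<sigma> Q"
  unfolding weights_prog_def
proof -
  let ?I = "\<lambda>m \<tau>. agree {''C'', ''b''} \<sigma> \<tau> \<and> (\<forall>i<m. \<tau> ''C'' (int i) = weight eps i mod modulus) \<and>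
    (\<forall>i<m. \<tau> ''b'' (int i) = point eps i)"
  let ?f = "\<lambda>i. Seq (Write ''C'' (Const (int i)) (remainder (weight_exp i)))
     (Write ''b'' (Const (int i)) (point_exp i))"
  \<comment> \<open>The points are stored unreduced; this is what the factor k in
    \<open>cap_modulus\<close> is for.\<close>
  have point: "\<bar>point eps i\<bar> \<le> 2 ^ L" if "i < k" for i
  proof -
    have "int i * eps \<le> int k * modulus"
      using that eps_le_modulus eps_ge by (intro mult_mono) auto
    then have "int i * eps \<le> 2 ^ L"
      using cap_modulus by linarith
    then show ?thesis
      using eps_ge by (simp add: point_def)
  qed
  have "ok (seq_upto ?f k) \<sigma> (?I k)"
  proof (rule ok_seq_upto[where I = ?I])
    fix i \<tau> assume i: "i < k" and I: "?I i \<tau>"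
    have \<tau>: "\<tau> ''Q'' 0 = modulus" "\<tau> ''eps'' 0 = eps"
      using \<sigma> by (simp_all add: agreeD[OF conjunct1[OF I]])
    show "ok (?f i) \<tau> (?I (Suc i))"
    proof (intro ok_Seq ok_Write)
      show "\<bar>aval (remainder (weight_exp i)) \<tau>\<bar> \<le> 2 ^ L"
        by (simp add: \<tau> abs_mod_le_cap)
    qed (use I i in \<open>simp_all add: aval_point_exp aval_weight_exp \<tau> point less_Suc_eq\<close>)
  qed simp
  then show "ok (seq_upto ?f k) \<sigma> Q"
    by (rule ok_mono) (use final in blast)
qed

lemma ok_constants_prog:
  assumes inputs: "inputs \<sigma>"
    and final: "\<And>\<tau>. agree {''a'', ''y'', ''Dn'', ''eps'', ''P'', ''Q'', ''C'', ''b''} \<sigma> \<tau> \<Longrightarrow> env \<tau> \<Longrightarrow> Q \<tau>"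
  shows "ok constants_prog \<sigma> Q"
  unfolding constants_prog_def
proof -
  let ?A = "{''a'', ''y'', ''Dn'', ''eps'', ''P'', ''Q'', ''C'', ''b''}"
  let ?c9 = weights_prog
  let ?c8 = "Seq (Assign ''Q'' (Mul (Var ''P'') (Var ''eps''))) ?c9"
  let ?c7 = "Seq (For ''a'' (Var ''n'') (Assign ''P'' (Mul (Var ''P'') (power_exp (Var ''eps'') K)))) ?c8"
  let ?c6 = "Seq (Assign ''P'' (Const 1)) ?c7"
  let ?c5 = "Seq (For ''a'' (Add square_n (Const 1)) (Assign ''eps'' (Mul (Var ''eps'') (Var ''y'')))) ?c6"
  let ?c4 = "Seq (Assign ''eps'' (Var ''Dn'')) ?c5"
  let ?c3 = "Seq (For ''a'' (Var ''n'') (Assign ''Dn'' (Mul (Var ''Dn'') (Const D)))) ?c4"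
  let ?c2 = "Seq (Assign ''Dn'' (Const 1)) ?c3"
  let ?c1 = "Seq (For ''a'' square_n (Assign ''y'' (Mul (Var ''y'') (Const 2)))) ?c2"
  have n: "\<tau> ''n'' 0 = int n" if "agree ?A \<sigma> \<tau>" for \<tau>
    using inputs by (simp add: agreeD[OF that] inputs_def)
  have D_pow: "1 \<le> D ^ i" "i \<le> n \<Longrightarrow> D ^ i \<le> D ^ n" for i
    using D_pos by (auto intro: one_le_power power_increasing)
  have base_pow: "1 \<le> base ^ i" "i \<le> n * n + 1 \<Longrightarrow> base ^ i \<le> base ^ (n * n + 1)" for i
    using base_ge by (auto intro: one_le_power power_increasing simp del: power_Suc)
  have D_le: "D ^ n \<le> eps"
    using mult_left_mono[OF base_pow(1)[of "n * n + 1"], of "D ^ n"] D_pow(1)[of n]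
    by (simp add: eps_def del: power_Suc)
  have c9: "ok ?c9 \<tau> Q" if A: "agree ?A \<sigma> \<tau>" and "\<tau> ''y'' 0 = base" "\<tau> ''Dn'' 0 = D ^ n"
    "\<tau> ''eps'' 0 = eps" "\<tau> ''P'' 0 = shift" "\<tau> ''Q'' 0 = modulus" for \<tau>
  proof (rule ok_weights_prog)
    fix \<tau>' assume \<tau>': "agree {''C'', ''b''} \<tau> \<tau>'"
      "\<forall>i<k. \<tau>' ''C'' (int i) = weight eps i mod modulus" "\<forall>i<k. \<tau>' ''b'' (int i) = point eps i"
    have "agree ?A \<sigma> \<tau>'"
      using A \<tau>'(1) by (rule agree_trans) auto
    moreover from this have "env \<tau>'"
      using inputs \<tau>'(2,3) that(2-) by (simp add: env_def inputs_def agreeD agreeD[OF \<tau>'(1)] agreeD[OF A])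
    ultimately show "Q \<tau>'"
      by (rule final)
  qed (use that in simp_all)
  have c8: "ok ?c8 \<tau> Q" if A: "agree ?A \<sigma> \<tau>" and "\<tau> ''y'' 0 = base" "\<tau> ''Dn'' 0 = D ^ n"
    "\<tau> ''eps'' 0 = eps" "\<tau> ''P'' 0 = shift" for \<tau>
  proof (intro ok_Seq ok_Assign)
    have val: "aval (Mul (Var ''P'') (Var ''eps'')) \<tau> = modulus"
      using that by (simp add: modulus_def)
    show "\<bar>aval (Mul (Var ''P'') (Var ''eps'')) \<tau>\<bar> \<le> 2 ^ L"
      unfolding val using modulus_ge by (intro abs_le_cap) auto
    show "ok ?c9 (set_var \<tau> ''Q'' (aval (Mul (Var ''P'') (Var ''eps'')) \<tau>)) Q"
      unfolding val using that by (intro c9) simp_all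
  qed
  have c7: "ok ?c7 \<tau> Q" if A: "agree ?A \<sigma> \<tau>" and "\<tau> ''y'' 0 = base" "\<tau> ''Dn'' 0 = D ^ n"
    "\<tau> ''eps'' 0 = eps" "\<tau> ''P'' 0 = 1" for \<tau>
  proof (rule ok_Seq, rule ok_power[where m = n and w = "eps ^ K"])
    fix i assume i: "i \<le> n"
    have "(eps ^ K) ^ i \<le> shift"
      unfolding shift_def power_mult using i eps_ge by (intro power_increasing one_le_power) auto
    then show "\<bar>\<tau> ''P'' 0 * (eps ^ K) ^ i\<bar> \<le> 2 ^ L"
      using that eps_ge shift_le_modulus by (intro abs_le_cap) auto
  next
    show "ok ?c8 (set_var (set_var \<tau> ''a'' (int n)) ''P'' (\<tau> ''P'' 0 * (eps ^ K) ^ n)) Q"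
      using that by (intro c8) (simp_all add: shift_def power_mult)
  qed (use that n[OF A] cap_n in \<open>simp_all add: count_n table_guard_def\<close>)
  have c6: "ok ?c6 \<tau> Q" if A: "agree ?A \<sigma> \<tau>" and "\<tau> ''y'' 0 = base" "\<tau> ''Dn'' 0 = D ^ n"
    "\<tau> ''eps'' 0 = eps" for \<tau>
  proof (rule ok_Seq, rule ok_Assign)
    show "ok ?c7 (set_var \<tau> ''P'' (aval (Const 1) \<tau>)) Q"
      using that by (intro c7) simp_all
  qed simp
  have c5: "ok ?c5 \<tau> Q" if A: "agree ?A \<sigma> \<tau>" and "\<tau> ''y'' 0 = base" "\<tau> ''Dn'' 0 = D ^ n"
    "\<tau> ''eps'' 0 = D ^ n" for \<tau>
  proof (rule ok_Seq, rule ok_power[where m = "n * n + 1" and w = base])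
    fix i assume i: "i \<le> n * n + 1"
    have "D ^ n * base ^ i \<le> eps"
      unfolding eps_def using base_pow(2)[OF i] D_pow(1)[of n] by (intro mult_left_mono) auto
    then show "\<bar>\<tau> ''eps'' 0 * base ^ i\<bar> \<le> 2 ^ L"
      using that eps_le_modulus D_pow(1)[of n] base_pow(1)[of i] by (intro abs_le_cap) auto
  next
    show "ok ?c6 (set_var (set_var \<tau> ''a'' (int (n * n + 1))) ''eps'' (\<tau> ''eps'' 0 * base ^ (n * n + 1))) Q"
      using that by (intro c6) (simp_all add: eps_def)
  next
    show "n * n + 1 \<le> \<nu> (Sub (Add square_n (Const 1)) (Var ''a''))"
      by (rule count_square) (simp add: table_guard_def)
    show "int (n * n + 1) \<le> 2 ^ L"
      by (rule cap_square)
  qed (use that n[OF A] in \<open>simp_all add: square_n_def\<close>)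
  have c4: "ok ?c4 \<tau> Q" if A: "agree ?A \<sigma> \<tau>" and "\<tau> ''y'' 0 = base" "\<tau> ''Dn'' 0 = D ^ n" for \<tau>
  proof (rule ok_Seq, rule ok_Assign)
    show "\<bar>aval (Var ''Dn'') \<tau>\<bar> \<le> 2 ^ L"
      using that D_le D_pow(1)[of n] eps_le_modulus by (intro abs_le_cap) auto
    show "ok ?c5 (set_var \<tau> ''eps'' (aval (Var ''Dn'') \<tau>)) Q"
      using that by (intro c5) simp_all
  qed
  have c3: "ok ?c3 \<tau> Q" if A: "agree ?A \<sigma> \<tau>" and "\<tau> ''y'' 0 = base" "\<tau> ''Dn'' 0 = 1" for \<tau>
  proof (rule ok_Seq, rule ok_power[where m = n and w = D])
    fix i assume i: "i \<le> n"
    show "\<bar>\<tau> ''Dn'' 0 * D ^ i\<bar> \<le> 2 ^ L"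
      using that D_le D_pow(1)[of i] D_pow(2)[OF i] eps_le_modulus by (intro abs_le_cap) auto
  next
    show "ok ?c4 (set_var (set_var \<tau> ''a'' (int n)) ''Dn'' (\<tau> ''Dn'' 0 * D ^ n)) Q"
      using that by (intro c4) simp_all
  qed (use that n[OF A] cap_n in \<open>simp_all add: count_n table_guard_def\<close>)
  have c2: "ok ?c2 \<tau> Q" if A: "agree ?A \<sigma> \<tau>" and "\<tau> ''y'' 0 = base" for \<tau>
  proof (rule ok_Seq, rule ok_Assign)
    show "ok ?c3 (set_var \<tau> ''Dn'' (aval (Const 1) \<tau>)) Q"
      using that by (intro c3) simp_all
  qed simp
  have c1: "ok ?c1 \<tau> Q" if A: "agree ?A \<sigma> \<tau>" and "\<tau> ''y'' 0 = 2" for \<tau>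
  proof (rule ok_Seq, rule ok_power[where m = "n * n" and w = 2])
    fix i assume i: "i \<le> n * n"
    have "(2::int) ^ Suc i \<le> base"
      unfolding base_def using i by (intro power_increasing) auto
    then show "\<bar>\<tau> ''y'' 0 * 2 ^ i\<bar> \<le> 2 ^ L"
      using that base_le_eps eps_le_modulus by (intro abs_le_cap) auto
  next
    show "ok ?c2 (set_var (set_var \<tau> ''a'' (int (n * n))) ''y'' (\<tau> ''y'' 0 * 2 ^ (n * n))) Q"
      using that by (intro c2) (simp_all add: base_def)
  next
    show "n * n \<le> \<nu> (Sub square_n (Var ''a''))"
      using count_square[of "Sub square_n (Var ''a'')"] by (simp add: table_guard_def square_n_def)
    show "int (n * n) \<le> 2 ^ L"
      using cap_square by linarith
  qed (use that n[OF A] in \<open>simp_all add: square_n_def\<close>)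
  show "ok (Seq (Assign ''y'' (Const 2)) ?c1) \<sigma> Q"
  proof (rule ok_Seq, rule ok_Assign)
    show "\<bar>aval (Const 2) \<sigma>\<bar> \<le> 2 ^ L"
      using modulus_ge by (intro abs_le_cap) auto
    show "ok ?c1 (set_var \<sigma> ''y'' (aval (Const 2) \<sigma>)) Q"
      by (intro c1) simp_all
  qed
qed

section \<open>Extracting the counts from the residue\<close>

definition solution_count :: "nat \<Rightarrow> int" where
  "solution_count s = int (card {S. antifactor_solution X {..<n} E S \<and> card S = s})"

lemma card_E: "card E \<le> n * n"
proof -
  have "E \<subseteq> (\<lambda>(u, v). {u, v}) ` ({..<n} \<times> {..<n})"
  proof
    fix e assume "e \<in> E"
    then have "e \<subseteq> {..<n}" "card e = 2"
      using simple by (auto simp: simple_graph_def)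
    then show "e \<in> (\<lambda>(u, v). {u, v}) ` ({..<n} \<times> {..<n})"
      by (auto simp: card_2_iff image_iff)
  qed
  then have "card E \<le> card ({..<n} \<times> {..<n})"
    by (rule surj_card_le[rotated]) simp
  then show ?thesis
    by (simp add: card_cartesian_product)
qed

lemma solutions_subset: "{S. antifactor_solution X {..<n} E S} \<subseteq> Pow E"
  by (auto simp: antifactor_solution_def)

lemma finite_solutions: "finite {S. antifactor_solution X {..<n} E S}"
  using solutions_subset finite_E finite_subset by blast

text \<open>Even all edge sets together number less than \<open>base\<close>, so the counts are
  genuine digits and no carries occur.\<close>

lemma solution_count_less: "solution_count s < base"
proof -
  have "card {S. antifactor_solution X {..<n} E S \<and> card S = s} \<le> card (Pow E)"
    using finite_E by (intro card_mono) (auto simp: antifactor_solution_def)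
  also have "\<dots> = 2 ^ card E"
    using finite_E by (rule card_Pow)
  also have "\<dots> < 2 ^ (n * n + 1)"
    using card_E by (intro power_strict_increasing) auto
  finally have "int (card {S. antifactor_solution X {..<n} E S \<and> card S = s}) < int (2 ^ (n * n + 1))"
    by (simp only: of_nat_less_iff)
  then show ?thesis
    by (simp add: solution_count_def base_def)
qed

text \<open>Grouping by size turns the sum over solutions into a number whose digits are the counts;
  no solution has more than n^2 edges.\<close>

lemma solution_sum_digits: "solution_sum base n E = (\<Sum>s<n * n + 1. solution_count s * base ^ s)"
proof -
  let ?S = "{S. antifactor_solution X {..<n} E S}"
  have "card S < n * n + 1" if "S \<in> ?S" for S
    using that card_E card_mono[OF finite_E, of S] by (auto simp: antifactor_solution_def)
  then have "solution_sum base n E = (\<Sum>s<n * n + 1. \<Sum>S | S \<in> ?S \<and> card S = s. base ^ card S)"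
    unfolding solution_sum_def
    by (intro sum.group[symmetric]) (auto simp: finite_solutions)
  also have "\<dots> = (\<Sum>s<n * n + 1. solution_count s * base ^ s)"
    by (rule sum.cong) (simp_all add: solution_count_def)
  finally show ?thesis .
qed

text \<open>The leading coefficient is nonnegative and below \<open>eps\<close>, so it is its own
  residue modulo \<open>eps\<close>, while the unknown higher-order part \<open>eps * r\<close>
  vanishes.\<close>

lemma partition_function_mod: "partition_function base eps n E mod modulus = shift * (D ^ n * solution_sum base n E)"
  and solution_sum_bounds: "0 \<le> solution_sum base n E" "solution_sum base n E < eps"
proof -
  let ?Z = "solution_sum base n E"
  show nonneg: "0 \<le> ?Z"
    unfolding solution_sum_def using base_ge by (intro sum_nonneg) auto
  have "?Z < base ^ (n * n + 1)"
    unfolding solution_sum_digits using base_ge by (intro sum_digits_less solution_count_less) auto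
  then have less: "D ^ n * ?Z < eps"
    unfolding eps_def using D_pos by (intro mult_strict_left_mono) auto
  have "1 * ?Z \<le> D ^ n * ?Z"
    using D_pos nonneg by (intro mult_right_mono one_le_power) auto
  with less show "?Z < eps"
    by linarith
  have "\<And>e. e \<in> E \<Longrightarrow> e \<subseteq> {..<n}"
    using simple by (auto simp: simple_graph_def)
  then obtain r where "partition_function base eps n E = shift * (D ^ n * ?Z + eps * r)"
    using partition_function_eq[OF finite_E] unfolding shift_def by blast
  then have "partition_function base eps n E mod modulus = shift * ((D ^ n * ?Z + eps * r) mod eps)"
    by (simp only: modulus_def mult_mod_right)
  also have "(D ^ n * ?Z + eps * r) mod eps = D ^ n * ?Z"
    using less nonneg D_pos by simp
  finally show "partition_function base eps n E mod modulus = shift * (D ^ n * ?Z)" .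
qed

lemma ok_output_prog:
  assumes env: "env \<sigma>" and M: "\<sigma> ''M'' (int N) = partition_function base eps n E mod modulus"
    and out: "\<sigma> ''out'' = (\<lambda>_. 0)"
  shows "ok output_prog \<sigma> (\<lambda>\<tau>. \<forall>s::int. \<tau> ''out'' s =
    int (card {S. antifactor_solution X {..<n} E S \<and> int (card S) = s}))"
  unfolding output_prog_def
proof -
  let ?Z = "solution_sum base n E"
  let ?body = "Seq (Write ''out'' (Var ''s'') (Sub (Var ''ans'') (Mul (Var ''y'') (Div (Var ''ans'') (Var ''y'')))))
                (Assign ''ans'' (Div (Var ''ans'') (Var ''y'')))"
  let ?I = "\<lambda>m \<tau>. agree {''ans'', ''s'', ''out''} \<sigma> \<tau> \<and> \<tau> ''ans'' 0 = ?Z div base ^ m \<and>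
    \<tau> ''out'' = (\<lambda>i. if 0 \<le> i \<and> i < int m then solution_count (nat i) else 0)"
  have Z_div: "\<bar>?Z div base ^ m\<bar> \<le> 2 ^ L" for m
  proof -
    have "?Z div base ^ m \<le> ?Z div 1"
      using solution_sum_bounds(1) base_ge by (intro zdiv_mono2 one_le_power) auto
    moreover have "0 \<le> ?Z div base ^ m"
      using solution_sum_bounds(1) base_ge by (simp add: pos_imp_zdiv_nonneg_iff)
    ultimately show ?thesis
      using solution_sum_bounds eps_le_modulus by (intro abs_le_cap) auto
  qed
  have val: "aval (Div (Div (Read ''M'' (Var ''N'')) (Var ''P'')) (Var ''Dn'')) \<sigma> = ?Z"
    using shift_pos D_pos by (simp add: env_simps[OF env] M partition_function_mod)
  show "ok (Seq (Assign ''ans'' (Div (Div (Read ''M'' (Var ''N'')) (Var ''P'')) (Var ''Dn'')))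
      (For ''s'' (Add square_n (Const 1)) ?body)) \<sigma> (\<lambda>\<tau>. \<forall>s::int. \<tau> ''out'' s =
        int (card {S. antifactor_solution X {..<n} E S \<and> int (card S) = s}))" (is "ok _ _ ?Q")
  proof (rule ok_Seq, rule ok_Assign)
    show "\<bar>aval (Div (Div (Read ''M'' (Var ''N'')) (Var ''P'')) (Var ''Dn'')) \<sigma>\<bar> \<le> 2 ^ L"
      unfolding val using Z_div[of 0] by simp
    show "ok (For ''s'' (Add square_n (Const 1)) ?body)
        (set_var \<sigma> ''ans'' (aval (Div (Div (Read ''M'' (Var ''N'')) (Var ''P'')) (Var ''Dn'')) \<sigma>)) ?Q"
      unfolding val
    proof (rule ok_For[of "n * n + 1" _ _ ?I])
      show "n * n + 1 \<le> \<nu> (Sub (Add square_n (Const 1)) (Var ''s''))"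
        by (rule count_square) (simp add: table_guard_def)
      show "int (n * n + 1) \<le> 2 ^ L"
        by (rule cap_square)
      show "?I 0 (set_var (set_var \<sigma> ''ans'' ?Z) ''s'' 0)"
        using out by (simp add: fun_eq_iff)
    next
      fix m \<tau> assume I: "?I m \<tau>"
      show "aval (Add square_n (Const 1)) \<tau> = int (n * n + 1)"
        by (simp add: square_n_def agreeD[OF conjunct1[OF I]] env_simps[OF env])
    next
      fix m \<tau> assume m: "m < n * n + 1" and I: "?I m \<tau>" and s: "\<tau> ''s'' 0 = int m"
      have y: "\<tau> ''y'' 0 = base"
        by (simp add: agreeD[OF conjunct1[OF I]] env_simps[OF env])
      have "aval (Sub (Var ''ans'') (Mul (Var ''y'') (Div (Var ''ans'') (Var ''y'')))) \<tau> = ?Z div base ^ m mod base"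
        using I y by (simp add: minus_mult_div_eq_mod)
      also have "\<dots> = solution_count m"
        unfolding solution_sum_digits
        by (rule digit_of_sum) (use m solution_count_less in \<open>auto simp: solution_count_def\<close>)
      finally have digit: "aval (Sub (Var ''ans'') (Mul (Var ''y'') (Div (Var ''ans'') (Var ''y'')))) \<tau>
          = solution_count m" .
      have next_ans: "\<tau> ''ans'' 0 div base = ?Z div base ^ Suc m"
        using I base_ge by (simp add: zdiv_zmult2_eq power_Suc2 del: power_Suc)
      show "ok ?body \<tau> (\<lambda>\<tau>'. \<tau>' ''s'' 0 = int m \<and> ?I (Suc m) (set_var \<tau>' ''s'' (int (Suc m))))"
      proof (rule ok_Seq, rule ok_Write, unfold digit, goal_cases)
        case 1
        have "\<bar>solution_count m\<bar> \<le> modulus"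
          using solution_count_less[of m] base_le_eps eps_le_modulus by (simp add: solution_count_def)
        then show ?case
          using modulus_le_cap by linarith
      next
        case 2
        have "?I (Suc m) (set_var (set_var (\<tau>(''out'' := (\<tau> ''out'')(int m := solution_count m))) ''ans''
            (?Z div base ^ Suc m)) ''s'' (int (Suc m)))"
          using I by (auto simp: fun_eq_iff simp del: power_Suc)
        then show ?case
          using s y next_ans Z_div[of "Suc m"] by (intro ok_Assign) (simp_all del: power_Suc)
      qed
    next
      fix \<tau> assume I: "?I (n * n + 1) \<tau>"
      show "?Q \<tau>"
      proof
        fix s :: int
        show "\<tau> ''out'' s = int (card {S. antifactor_solution X {..<n} E S \<and> int (card S) = s})"
        proof (cases "0 \<le> s \<and> s < int (n * n + 1)")
          case True
          then have "int (card S) = s \<longleftrightarrow> card S = nat s" for S :: "nat set set"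
            by auto
          then show ?thesis
            using I True by (simp add: solution_count_def)
        next
          case False
          have "int (card S) < int (n * n + 1)" if "antifactor_solution X {..<n} E S" for S
          proof -
            have "card S \<le> card E"
              using that finite_E by (intro card_mono) (auto simp: antifactor_solution_def)
            then have "card S < n * n + 1"
              using card_E by linarith
            then show ?thesis
              by (simp only: of_nat_less_iff)
          qed
          then have empty: "{S. antifactor_solution X {..<n} E S \<and> int (card S) = s} = {}"
            using False by force
          have "\<tau> ''out'' s = 0"
            using I False by auto
          then show ?thesis
            unfolding empty by simp
        qed
      qed
    qed
  qed
qed

text \<open>Every vertex lies in a bag by the nonemptiness in \<open>connected_in\<close>, so the
  span is the whole vertex set, isolated vertices included, and \<open>remaining\<close> is the full
  partition function.\<close>

lemma dp_state_initial:
  assumes "\<sigma> ''par'' = (\<lambda>_. 0)" "\<sigma> ''M'' = (\<lambda>_. 0)"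
  shows "dp_state {..<N} par M \<sigma>"
proof -
  have tree: "\<forall>e\<in>E. \<exists>t\<in>{..<N}. e \<subseteq> B t" "\<forall>v\<in>{..<n}. connected_in F {t \<in> {..<N}. v \<in> B t}"
    using decomposition by (simp_all add: tree_decomposition_def)
  have bag: "bag t = B t" if "t < N" for t
    using that by (simp add: ext_bag_def)
  have "{..<n} \<subseteq> span {..<N}"
  proof
    fix v assume "v \<in> {..<n}"
    then have "{t \<in> {..<N}. v \<in> B t} \<noteq> {}"
      using tree(2) unfolding connected_in_def by blast
    then show "v \<in> span {..<N}"
      using bag by (auto simp: span_def)
  qed
  then have span: "span {..<N} = {..<n}"
    using span_subset by blast
  have "{e. e \<in> E \<and> e \<subseteq> {..<n}} = E"
    using simple by (auto simp: simple_graph_def)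
  then have "remaining {..<N} par M = partition_function base eps n E"
    by (simp add: remaining_def partition_function_def span flip: k_def)
  moreover have "linked F {r \<in> {..<N}. v \<in> bag r}" for v
  proof (cases "v < n")
    case True
    have "{r \<in> {..<N}. v \<in> bag r} = {t \<in> {..<N}. v \<in> B t}"
      using bag by auto
    then show ?thesis
      using tree(2) True by (simp add: connected_in_def linked_def)
  next
    case False
    then have "{r \<in> {..<N}. v \<in> bag r} = {}"
      using bag_subset by auto
    then show ?thesis
      by (simp only:) (simp add: linked_def)
  qed
  moreover have "\<exists>s\<in>{..<N}. e \<subseteq> bag s" if "e \<in> E" for e
    using tree(1) that bag by fastforce
  ultimately show ?thesis
    using assms by (simp add: dp_state_def)
qed

lemma ok_antifactor_prog:
  assumes inputs: "inputs \<sigma>" and zero: "\<sigma> ''par'' = (\<lambda>_. 0)" "\<sigma> ''M'' = (\<lambda>_. 0)" "\<sigma> ''out'' = (\<lambda>_. 0)"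
  shows "ok antifactor_prog \<sigma> (\<lambda>\<tau>. \<forall>s::int. \<tau> ''out'' s =
    int (card {S. antifactor_solution X {..<n} E S \<and> int (card S) = s}))" (is "ok _ _ ?Q")
  unfolding antifactor_prog_def
proof (rule ok_Seq, rule ok_constants_prog[OF inputs])
  fix \<tau>1 assume \<tau>1: "agree {''a'', ''y'', ''Dn'', ''eps'', ''P'', ''Q'', ''C'', ''b''} \<sigma> \<tau>1" and env1: "env \<tau>1"
  let ?c2 = "Seq node_prog output_prog"
  let ?c1 = "Seq (Assign ''t'' (Var ''N'')) (Seq (Assign ''p'' (Var ''N'')) ?c2)"
  have "dp_state {..<N} (\<lambda>_. 0) (\<lambda>_ _. 0) \<tau>1"
    using zero by (intro dp_state_initial) (simp_all add: agreeD[OF \<tau>1])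
  then show "ok (Seq (For ''r'' (Var ''N'') (Seq leaf_prog node_prog)) ?c1) \<tau>1 ?Q"
  proof (intro ok_Seq[of "For _ _ _"], rule ok_main_loop[OF env1])
    fix \<tau>2 par M assume \<tau>2: "agree {''r'', ''u'', ''d'', ''q'', ''s'', ''t'', ''p'', ''z'', ''g'', ''v'', ''x'',
        ''c'', ''h'', ''M'', ''par'', ''K'', ''i''} \<tau>1 \<tau>2" and state: "dp_state {} par M \<tau>2"
    have env2: "env \<tau>2"
      using env1 \<tau>2 by (rule env_agree) (auto simp: env_names_def)
    let ?\<tau> = "set_var (set_var \<tau>2 ''t'' (int N)) ''p'' (int N)"
    have env: "env ?\<tau>"
      using env2 by (intro env_set_var) (auto simp: env_names_def)
    have capN: "int N \<le> 2 ^ L"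
      using cap_N by linarith
    \<comment> \<open>The dummy node is processed with itself as parent. Its overlap is empty, the
      only table index is 0, and the result lands at address N.\<close>
    have "ok ?c2 ?\<tau> ?Q"
    proof (rule ok_Seq, rule ok_node_prog[OF env, where t = N and p = N and R = "{}" and par = par and M = M])
      fix \<tau>3 assume \<tau>3: "agree {''z'', ''g'', ''v'', ''u'', ''x'', ''c'', ''h'', ''M'', ''par'', ''K'', ''i''} ?\<tau> \<tau>3"
        and msg: "\<And>\<rho>. \<rho> \<in> bag N \<inter> bag N \<rightarrow>\<^sub>E {..<k} \<Longrightarrow>
          \<tau>3 ''M'' (int N + (int N + 1) * int (code k (bag N \<inter> bag N) \<rho> n)) = message {} par M N N \<rho> mod modulus"
      have "code k {} \<rho> m = 0" for \<rho> m
        by (induction m) simp_all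
      then have "\<tau>3 ''M'' (int N) = message {} par M N N (\<lambda>_. undefined) mod modulus"
        using msg[of "\<lambda>_. undefined"] by simp
      also have "\<dots> = partition_function base eps n E mod modulus"
        using state by (simp add: dp_state_def flip: remaining_empty)
      finally have "\<tau>3 ''M'' (int N) = partition_function base eps n E mod modulus" .
      moreover have "env \<tau>3"
        using env \<tau>3 by (rule env_agree) (auto simp: env_names_def)
      moreover have "\<tau>3 ''out'' = (\<lambda>_. 0)"
        using zero(3) by (simp add: agreeD[OF \<tau>3] agreeD[OF \<tau>2] agreeD[OF \<tau>1])
      ultimately show "ok output_prog \<tau>3 ?Q"
        by (intro ok_output_prog)
    next
      fix c \<rho> assume c: "c < N" "par c = N" "\<rho> \<in> bag c \<inter> bag N \<rightarrow>\<^sub>E {..<k}"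
      have "\<forall>\<rho>\<in>bag c \<inter> bag (par c) \<rightarrow>\<^sub>E {..<k}. \<tau>2 ''M'' (int c + (int N + 1) *
          int (code k (bag c \<inter> bag (par c)) \<rho> n)) = M c \<rho> mod modulus"
        using state c(1) by (simp add: dp_state_def)
      then show "?\<tau> ''M'' (int c + (int N + 1) * int (code k (bag c \<inter> bag N) \<rho> n)) = M c \<rho> mod modulus"
        using c(2,3) by simp
    qed (use state in \<open>auto simp: dp_state_def\<close>)
    then show "ok ?c1 \<tau>2 ?Q"
      using capN by (intro ok_Seq[of "Assign _ _"] ok_Assign) (simp_all add: env_simps[OF env2])
  qed
qed

end

section \<open>The running time\<close>

text \<open>u is not assumed below m: the rows after the last one read 0, on which the dummy node
  relies.\<close>

lemma matrix_cells_at: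
  assumes "v < k"
  shows "matrix_cells m k P (int u * int k + int v) = of_bool (u < m \<and> P u v)"
proof -
  have "u = u' \<and> v = v'" if "int u * int k + int v = int (u' * k + v')" "v' < k" for u' v'
  proof -
    have eq: "u * k + v = u' * k + v'"
      using that(1) by (metis of_nat_add of_nat_eq_iff of_nat_mult)
    from arg_cong[OF eq, of "\<lambda>i. i div k"] arg_cong[OF eq, of "\<lambda>i. i mod k"] show ?thesis
      using assms that(2) by simp
  qed
  then have "(\<exists>u'<m. \<exists>v'<k. int u * int k + int v = int (u' * k + v') \<and> P u' v') \<longleftrightarrow> u < m \<and> P u v"
    using assms by (metis of_nat_add of_nat_mult)
  then show ?thesis
    unfolding matrix_cells_def by (simp only:)
qed

lemma bounded_input_store:
  assumes "int n \<le> 2 ^ L" "int N \<le> 2 ^ L"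
  shows "bounded_store L (input_store n E N F B)"
  using assms by (auto simp: bounded_store_def input_store_def matrix_cells_def of_bool_def)

context antifactor_run
begin

lemma exec_antifactor_prog:
  "\<exists>t \<tau>. exec antifactor_prog (input_store n E N F B) t \<tau> \<and> t \<le> com_weight \<nu> antifactor_prog * L \<and>
    (\<forall>s::int. \<tau> ''out'' s = int (card {S. antifactor_solution X {..<n} E S \<and> int (card S) = s}))"
proof -
  let ?\<sigma> = "input_store n E N F B"
  have "inputs ?\<sigma>"
    by (auto simp: inputs_def input_store_def matrix_cells_at ext_bag_def le_less)
  then have "ok antifactor_prog ?\<sigma> (\<lambda>\<tau>. \<forall>s::int. \<tau> ''out'' s =
      int (card {S. antifactor_solution X {..<n} E S \<and> int (card S) = s}))"
    by (rule ok_antifactor_prog) (auto simp: input_store_def)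
  moreover have "int N \<le> 2 ^ L"
    using cap_N by linarith
  then have "bounded_store L ?\<sigma>"
    using cap_n by (intro bounded_input_store)
  ultimately show ?thesis
    unfolding runs_def by blast
qed

end

text \<open>If all bags are empty, the subtraction in \<open>td_width\<close> is truncated at 0, and
  the bound still holds.\<close>

lemma card_ext_bag_le: "card (ext_bag N B t) \<le> td_width {..<N} B + 1"
proof (cases "t < N")
  case True
  then have "card (B t) \<le> Max ((\<lambda>t. card (B t)) ` {..<N})"
    by (intro Max_ge) auto
  then show ?thesis
    unfolding td_width_def ext_bag_def if_P[OF True] by linarith
qed (simp add: ext_bag_def)

lemma (in degree_weights) antifactor_prog_time:
  fixes q :: "nat poly"
  shows "\<exists>p :: nat poly. \<forall>n E N F B.
    simple_graph {..<n} E \<and> tree_decomposition {..<n} E {..<N} F B \<and> N \<le> poly q n \<longrightarrow>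
    (\<exists>t \<tau>. exec antifactor_prog (input_store n E N F B) t \<tau> \<and>
      t \<le> k ^ td_width {..<N} B * poly p n \<and>
      (\<forall>s::int. \<tau> ''out'' s = int (card {S. antifactor_solution X {..<n} E S \<and> int (card S) = s})))"
proof -
  obtain w where w: "\<And>m. com_weight ((\<lambda>_. m)(table_guard := 0)) antifactor_prog = poly w m"
    using com_weight_poly by blast
  \<comment> \<open>Bounds the rounds of every loop other than the one over assignments: their
    ranges are at most n^2 + 1 or N.\<close>
  define cp where "cp = [:1, 0, 1:] + q"
  \<comment> \<open>Bits that suffice for every cell: with (n^2 + 1)^2 + D n bits for \<epsilon>,
    the modulus takes K n + 1 times as many, and its multiple by k another k; k n bits hold a table
    index, and the remaining summands cover the counters.\<close>
  define Lp where "Lp = [:k, k:] + [:1, K:] * ([:1, 0, 1:] * [:1, 0, 1:] + [:0, nat D:]) + [:1, 0, 1:] + q + [:1:]"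
  show ?thesis
  \<comment> \<open>The factor 2 k absorbs two losses: a bag has up to width + 1 vertices, and the
    weight is linear in \<open>Suc T\<close>, which is at most 2 T.\<close>
  proof (intro exI[of _ "[:2 * k:] * pcompose w cp * Lp"] allI impI, elim conjE)
    fix n :: nat and E :: "nat set set" and N :: nat and F :: "nat set set" and B :: "nat \<Rightarrow> nat set"
    assume G: "simple_graph {..<n} E" and td: "tree_decomposition {..<n} E {..<N} F B" and N: "N \<le> poly q n"
    define L where "L = poly Lp n"
    define T where "T = k ^ (td_width {..<N} B + 1)"
    define \<nu> where "\<nu> = (\<lambda>_ :: aexp. poly cp n)(table_guard := T)"
    define base :: int where "base = 2 ^ (n * n + 1)"
    define eps where "eps = D ^ n * base ^ (n * n + 1)"
    define shift where "shift = eps ^ (K * n)"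
    define l where "l = (n * n + 1) * (n * n + 1) + nat D * n"
    have L: "L = k + k * n + (K * n + 1) * l + (n * n + 1) + poly q n + 1"
      by (simp add: L_def Lp_def l_def algebra_simps)
    have le_pow: "int m \<le> 2 ^ L" if "m \<le> 2 ^ m'" "m' \<le> L" for m m'
    proof -
      have "m \<le> 2 ^ L"
        using that(1) power_increasing[OF that(2), of "2::nat"] by linarith
      then have "int m \<le> int (2 ^ L)"
        by (simp only: of_nat_le_iff)
      then show ?thesis
        by simp
    qed
    have self_le: "m \<le> 2 ^ m" for m :: nat
      using less_exp[of m] by simp
    have D_le: "D \<le> 2 ^ nat D"
    proof -
      have "int (nat D) \<le> int (2 ^ nat D)"
        using self_le by (simp only: of_nat_le_iff)
      then show ?thesis
        using D_pos by simp
    qed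
    have "eps \<le> (2 ^ nat D) ^ n * base ^ (n * n + 1)"
      unfolding eps_def base_def using D_pos D_le by (intro mult_right_mono power_mono) auto
    also have "\<dots> = 2 ^ l"
      unfolding base_def l_def power_add[of 2 "(n * n + 1) * (n * n + 1)"]
      by (simp only: power_mult) (rule mult.commute)
    finally have eps_le: "eps \<le> 2 ^ l" .
    have "0 \<le> eps"
      using D_pos by (simp add: eps_def base_def)
    have "shift * eps = eps ^ (K * n + 1)"
      by (simp add: shift_def)
    also have "\<dots> \<le> (2 ^ l) ^ (K * n + 1)"
      using eps_le \<open>0 \<le> eps\<close> by (intro power_mono) auto
    finally have "int k * (shift * eps) \<le> 2 ^ k * (2 ^ l) ^ (K * n + 1)"
      using self_le[of k] \<open>0 \<le> eps\<close>
      by (intro mult_mono) (auto simp: shift_def simp flip: of_nat_le_iff)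
    also have "\<dots> = 2 ^ (k + l * (K * n + 1))"
      unfolding power_add[of 2 k] by (simp only: power_mult)
    also have "\<dots> \<le> 2 ^ L"
      by (intro power_increasing) (simp_all add: L mult.commute)
    finally have cap_modulus: "int k * (shift * eps) \<le> 2 ^ L" .
    have "k ^ n \<le> (2 ^ k) ^ n"
      by (intro power_mono self_le) simp
    then have "k ^ n \<le> 2 ^ (k * n)"
      by (simp only: power_mult)
    note caps = le_pow[OF self_le, of "n * n + 1"] le_pow[OF self_le, of "N + 1"] le_pow[OF this]
    interpret antifactor_run X K D d L \<nu> n N E F B base eps shift "shift * eps"
    proof
      show "1 \<le> L"
        by (simp add: L)
      show "k ^ card (ext_bag N B t) \<le> \<nu> table_guard" for t
        unfolding \<nu>_def T_def using power_increasing[OF card_ext_bag_le[of N B t], of k] by (simp add: Suc_le_eq)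
      show "n * n + 1 \<le> \<nu> e" "N \<le> \<nu> e" if "e \<noteq> table_guard" for e
        using that N by (simp_all add: \<nu>_def cp_def)
      show "int (n * n + 1) \<le> 2 ^ L" "int (N + 1) \<le> 2 ^ L" "int (k ^ n) \<le> 2 ^ L"
        using caps N unfolding L by auto
    qed (use G td base_def eps_def shift_def cap_modulus in auto)
    obtain t \<tau> where exec: "exec antifactor_prog (input_store n E N F B) t \<tau>"
      and t: "t \<le> com_weight \<nu> antifactor_prog * L"
      and out: "\<forall>s::int. \<tau> ''out'' s = int (card {S. antifactor_solution X {..<n} E S \<and> int (card S) = s})"
      using exec_antifactor_prog by blast
    have "1 \<le> T"
      unfolding T_def by (intro one_le_power) (simp add: Suc_le_eq)
    have "com_weight \<nu> antifactor_prog \<le> Suc T * poly w (poly cp n)"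
      using com_weight_unnested[OF unnested_antifactor_prog, of "\<lambda>_. poly cp n" T] w by (simp add: \<nu>_def)
    also have "\<dots> \<le> (2 * T) * poly w (poly cp n)"
      using \<open>1 \<le> T\<close> by (intro mult_le_mono1) simp
    finally have "t \<le> (2 * T) * poly w (poly cp n) * L"
      using t by (meson le_trans mult_le_mono1)
    also have "\<dots> = k ^ td_width {..<N} B * poly ([:2 * k:] * pcompose w cp * Lp) n"
      by (simp add: T_def L_def poly_pcompose mult_ac)
    finally show "\<exists>t \<tau>. exec antifactor_prog (input_store n E N F B) t \<tau> \<and>
        t \<le> k ^ td_width {..<N} B * poly ([:2 * k:] * pcompose w cp * Lp) n \<and>
        (\<forall>s::int. \<tau> ''out'' s = int (card {S. antifactor_solution X {..<n} E S \<and> int (card S) = s}))"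
      using exec out by blast
  qed
qed

theorem theorem1p3:
  fixes X :: "nat set"
  assumes "finite X"
  shows "\<exists>c :: com. \<forall>q :: nat poly. \<exists>p :: nat poly.
    \<forall>(n::nat) (E :: nat set set) (N::nat) (F :: nat set set) (B :: nat \<Rightarrow> nat set).
      simple_graph {..<n} E \<and> tree_decomposition {..<n} E {..<N} F B \<and> N \<le> poly q n \<longrightarrow>
      (\<exists>t \<tau>. exec c (input_store n E N F B) t \<tau> \<and>
         t \<le> (if X = {} then 1 else Max X + 2) ^ td_width {..<N} B * poly p n \<and>
         (\<forall>s::int. \<tau> ''out'' s =
            int (card {S. antifactor_solution X {..<n} E S \<and> int (card S) = s})))"
proof -
  \<comment> \<open>All elements of X are below K, and k = K + 1 is then Max X + 2. For empty X
    there is no coefficient to extract, and the point 1 is the only state.\<close>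
  define K where "K = (if X = {} then 0 else Max X + 1)"
  obtain D d where D: "D > (0::int)"
    and d: "\<And>m j. m < K \<Longrightarrow> j < K \<Longrightarrow> (\<Sum>i<K. d j i * int i ^ m) = (if m = j then D else 0)"
    using integer_interpolation[of K] by blast
  \<comment> \<open>Zeroing the rows outside X leaves only the forbidden degrees to be
    subtracted.\<close>
  interpret degree_weights X K D "\<lambda>j i. if j \<in> X then d j i else 0"
  proof
    show "j < K" if "j \<in> X" for j
      using that Max_ge[OF assms that] by (auto simp: K_def)
    show "(\<Sum>i<K. (if j \<in> X then d j i else 0) * int i ^ m) = (if m = j \<and> j \<in> X then D else 0)"
      if "m < K" "j < K" for m j
      using d[OF that] by (cases "j \<in> X") auto
  qed (rule D)
  have "k = (if X = {} then 1 else Max X + 2)"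
    unfolding k_def by (simp add: K_def)
  then show ?thesis
    using antifactor_prog_time by (intro exI[of _ antifactor_prog] allI) (simp only:)
qed

end
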